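(* Let $(M, g)$ be a causally non-branching, non-intertwining $C^1$-spacetime. Then the causal exponential map $\exp_p \colon \mathcal{E}_p \to M$ at $p$ is continuous for every $p \in M$.
   Context: **$C^1$-spacetime**: a smooth manifold $M$ with a time-oriented Lorentzian metric $g$ (signature $(-,+,\dots,+)$) of class $C^1$. **Geodesic**: a $C^2$-curve $\gamma\colon I\to M$ solving $\ddot\gamma^k+\sum_{i,j}\Gamma^k_{ij}\dot\gamma^i\dot\gamma^j=0$ in charts, where $\Gamma^k_{ij}=\frac12\sum_l g^{kl}(\partial_ig_{jl}+\partial_jg_{il}-\partial_lg_{ij})$ are the (continuous) Christoffel symbols. It is causal if its tangent vector is causal. **Causally non-branching**: no causal geodesic branches. A geodesic $\gamma\colon[a,b]\to M$ branches at $t_0\in(a,b)$ if there exist $\epsilon>0$ (with $(t_0-\epsilon,t_0+\epsilon)\subset[a,b]$) and a geodesic $\sigma\colon(t_0-\epsilon,t_0+\epsilon)\to M$ with $\gamma|_{(t_0-\epsilon,t_0]}=\sigma|_{(t_0-\epsilon,t_0]}$ and $\gamma((t_0,t_0+\epsilon))\cap\sigma((t_0,t_0+\epsilon))=\emptyset$. **Non-intertwining**: every $p\in M$ has a neighborhood $U$ such that for any $\varepsilon>0$ and any causal geodesics $\gamma_1,\gamma_2\colon[0,\varepsilon]\to U$ starting at $p$ with the same initial velocity, either $\gamma_1(t)=\gamma_2(t)$ for all $t\in[0,\varepsilon]$, or $\gamma_1((0,\varepsilon])\cap\gamma_2((0,\varepsilon])$ has no accumulation point (in $M$). **Causal exponential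 map.** Under these two hypotheses causal geodesics with the same initial point and velocity coincide on common intervals, so for $v\in T_pM$ with $g_p(v,v)\leq0$ let $\gamma_v$ be the geodesic with $\gamma_v(0)=p$, $\dot\gamma_v(0)=v$, on its maximal interval of existence (constant if $v=0$). Then $\mathcal{E}_p=\{v\in T_pM: g_p(v,v)\leq0,\ \gamma_v\text{ is defined on an interval containing }[0,1]\}$, with the subspace topology of $T_pM$, and $\exp_p(v)=\gamma_v(1)$. *)

theory Defs
  imports "HOL-Analysis.Analysis"
begin

section \<open>Smooth atlases\<close>

text \<open>Only used for open S in finite-dimensional spaces, where it is the usual notion of a map of
  class C^k.\<close>

fun Ck_on :: "nat \<Rightarrow> 'a::real_normed_vector set \<Rightarrow> ('a \<Rightarrow> 'b::real_normed_vector) \<Rightarrow> bool" where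
  "Ck_on 0 S f \<longleftrightarrow> continuous_on S f"
| "Ck_on (Suc k) S f \<longleftrightarrow>
    (\<forall>x\<in>S. f differentiable (at x)) \<and> (\<forall>v. Ck_on k S (\<lambda>x. frechet_derivative f (at x) v))"

definition smooth_on :: "'a::real_normed_vector set \<Rightarrow> ('a \<Rightarrow> 'b::real_normed_vector) \<Rightarrow> bool" where
  "smooth_on S f \<longleftrightarrow> (\<forall>k. Ck_on k S f)"

text \<open>A chart is a pair of an open domain and a coordinate map; the values of the coordinate map
  outside of the domain are irrelevant.\<close>

type_synonym ('m, 'n) chart = "'m set \<times> ('m \<Rightarrow> real ^ 'n)"

abbreviation cdom :: "('m, 'n) chart \<Rightarrow> 'm set" where
  "cdom c \<equiv> fst c"

abbreviation cmap :: "('m, 'n) chart \<Rightarrow> 'm \<Rightarrow> real ^ 'n" where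
  "cmap c \<equiv> snd c"

abbreviation cinv :: "('m, 'n) chart \<Rightarrow> real ^ 'n \<Rightarrow> 'm" where
  "cinv c \<equiv> inv_into (cdom c) (cmap c)"

text \<open>The manifold is the whole type, of dimension \<open>CARD('n)\<close>. The smooth structure is given by an
  arbitrary smooth atlas, maximal or not.\<close>

locale smooth_manifold =
  fixes A :: "('m::{t2_space, second_countable_topology}, 'n::finite) chart set"
  assumes open_cdom: "c \<in> A \<Longrightarrow> open (cdom c)"
    and open_cimage: "c \<in> A \<Longrightarrow> open (cmap c ` cdom c)"
    and chart_homeomorphism:
      "c \<in> A \<Longrightarrow> homeomorphism (cdom c) (cmap c ` cdom c) (cmap c) (cinv c)"
    and charts_cover: "(\<Union>c\<in>A. cdom c) = UNIV"
    and charts_compatible: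
      "c \<in> A \<Longrightarrow> d \<in> A \<Longrightarrow> smooth_on (cmap c ` (cdom c \<inter> cdom d)) (cmap d \<circ> cinv c)"

section \<open>Tangent spaces\<close>

text \<open>A tangent vector at p is the family of its coordinate representations in the charts around p,
  related by the derivatives of the transition maps, and extended by 0 to all other indices.
  Vector space operations are pointwise, and the topology is that of pointwise convergence. It is
  the usual topology of the finite-dimensional vector space, see \<open>tangent_space_homeomorphism\<close>
  below.\<close>

type_synonym ('m, 'n) tvec = "('m, 'n) chart \<Rightarrow> real ^ 'n"

definition charts_at :: "('m, 'n) chart set \<Rightarrow> 'm \<Rightarrow> ('m, 'n) chart set" where
  "charts_at A p = {c \<in> A. p \<in> cdom c}"

definition tangent_space ::
    "('m, 'n::finite) chart set \<Rightarrow> 'm \<Rightarrow> ('m, 'n) tvec set" where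
  "tangent_space A p =
    {v. (\<forall>c. c \<notin> charts_at A p \<longrightarrow> v c = 0) \<and>
        (\<forall>c\<in>charts_at A p. \<forall>d\<in>charts_at A p.
           v d = frechet_derivative (cmap d \<circ> cinv c) (at (cmap c p)) (v c))}"

text \<open>The tangent vector at p with coordinates x in the chart c.\<close>

definition tvec_of_coords ::
    "('m, 'n::finite) chart set \<Rightarrow> ('m, 'n) chart \<Rightarrow> 'm \<Rightarrow> real ^ 'n \<Rightarrow> ('m, 'n) tvec" where
  "tvec_of_coords A c p x =
    (\<lambda>d. if d \<in> charts_at A p
         then frechet_derivative (cmap d \<circ> cinv c) (at (cmap c p)) x else 0)"

abbreviation coord_vec ::
    "('m, 'n::finite) chart set \<Rightarrow> ('m, 'n) chart \<Rightarrow> 'm \<Rightarrow> 'n \<Rightarrow> ('m, 'n) tvec" where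
  "coord_vec A c p i \<equiv> tvec_of_coords A c p (axis i 1)"

section \<open>Spacetimes with a metric of class C^1\<close>

type_synonym ('m, 'n) metric_field = "'m \<Rightarrow> ('m, 'n) tvec \<Rightarrow> ('m, 'n) tvec \<Rightarrow> real"

text \<open>The component functions of the metric in the chart c, as functions of the coordinates.\<close>

definition metric_comp ::
    "('m, 'n::finite) chart set \<Rightarrow> ('m, 'n) metric_field \<Rightarrow> ('m, 'n) chart \<Rightarrow> 'n \<Rightarrow> 'n
      \<Rightarrow> real ^ 'n \<Rightarrow> real" where
  "metric_comp A g c i j x =
    g (cinv c x) (coord_vec A c (cinv c x) i) (coord_vec A c (cinv c x) j)"

text \<open>In \<open>metric_signature\<close>, the family e consists of \<open>CARD('n)\<close> orthonormal vectors and hence is a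
  basis of the tangent space. The time orientation is represented by a continuous timelike vector
  field T.\<close>

locale C1_spacetime = smooth_manifold A
  for A :: "('m::{t2_space, second_countable_topology}, 'n::finite) chart set" +
  fixes g :: "('m, 'n) metric_field"
    and T :: "'m \<Rightarrow> ('m, 'n) tvec"
  assumes metric_sym:
      "u \<in> tangent_space A p \<Longrightarrow> v \<in> tangent_space A p \<Longrightarrow> g p u v = g p v u"
    and metric_linear:
      "u \<in> tangent_space A p \<Longrightarrow> v \<in> tangent_space A p \<Longrightarrow> w \<in> tangent_space A p \<Longrightarrow>
        g p (\<lambda>c. a *\<^sub>R u c + b *\<^sub>R v c) w = a * g p u w + b * g p v w"
    and metric_signature:
      "\<exists>e i\<^sub>0. (\<forall>i::'n. e i \<in> tangent_space A p) \<and>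
        (\<forall>i j. g p (e i) (e j) = (if i \<noteq> j then 0 else if i = i\<^sub>0 then - 1 else 1))"
    and metric_C1: "c \<in> A \<Longrightarrow> Ck_on 1 (cmap c ` cdom c) (metric_comp A g c i j)"
    and orientation_tangent: "T p \<in> tangent_space A p"
    and orientation_timelike: "g p (T p) (T p) < 0"
    and orientation_continuous: "c \<in> A \<Longrightarrow> continuous_on (cdom c) (\<lambda>p. T p c)"

definition causal_vector :: "('m, 'n::finite) metric_field \<Rightarrow> 'm \<Rightarrow> ('m, 'n) tvec \<Rightarrow> bool" where
  "causal_vector g p v \<longleftrightarrow> v \<noteq> (\<lambda>c. 0) \<and> g p v v \<le> 0"

section \<open>Geodesics\<close>

definition metric_matrix ::
    "('m, 'n::finite) chart set \<Rightarrow> ('m, 'n) metric_field \<Rightarrow> ('m, 'n) chart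
      \<Rightarrow> real ^ 'n \<Rightarrow> real ^ 'n ^ 'n" where
  "metric_matrix A g c x = (\<chi> i j. metric_comp A g c i j x)"

definition metric_partial ::
    "('m, 'n::finite) chart set \<Rightarrow> ('m, 'n) metric_field \<Rightarrow> ('m, 'n) chart
      \<Rightarrow> 'n \<Rightarrow> 'n \<Rightarrow> 'n \<Rightarrow> real ^ 'n \<Rightarrow> real" where
  "metric_partial A g c i j l x = frechet_derivative (metric_comp A g c j l) (at x) (axis i 1)"

definition christoffel ::
    "('m, 'n::finite) chart set \<Rightarrow> ('m, 'n) metric_field \<Rightarrow> ('m, 'n) chart
      \<Rightarrow> 'n \<Rightarrow> 'n \<Rightarrow> 'n \<Rightarrow> real ^ 'n \<Rightarrow> real" where
  "christoffel A g c k i j x =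
    1/2 * (\<Sum>l\<in>UNIV. matrix_inv (metric_matrix A g c x) $ k $ l *
      (metric_partial A g c i j l x + metric_partial A g c j i l x - metric_partial A g c l i j x))"

text \<open>Derivatives are taken within the interval I, i.e. they are one-sided at end points of I that
  belong to I.\<close>

definition cvel :: "('m, 'n::finite) chart \<Rightarrow> real set \<Rightarrow> (real \<Rightarrow> 'm) \<Rightarrow> real \<Rightarrow> real ^ 'n" where
  "cvel c I \<gamma> t = vector_derivative (cmap c \<circ> \<gamma>) (at t within I)"

definition cacc :: "('m, 'n::finite) chart \<Rightarrow> real set \<Rightarrow> (real \<Rightarrow> 'm) \<Rightarrow> real \<Rightarrow> real ^ 'n" where
  "cacc c I \<gamma> t = vector_derivative (cvel c I \<gamma>) (at t within I)"

definition velocity ::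
    "('m, 'n::finite) chart set \<Rightarrow> real set \<Rightarrow> (real \<Rightarrow> 'm) \<Rightarrow> real \<Rightarrow> ('m, 'n) tvec" where
  "velocity A I \<gamma> t = (\<lambda>c. if c \<in> charts_at A (\<gamma> t) then cvel c I \<gamma> t else 0)"

definition C2_curve ::
    "('m::topological_space, 'n::finite) chart set \<Rightarrow> real set \<Rightarrow> (real \<Rightarrow> 'm) \<Rightarrow> bool" where
  "C2_curve A I \<gamma> \<longleftrightarrow>
    is_interval I \<and> interior I \<noteq> {} \<and> continuous_on I \<gamma> \<and>
    (\<forall>c\<in>A. (\<forall>t\<in>I. \<gamma> t \<in> cdom c \<longrightarrow>
               (cmap c \<circ> \<gamma>) differentiable (at t within I) \<and>
               cvel c I \<gamma> differentiable (at t within I)) \<and>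
           continuous_on {t \<in> I. \<gamma> t \<in> cdom c} (cacc c I \<gamma>))"

definition geodesic ::
    "('m::topological_space, 'n::finite) chart set \<Rightarrow> ('m, 'n) metric_field
      \<Rightarrow> real set \<Rightarrow> (real \<Rightarrow> 'm) \<Rightarrow> bool" where
  "geodesic A g I \<gamma> \<longleftrightarrow>
    C2_curve A I \<gamma> \<and>
    (\<forall>c\<in>A. \<forall>t\<in>I. \<gamma> t \<in> cdom c \<longrightarrow>
      (\<forall>k. cacc c I \<gamma> t $ k +
        (\<Sum>i\<in>UNIV. \<Sum>j\<in>UNIV. christoffel A g c k i j (cmap c (\<gamma> t)) *
           cvel c I \<gamma> t $ i * cvel c I \<gamma> t $ j) = 0))"

definition causal_geodesic ::
    "('m::topological_space, 'n::finite) chart set \<Rightarrow> ('m, 'n) metric_field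
      \<Rightarrow> real set \<Rightarrow> (real \<Rightarrow> 'm) \<Rightarrow> bool" where
  "causal_geodesic A g I \<gamma> \<longleftrightarrow>
    geodesic A g I \<gamma> \<and> (\<forall>t\<in>I. causal_vector g (\<gamma> t) (velocity A I \<gamma> t))"

definition branches_at ::
    "('m::topological_space, 'n::finite) chart set \<Rightarrow> ('m, 'n) metric_field
      \<Rightarrow> real \<Rightarrow> real \<Rightarrow> (real \<Rightarrow> 'm) \<Rightarrow> real \<Rightarrow> bool" where
  "branches_at A g a b \<gamma> t\<^sub>0 \<longleftrightarrow>
    (\<exists>\<epsilon>>0. {t\<^sub>0 - \<epsilon><..<t\<^sub>0 + \<epsilon>} \<subseteq> {a..b} \<and>
      (\<exists>\<sigma>. geodesic A g {t\<^sub>0 - \<epsilon><..<t\<^sub>0 + \<epsilon>} \<sigma> \<and>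
           (\<forall>t\<in>{t\<^sub>0 - \<epsilon><..t\<^sub>0}. \<gamma> t = \<sigma> t) \<and>
           \<gamma> ` {t\<^sub>0<..<t\<^sub>0 + \<epsilon>} \<inter> \<sigma> ` {t\<^sub>0<..<t\<^sub>0 + \<epsilon>} = {}))"

definition causally_non_branching ::
    "('m::topological_space, 'n::finite) chart set \<Rightarrow> ('m, 'n) metric_field \<Rightarrow> bool" where
  "causally_non_branching A g \<longleftrightarrow>
    (\<forall>a b \<gamma>. a < b \<and> causal_geodesic A g {a..b} \<gamma> \<longrightarrow>
      \<not> (\<exists>t\<^sub>0\<in>{a<..<b}. branches_at A g a b \<gamma> t\<^sub>0))"

definition non_intertwining ::
    "('m::topological_space, 'n::finite) chart set \<Rightarrow> ('m, 'n) metric_field \<Rightarrow> bool" where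
  "non_intertwining A g \<longleftrightarrow>
    (\<forall>p. \<exists>U. p \<in> interior U \<and>
      (\<forall>\<epsilon>>0. \<forall>\<gamma>\<^sub>1 \<gamma>\<^sub>2.
        causal_geodesic A g {0..\<epsilon>} \<gamma>\<^sub>1 \<and> causal_geodesic A g {0..\<epsilon>} \<gamma>\<^sub>2 \<and>
        \<gamma>\<^sub>1 ` {0..\<epsilon>} \<subseteq> U \<and> \<gamma>\<^sub>2 ` {0..\<epsilon>} \<subseteq> U \<and> \<gamma>\<^sub>1 0 = p \<and> \<gamma>\<^sub>2 0 = p \<and>
        velocity A {0..\<epsilon>} \<gamma>\<^sub>1 0 = velocity A {0..\<epsilon>} \<gamma>\<^sub>2 0 \<longrightarrow>
        (\<forall>t\<in>{0..\<epsilon>}. \<gamma>\<^sub>1 t = \<gamma>\<^sub>2 t) \<or>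
        \<not> (\<exists>q. q islimpt (\<gamma>\<^sub>1 ` {0<..\<epsilon>} \<inter> \<gamma>\<^sub>2 ` {0<..\<epsilon>}))))"

section \<open>The causal exponential map\<close>

definition geodesic_from ::
    "('m::topological_space, 'n::finite) chart set \<Rightarrow> ('m, 'n) metric_field
      \<Rightarrow> 'm \<Rightarrow> ('m, 'n) tvec \<Rightarrow> real set \<Rightarrow> (real \<Rightarrow> 'm) \<Rightarrow> bool" where
  "geodesic_from A g p v I \<gamma> \<longleftrightarrow>
    geodesic A g I \<gamma> \<and> 0 \<in> I \<and> \<gamma> 0 = p \<and> velocity A I \<gamma> 0 = v \<and>
    (v = (\<lambda>c. 0) \<longrightarrow> (\<forall>t\<in>I. \<gamma> t = p))"

definition maximal_geodesic_from ::
    "('m::topological_space, 'n::finite) chart set \<Rightarrow> ('m, 'n) metric_field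
      \<Rightarrow> 'm \<Rightarrow> ('m, 'n) tvec \<Rightarrow> real set \<Rightarrow> (real \<Rightarrow> 'm) \<Rightarrow> bool" where
  "maximal_geodesic_from A g p v I \<gamma> \<longleftrightarrow>
    geodesic_from A g p v I \<gamma> \<and>
    (\<forall>J \<sigma>. geodesic_from A g p v J \<sigma> \<and> I \<subseteq> J \<and> (\<forall>t\<in>I. \<sigma> t = \<gamma> t) \<longrightarrow> J = I)"

definition causal_exp_domain ::
    "('m::topological_space, 'n::finite) chart set \<Rightarrow> ('m, 'n) metric_field
      \<Rightarrow> 'm \<Rightarrow> ('m, 'n) tvec set" where
  "causal_exp_domain A g p =
    {v \<in> tangent_space A p. g p v v \<le> 0 \<and>
      (\<exists>I \<gamma>. maximal_geodesic_from A g p v I \<gamma> \<and> {0..1} \<subseteq> I)}"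

text \<open>The maximal interval and the values of the maximal geodesic on it are unique for causally
  non-branching, non-intertwining spacetimes. The values outside of the interval are arbitrary,
  hence the description of the end point rather than of the curve.\<close>

definition causal_exp ::
    "('m::topological_space, 'n::finite) chart set \<Rightarrow> ('m, 'n) metric_field
      \<Rightarrow> 'm \<Rightarrow> ('m, 'n) tvec \<Rightarrow> 'm" where
  "causal_exp A g p v =
    (THE q. \<exists>I \<gamma>. maximal_geodesic_from A g p v I \<gamma> \<and> {0..1} \<subseteq> I \<and> \<gamma> 1 = q)"

section \<open>The topology of the tangent space\<close>

context smooth_manifold
begin

lemma transition_differentiable:
  assumes "c \<in> charts_at A p" "d \<in> charts_at A p"
  shows "(cmap d \<circ> cinv c) differentiable (at (cmap c p))"
proof -
  have "Ck_on (Suc 0) (cmap c ` (cdom c \<inter> cdom d)) (cmap d \<circ> cinv c)"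
    using charts_compatible assms unfolding smooth_on_def charts_at_def by blast
  then show ?thesis using assms by (auto simp: charts_at_def)
qed

lemma cinv_cmap:
  assumes "c \<in> charts_at A p"
  shows "cinv c (cmap c p) = p"
  using chart_homeomorphism assms unfolding homeomorphism_def charts_at_def by blast

lemma transition_cocycle:
  assumes c: "c \<in> charts_at A p" and d: "d \<in> charts_at A p" and e: "e \<in> charts_at A p"
  shows "frechet_derivative (cmap e \<circ> cinv d) (at (cmap d p))
           (frechet_derivative (cmap d \<circ> cinv c) (at (cmap c p)) x) =
         frechet_derivative (cmap e \<circ> cinv c) (at (cmap c p)) x"
proof -
  let ?f = "cmap d \<circ> cinv c" and ?g = "cmap e \<circ> cinv d"
  have fp: "?f (cmap c p) = cmap d p" by (simp add: cinv_cmap c)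
  have f: "(?f has_derivative frechet_derivative ?f (at (cmap c p))) (at (cmap c p))"
    using transition_differentiable[OF c d] frechet_derivative_works by blast
  have g: "(?g has_derivative frechet_derivative ?g (at (cmap d p))) (at (cmap d p))"
    using transition_differentiable[OF d e] frechet_derivative_works by blast
  have gf: "(?g \<circ> ?f has_derivative
      frechet_derivative ?g (at (cmap d p)) \<circ> frechet_derivative ?f (at (cmap c p))) (at (cmap c p))"
    using diff_chain_at[OF f] g fp by simp
  have hom: "homeomorphism (cdom c) (cmap c ` cdom c) (cmap c) (cinv c)"
    and A: "c \<in> A" "d \<in> A" "p \<in> cdom c" "p \<in> cdom d"
    using c d chart_homeomorphism by (auto simp: charts_at_def)
  define W where "W = cmap c ` cdom c \<inter> cinv c -` cdom d"
  have W: "open W" unfolding W_def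
    using hom open_cimage open_cdom A continuous_open_preimage
    by (metis homeomorphism_def)
  have pW: "cmap c p \<in> W" using A cinv_cmap[OF c] by (simp add: W_def)
  have "(cmap e \<circ> cinv c has_derivative
      frechet_derivative ?g (at (cmap d p)) \<circ> frechet_derivative ?f (at (cmap c p))) (at (cmap c p))"
  proof (rule has_derivative_transform_within_open[OF gf W pW])
    fix y assume "y \<in> W"
    then have "cinv d (cmap d (cinv c y)) = cinv c y"
      using cinv_cmap[of d "cinv c y"] A by (simp add: W_def charts_at_def)
    then show "(?g \<circ> ?f) y = (cmap e \<circ> cinv c) y" by simp
  qed
  from frechet_derivative_at[OF this] show ?thesis by (metis comp_apply)
qed

lemma tvec_of_coords_in_tangent_space:
  assumes "c \<in> charts_at A p"
  shows "tvec_of_coords A c p x \<in> tangent_space A p"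
  using transition_cocycle[OF assms]
  by (auto simp: tangent_space_def tvec_of_coords_def)

lemma tvec_of_coords_self:
  assumes "c \<in> charts_at A p"
  shows "tvec_of_coords A c p x c = x"
proof -
  have A: "c \<in> A" "p \<in> cdom c" using assms by (auto simp: charts_at_def)
  have "(id has_derivative id) (at (cmap c p))" by (rule has_derivative_id)
  then have "(cmap c \<circ> cinv c has_derivative id) (at (cmap c p))"
    by (rule has_derivative_transform_within_open[OF _ open_cimage[OF A(1)]])
       (use A chart_homeomorphism in \<open>auto simp: homeomorphism_def\<close>)
  from frechet_derivative_at[OF this] show ?thesis
    using assms by (simp add: tvec_of_coords_def flip: id_def)
qed

text \<open>Every chart around p identifies the tangent space at p homeomorphically with the
  coordinate space.\<close>

lemma tangent_space_homeomorphism: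
  assumes c: "c \<in> charts_at A p"
  shows "homeomorphism (tangent_space A p) UNIV (\<lambda>v. v c) (tvec_of_coords A c p)"
proof (rule homeomorphismI)
  show "continuous_on (tangent_space A p) (\<lambda>v. v c)"
    by (rule continuous_on_subset[OF continuous_on_product_coordinates subset_UNIV])
  show "continuous_on UNIV (tvec_of_coords A c p)"
  proof (rule continuous_on_coordinatewise_then_product)
    fix d
    show "continuous_on UNIV (\<lambda>x. tvec_of_coords A c p x d)"
    proof (cases "d \<in> charts_at A p")
      case True
      then show ?thesis
        using linear_frechet_derivative[OF transition_differentiable[OF c True]]
        by (simp add: tvec_of_coords_def linear_continuous_on linear_conv_bounded_linear[symmetric])
    qed (simp add: tvec_of_coords_def)
  qed
  show "tvec_of_coords A c p ` UNIV \<subseteq> tangent_space A p"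
    using tvec_of_coords_in_tangent_space[OF c] by auto
  show "tvec_of_coords A c p (v c) = v" if v: "v \<in> tangent_space A p" for v
  proof
    fix d
    have "v d = 0" if "d \<notin> charts_at A p"
      using v that unfolding tangent_space_def by blast
    moreover have "v d = frechet_derivative (cmap d \<circ> cinv c) (at (cmap c p)) (v c)"
      if "d \<in> charts_at A p"
      using v c that unfolding tangent_space_def by blast
    ultimately show "tvec_of_coords A c p (v c) d = v d"
      unfolding tvec_of_coords_def by presburger
  qed
  show "(\<lambda>v. v c) ` tangent_space A p \<subseteq> UNIV" by (rule subset_UNIV)
  show "tvec_of_coords A c p x c = x" for x by (rule tvec_of_coords_self[OF c])
qed

end

end

theory Submission
  imports Defs "HOL-Complex_Analysis.Great_Picard"
begin

text \<open>In a chart, geodesics solve a first-order equation for position and velocity with continuous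
  right-hand side. Peano's theorem extends a solution backwards, so two causal geodesics with common
  initial data that do not coincide would branch: by the non-intertwining condition their images
  meet in a finite set only, hence not at all for small positive times. So causal
  initial data have a unique solution in each chart. By Arzela-Ascoli, geodesics whose initial data
  converge to causal initial data accumulate at a solution with the limit data, and uniqueness makes
  the whole sequence converge. This propagates along the compact interval [0,1] from chart to chart;
  constant sequences show that the exponential map is well defined.\<close>

section \<open>Ordinary differential equations with continuous right-hand side\<close>

text \<open>The Christoffel symbols of a C^1 metric are merely continuous, so neither uniqueness nor
  continuous dependence comes from Picard-Lindelof; both have to be extracted from the two
  hypotheses. These concern causal, hence nonzero, velocities, and branching is a two-sided notion
  about images. This forces three additional arguments: solutions receive a past so that the initial
  time becomes interior; zero velocity is treated separately by a quadratic estimate; and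
  conservation of \<open>g(u,u)\<close> carries causality from the initial time to all later ones.
  Uniqueness is applied to the limit curve alone, so the convergence argument asks no causality of
  the approximating geodesics. A further obstacle is that \<open>geodesic\<close> demands the
  equation in every chart of the atlas, whereas solutions are produced in a single one; the bridge
  is the transformation law of the acceleration under a change of charts.\<close>

lemma real_induction:
  fixes a b :: real
  assumes closed: "\<And>t. t \<in> {a..b} \<Longrightarrow> (\<And>s. s \<in> {a..<t} \<Longrightarrow> P s) \<Longrightarrow> P t"
    and "open": "\<And>t. t \<in> {a..<b} \<Longrightarrow> (\<And>s. s \<in> {a..t} \<Longrightarrow> P s) \<Longrightarrow>
      \<exists>e>0. \<forall>s. t < s \<and> s < t + e \<and> s \<le> b \<longrightarrow> P s"
    and t: "t \<in> {a..b}"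
  shows "P t"
proof (rule ccontr)
  assume "\<not> P t"
  define B where "B = {s \<in> {a..b}. \<not> P s}"
  define m where "m = Inf B"
  have tB: "t \<in> B" using t \<open>\<not> P t\<close> by (simp add: B_def)
  have bdd: "bdd_below B" by (rule bdd_belowI[of _ a]) (simp add: B_def)
  have am: "a \<le> m" unfolding m_def using tB by (intro cInf_greatest) (auto simp: B_def)
  have mt: "m \<le> t" unfolding m_def using tB bdd by (rule cInf_lower)
  have before: "P s" if "s \<in> {a..<m}" for s
    using cInf_lower[OF _ bdd, of s] that mt t by (auto simp: m_def B_def)
  have Pm: "P m" using closed[of m] before am mt t by auto
  with mt t \<open>\<not> P t\<close> have mb: "m < b" by (cases "m = t") auto
  have upto: "P s" if "s \<in> {a..m}" for s
    using that before Pm by (cases "s = m") auto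
  from "open"[of m] am mb upto obtain e where e: "e > 0"
      "\<And>s. m < s \<Longrightarrow> s < m + e \<Longrightarrow> s \<le> b \<Longrightarrow> P s" by auto
  have "m + e \<le> m" unfolding m_def
  proof (subst m_def[symmetric], rule cInf_greatest)
    show "B \<noteq> {}" using tB by blast
    fix s assume s: "s \<in> B"
    then have "m \<le> s" unfolding m_def using bdd by (intro cInf_lower)
    with s Pm have "m < s" by (cases "m = s") (auto simp: B_def)
    with e(2)[of s] s show "m + e \<le> s" by (fastforce simp: B_def not_less[symmetric])
  qed
  with e(1) show False by simp
qed

lemma vector_derivative_bound_imp_lipschitz:
  fixes f :: "real \<Rightarrow> 'a::real_normed_vector"
  assumes "\<And>t. t \<in> {a..b} \<Longrightarrow> (f has_vector_derivative f' t) (at t within {a..b})"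
    and "\<And>t. t \<in> {a..b} \<Longrightarrow> norm (f' t) \<le> B"
    and "s \<in> {a..b}" "t \<in> {a..b}"
  shows "norm (f s - f t) \<le> B * \<bar>s - t\<bar>"
proof -
  have "norm (f s - f t) \<le> B * norm (s - t)"
  proof (rule differentiable_bound[where S = "{a..b}" and f' = "\<lambda>t h. h *\<^sub>R f' t"])
    show "onorm (\<lambda>h. h *\<^sub>R f' x) \<le> B" if "x \<in> {a..b}" for x
      using mult_right_mono[OF assms(2)[OF that] abs_ge_zero]
      by (intro onorm_le) (simp add: mult.commute)
  qed (use assms in \<open>auto simp: has_vector_derivative_def\<close>)
  then show ?thesis by simp
qed

text \<open>The equation is only required up to an error that tends to 0 uniformly. So the lemma
  covers both the delayed approximants of Peano's theorem and sequences of exact solutions, where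
  \<open>f n t = F (z n t)\<close>.\<close>

lemma approximate_solutions_subsequence:
  fixes z :: "nat \<Rightarrow> real \<Rightarrow> 'a::euclidean_space"
  assumes ab: "a \<le> b" and K: "compact K" and F: "continuous_on K F"
    and zK: "\<And>n t. t \<in> {a..b} \<Longrightarrow> z n t \<in> K"
    and zd: "\<And>n t. t \<in> {a..b} \<Longrightarrow> (z n has_vector_derivative f n t) (at t within {a..b})"
    and err: "\<And>e. e > 0 \<Longrightarrow> \<forall>\<^sub>F n in sequentially. \<forall>t\<in>{a..b}. norm (f n t - F (z n t)) < e"
  obtains y k where "strict_mono (k :: nat \<Rightarrow> nat)"
    "\<And>t. t \<in> {a..b} \<Longrightarrow> (y has_vector_derivative F (y t)) (at t within {a..b})"
    "\<And>t. t \<in> {a..b} \<Longrightarrow> y t \<in> K"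
    "\<And>t. t \<in> {a..b} \<Longrightarrow> (\<lambda>n. z (k n) t) \<longlonglongrightarrow> y t"
proof -
  obtain N where N: "\<And>n t. n \<ge> N \<Longrightarrow> t \<in> {a..b} \<Longrightarrow> norm (f n t - F (z n t)) < 1"
    using err[of 1] unfolding eventually_sequentially by (meson zero_less_one)
  obtain M where M: "\<And>w. w \<in> K \<Longrightarrow> norm (F w) \<le> M"
    using compact_imp_bounded[OF compact_continuous_image[OF F K]] by (auto simp: bounded_iff)
  obtain R where R: "\<And>w. w \<in> K \<Longrightarrow> norm w \<le> R"
    using compact_imp_bounded[OF K] by (auto simp: bounded_iff)
  have M0: "0 \<le> M" using M[OF zK[of a 0]] ab norm_ge_zero order_trans by (metis atLeastAtMost_iff order_refl)
  have fb: "norm (f n t) \<le> M + 1" if "n \<ge> N" "t \<in> {a..b}" for n t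
    using N[OF that] M[OF zK[OF that(2)], of n]
      norm_triangle_ineq[of "f n t - F (z n t)" "F (z n t)"] by simp
  have lip: "norm (z n s - z n t) \<le> (M + 1) * \<bar>s - t\<bar>"
    if "n \<ge> N" "s \<in> {a..b}" "t \<in> {a..b}" for n s t
    using vector_derivative_bound_imp_lipschitz[OF zd fb] that by blast
  \<comment> \<open>\<open>Arzela_Ascoli\<close> wants its bounds for every index, whereas the
    Lipschitz constant \<open>M + 1\<close> is available from \<open>N\<close> on only; hence the
    shift of the sequence by \<open>N\<close>.\<close>
  have equi: "\<exists>d. 0 < d \<and> (\<forall>n y. y \<in> {a..b} \<and> norm (x - y) < d \<longrightarrow>
      norm (z (n + N) x - z (n + N) y) < e)" if x: "x \<in> {a..b}" and e: "0 < e" for x e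
  proof (intro exI conjI allI impI)
    show "0 < e / (M + 1)" using e M0 by simp
    fix n y assume y: "y \<in> {a..b} \<and> norm (x - y) < e / (M + 1)"
    then have "norm (z (n + N) x - z (n + N) y) \<le> (M + 1) * \<bar>x - y\<bar>" using lip x by simp
    also have "\<dots> < e" using y M0 by (simp add: field_simps)
    finally show "norm (z (n + N) x - z (n + N) y) < e" .
  qed
  have bd: "norm (z (n + N) x) \<le> R" if "x \<in> {a..b}" for n x
    using R[OF zK[OF that]] .
  obtain y k0 where y: "continuous_on {a..b} y" "strict_mono (k0 :: nat \<Rightarrow> nat)"
    and lim0: "\<And>e. 0 < e \<Longrightarrow> \<exists>n0. \<forall>n x. n \<ge> n0 \<and> x \<in> {a..b} \<longrightarrow> norm (z (k0 n + N) x - y x) < e"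
    using Arzela_Ascoli[of "{a..b}" "\<lambda>n. z (n + N)", OF compact_Icc bd equi] by metis
  define k where "k n = k0 n + N" for n
  have k: "strict_mono k" using y(2) by (simp add: k_def strict_mono_def)
  have ul: "uniform_limit {a..b} (\<lambda>n. z (k n)) y sequentially"
    unfolding uniform_limit_iff eventually_sequentially dist_norm k_def using lim0 by meson
  have lim: "(\<lambda>n. z (k n) t) \<longlonglongrightarrow> y t" if "t \<in> {a..b}" for t
    using tendsto_uniform_limitI[OF ul that] .
  have yK: "y t \<in> K" if "t \<in> {a..b}" for t
    using closed_sequentially[OF compact_imp_closed[OF K] _ lim[OF that]] zK[OF that] by blast
  have uF: "uniformly_continuous_on K F" by (rule compact_uniformly_continuous[OF F K])
  \<comment> \<open>Uniform convergence of \<open>z (k n)\<close> and uniform continuity of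
    \<open>F\<close> on \<open>K\<close> make the derivatives converge uniformly to
    \<open>F (y x)\<close>. Differentiating the limit in this way also covers the end
    points.\<close>
  have "\<exists>g. \<forall>x\<in>{a..b}. (\<lambda>n. z (k n) x) \<longlonglongrightarrow> g x \<and>
      (g has_derivative (\<lambda>h. h *\<^sub>R F (y x))) (at x within {a..b})"
  proof (rule has_derivative_sequence[where f' = "\<lambda>n x h. h *\<^sub>R f (k n) x"])
    show "(z (k n) has_derivative (\<lambda>h. h *\<^sub>R f (k n) x)) (at x within {a..b})"
      if "x \<in> {a..b}" for n x
      using zd[OF that] by (simp add: has_vector_derivative_def)
    fix e :: real assume e: "e > 0"
    obtain d where d: "d > 0" "\<And>v w. v \<in> K \<Longrightarrow> w \<in> K \<Longrightarrow> dist v w < d \<Longrightarrow> dist (F v) (F w) < e / 2"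
      using uF e unfolding uniformly_continuous_on_def by (metis half_gt_zero)
    have 1: "\<forall>\<^sub>F n in sequentially. \<forall>t\<in>{a..b}. norm (f (k n) t - F (z (k n) t)) < e / 2"
      using eventually_subseq[OF k err[of "e / 2"]] e by simp
    have 2: "\<forall>\<^sub>F n in sequentially. \<forall>t\<in>{a..b}. dist (z (k n) t) (y t) < d"
      using ul d(1) unfolding uniform_limit_iff by blast
    from 1 2 show "\<forall>\<^sub>F n in sequentially. \<forall>x\<in>{a..b}. \<forall>h.
        norm (h *\<^sub>R f (k n) x - h *\<^sub>R F (y x)) \<le> e * norm h"
    proof eventually_elim
      case (elim n)
      show ?case
      proof (intro ballI allI)
        fix x h assume x: "x \<in> {a..b}"
        have "dist (F (z (k n) x)) (F (y x)) < e / 2"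
          using d(2) zK yK x elim(2) by blast
        then have "norm (f (k n) x - F (y x)) \<le> e"
          using elim(1) x norm_triangle_ineq[of "f (k n) x - F (z (k n) x)" "F (z (k n) x) - F (y x)"]
          by (fastforce simp: dist_norm)
        then have "\<bar>h\<bar> * norm (f (k n) x - F (y x)) \<le> \<bar>h\<bar> * e"
          by (intro mult_left_mono) auto
        then show "norm (h *\<^sub>R f (k n) x - h *\<^sub>R F (y x)) \<le> e * norm h"
          by (simp add: scaleR_diff_right[symmetric] mult.commute)
      qed
    qed
  qed (use ab lim in auto)
  then obtain g where g: "\<And>x. x \<in> {a..b} \<Longrightarrow> (\<lambda>n. z (k n) x) \<longlonglongrightarrow> g x"
    "\<And>x. x \<in> {a..b} \<Longrightarrow> (g has_derivative (\<lambda>h. h *\<^sub>R F (y x))) (at x within {a..b})" by blast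
  have gy: "g t = y t" if "t \<in> {a..b}" for t
    using LIMSEQ_unique[OF g(1)[OF that] lim[OF that]] .
  have "(y has_vector_derivative F (y t)) (at t within {a..b})" if t: "t \<in> {a..b}" for t
    using has_derivative_transform[OF t _ g(2)[OF t], of y] gy
    by (simp add: has_vector_derivative_def)
  with that k yK lim show thesis by blast
qed

text \<open>Tonelli's approximation: the right-hand side is evaluated with a delay h.\<close>

lemma delayed_solution_exists:
  fixes G :: "'a::euclidean_space \<Rightarrow> 'a"
  assumes G: "continuous_on UNIV G" and h: "h > 0" and b: "b > 0"
  obtains y where "\<And>t. t \<le> 0 \<Longrightarrow> y t = z0"
    "\<And>t. t \<in> {0..b} \<Longrightarrow> (y has_vector_derivative G (y (t - h))) (at t within {0..b})"
proof -
  \<comment> \<open>Method of steps: with the delay \<open>h\<close>, the values on an interval of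
    length \<open>h\<close> are determined by the values before it.\<close>
  define Y where "Y = rec_nat (\<lambda>_. z0) (\<lambda>_ y t. z0 + integral {0..t} (\<lambda>s. G (y (s - h))))"
  have Y0: "Y 0 = (\<lambda>_. z0)" and YS: "Y (Suc k) = (\<lambda>t. z0 + integral {0..t} (\<lambda>s. G (Y k (s - h))))" for k
    by (simp_all add: Y_def)
  \<comment> \<open>For \<open>t < 0\<close> the interval \<open>{0..t}\<close> is empty and the
    integral is 0, so the constant prehistory \<open>z0\<close> needs no case distinction in the
    recursion.\<close>
  have neg: "Y k t = z0" if "t \<le> 0" for k t
    using that by (cases k; cases "t = 0") (auto simp: Y0 YS)
  have delay: "continuous_on {0..b} (\<lambda>s. G (Y k (s - h)))" if "continuous_on {..b} (Y k)" for k
    by (rule continuous_on_compose2[OF G continuous_on_compose2[OF that]])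
       (use h in \<open>auto intro!: continuous_intros\<close>)
  have cont: "continuous_on {..b} (Y k)" for k
  proof (induction k)
    case (Suc k)
    have "continuous_on {0..b} (Y (Suc k))"
      unfolding YS by (intro continuous_intros indefinite_integral_continuous_1
          integrable_continuous_real delay Suc)
    moreover have "continuous_on {..0} (Y (Suc k))"
      using continuous_on_cong[of "{..0}" "{..0}" "Y (Suc k)" "\<lambda>_. z0"] neg by simp
    moreover have "{..b} = {..0} \<union> {0..b}" using b by auto
    ultimately show ?case by (metis continuous_on_closed_Un closed_atMost closed_atLeastAtMost)
  qed (simp add: Y0)
  \<comment> \<open>Each iteration settles one more interval of length \<open>h\<close>. Hence an
    iterate with \<open>b < k * h\<close> satisfies the delayed equation exactly on
    \<open>{0..b}\<close>.\<close>
  have stable: "Y (Suc k) t = Y k t" if "t \<le> real k * h" for k t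
    using that
  proof (induction k arbitrary: t)
    case (Suc k)
    have "Y (Suc k) (s - h) = Y k (s - h)" if "s \<in> {0..t}" for s
      using Suc.IH[of "s - h"] that Suc.prems by (auto simp: algebra_simps)
    then show ?case
      unfolding YS[of "Suc k"] YS[of k] by (metis (no_types, lifting) integral_cong)
  qed (simp add: neg)
  obtain k :: nat where k: "b < real k * h" using reals_Archimedean3[OF h] by blast
  show thesis
  proof
    show "Y (Suc k) t = z0" if "t \<le> 0" for t using neg that by blast
    fix t assume t: "t \<in> {0..b}"
    have "((\<lambda>t. integral {0..t} (\<lambda>s. G (Y k (s - h)))) has_vector_derivative G (Y k (t - h)))
        (at t within {0..b})"
      by (rule integral_has_vector_derivative[OF delay[OF cont] t])
    then have "(Y (Suc k) has_vector_derivative 0 + G (Y k (t - h))) (at t within {0..b})"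
      unfolding YS by (intro has_vector_derivative_add has_vector_derivative_const)
    moreover have "Y (Suc k) (t - h) = Y k (t - h)"
      by (rule stable) (use t h k in auto)
    ultimately show "(Y (Suc k) has_vector_derivative G (Y (Suc k) (t - h))) (at t within {0..b})"
      by simp
  qed
qed

text \<open>Projecting to a closed ball in \<open>S\<close> before applying \<open>F\<close> gives a
  globally defined continuous field, for which the delayed equations are solvable. The approximants
  never leave the ball, where this field agrees with \<open>F\<close>.\<close>

theorem Peano_existence:
  fixes F :: "'a::euclidean_space \<Rightarrow> 'a"
  assumes S: "open S" and F: "continuous_on S F" and z0: "z0 \<in> S"
  obtains d z where "d > 0" "z 0 = z0" "\<And>t. t \<in> {0..d} \<Longrightarrow> z t \<in> S"
    "\<And>t. t \<in> {0..d} \<Longrightarrow> (z has_vector_derivative F (z t)) (at t within {0..d})"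
proof -
  obtain r where r: "r > 0" "cball z0 r \<subseteq> S" using S z0 open_contains_cball by blast
  define K where "K = cball z0 r"
  have K: "compact K" "convex K" "closed K" "K \<noteq> {}" using r by (auto simp: K_def)
  have FK: "continuous_on K F" using F r continuous_on_subset K_def by blast
  define G where "G = F \<circ> closest_point K"
  have clK: "closest_point K w \<in> K" for w using closest_point_in_set K by blast
  have G: "continuous_on UNIV G" unfolding G_def
    by (intro continuous_on_compose continuous_on_closest_point K continuous_on_subset[OF FK])
       (use clK in auto)
  have GF: "G w = F w" if "w \<in> K" for w using that by (simp add: G_def closest_point_self)
  obtain M where "M > 0" and MF: "\<And>w. w \<in> K \<Longrightarrow> norm (F w) \<le> M"
    using compact_imp_bounded[OF compact_continuous_image[OF FK K(1)]]
    unfolding bounded_pos by auto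
  have M: "norm (G w) \<le> M" for w using MF[OF clK] by (simp add: G_def)
  \<comment> \<open>With speed at most \<open>M\<close>, a curve starting at the centre needs at
    least this time to leave the ball of radius \<open>r\<close>.\<close>
  define d where "d = r / M"
  have d: "d > 0" using r \<open>M > 0\<close> by (simp add: d_def)
  have "\<exists>y. (\<forall>t\<le>0. y t = z0) \<and> (\<forall>t\<in>{0..d}. (y has_vector_derivative G (y (t - h))) (at t within {0..d}))"
    if "h > 0" for h
    using delayed_solution_exists[OF G that d, of z0] by metis
  then obtain z where z: "\<And>h t. h > 0 \<Longrightarrow> t \<le> 0 \<Longrightarrow> z h t = z0"
    "\<And>h t. h > 0 \<Longrightarrow> t \<in> {0..d} \<Longrightarrow> (z h has_vector_derivative G (z h (t - h))) (at t within {0..d})"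
    by metis
  \<comment> \<open>Negative times are included because the delayed argument \<open>t - h\<close>
    may precede 0.\<close>
  have lip: "norm (z h s - z h t) \<le> M * \<bar>s - t\<bar>" if "h > 0" "s \<le> d" "t \<le> d" for h s t
  proof -
    have pos: "norm (z h s - z h t) \<le> M * \<bar>s - t\<bar>" if "s \<in> {0..d}" "t \<in> {0..d}" for s t
      by (rule vector_derivative_bound_imp_lipschitz[OF z(2)[OF \<open>h > 0\<close>] M that])
    have mix: "norm (z h s - z h t) \<le> M * \<bar>s - t\<bar>" if "s \<le> 0" "t \<in> {0..d}" for s t
    proof -
      have "norm (z h 0 - z h t) \<le> M * \<bar>0 - t\<bar>" using pos[of 0 t] that d by auto
      also have "\<dots> \<le> M * \<bar>s - t\<bar>" using that \<open>M > 0\<close> by (intro mult_left_mono) auto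
      finally show ?thesis using z(1)[OF \<open>h > 0\<close>, of s] z(1)[OF \<open>h > 0\<close>, of 0] that by simp
    qed
    have "s \<le> 0 \<or> s \<in> {0..d}" "t \<le> 0 \<or> t \<in> {0..d}" using that by auto
    then consider "s \<le> 0" "t \<le> 0" | "s \<le> 0" "t \<in> {0..d}" | "t \<le> 0" "s \<in> {0..d}" | "s \<in> {0..d}" "t \<in> {0..d}"
      by blast
    then show ?thesis
    proof cases
      case 1 then show ?thesis using z(1) \<open>h > 0\<close> \<open>M > 0\<close> by simp
    next
      case 3 then show ?thesis using mix[of t s] by (simp add: norm_minus_commute abs_minus_commute)
    qed (use pos mix in auto)
  qed
  have zK: "z h t \<in> K" if "h > 0" "t \<le> d" for h t
  proof (cases "t \<le> 0")
    case True then show ?thesis using z(1) that r by (simp add: K_def)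
  next
    case False
    have "norm (z h 0 - z h t) \<le> M * t" using lip[of h 0 t] that d False by simp
    also have "\<dots> \<le> M * d" using that \<open>M > 0\<close> by simp
    also have "\<dots> = r" using \<open>M > 0\<close> by (simp add: d_def)
    finally show ?thesis using z(1)[of h 0] that by (simp add: K_def dist_norm)
  qed
  define \<eta> where "\<eta> n = 1 / real (Suc n)" for n
  have \<eta>0: "\<eta> n > 0" for n by (simp add: \<eta>_def)
  have \<eta>lim: "\<eta> \<longlonglongrightarrow> 0"
    using LIMSEQ_inverse_real_of_nat unfolding \<eta>_def[abs_def] inverse_eq_divide .
  define w where "w n = z (\<eta> n)" for n
  have uF: "uniformly_continuous_on K F" by (rule compact_uniformly_continuous[OF FK K(1)])
  have err: "\<forall>\<^sub>F n in sequentially. \<forall>t\<in>{0..d}. norm (G (w n (t - \<eta> n)) - F (w n t)) < e"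
    if e: "e > 0" for e
  proof -
    obtain \<delta> where \<delta>: "\<delta> > 0" "\<And>v w. v \<in> K \<Longrightarrow> w \<in> K \<Longrightarrow> dist v w < \<delta> \<Longrightarrow> dist (F v) (F w) < e"
      using uF e unfolding uniformly_continuous_on_def by (metis dist_commute)
    have "\<forall>\<^sub>F n in sequentially. \<eta> n < \<delta> / M"
      using order_tendstoD(2)[OF \<eta>lim] \<delta>(1) \<open>M > 0\<close> by simp
    then show ?thesis
    proof eventually_elim
      case (elim n)
      show ?case
      proof
        fix t assume t: "t \<in> {0..d}"
        have th: "t - \<eta> n \<le> d" using t \<eta>0[of n] by simp
        have wK: "w n (t - \<eta> n) \<in> K" "w n t \<in> K"
          unfolding w_def using zK[OF \<eta>0 th] zK[OF \<eta>0, of t] t by simp_all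
        have "norm (w n (t - \<eta> n) - w n t) \<le> M * \<bar>(t - \<eta> n) - t\<bar>"
          unfolding w_def by (rule lip) (use th t \<eta>0 in simp_all)
        also have "\<dots> = \<eta> n * M" using \<eta>0[of n] by simp
        also have "\<dots> < \<delta>" using elim \<open>M > 0\<close> by (simp add: pos_less_divide_eq)
        finally have "dist (F (w n (t - \<eta> n))) (F (w n t)) < e"
          by (intro \<delta>(2) wK) (simp only: dist_norm)
        with GF[OF wK(1)] show "norm (G (w n (t - \<eta> n)) - F (w n t)) < e" by (simp add: dist_norm)
      qed
    qed
  qed
  have wd: "(w n has_vector_derivative G (w n (t - \<eta> n))) (at t within {0..d})"
    if "t \<in> {0..d}" for n t unfolding w_def by (rule z(2)[OF \<eta>0 that])
  have wK: "w n t \<in> K" if "t \<in> {0..d}" for n t unfolding w_def using zK \<eta>0 that by simp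
  obtain y k where y: "strict_mono (k :: nat \<Rightarrow> nat)"
    "\<And>t. t \<in> {0..d} \<Longrightarrow> (y has_vector_derivative F (y t)) (at t within {0..d})"
    "\<And>t. t \<in> {0..d} \<Longrightarrow> y t \<in> K"
    "\<And>t. t \<in> {0..d} \<Longrightarrow> (\<lambda>n. w (k n) t) \<longlonglongrightarrow> y t"
    by (rule approximate_solutions_subsequence[OF less_imp_le[OF d] K(1) FK wK wd err]) (assumption+, rule that)
  have "w (k n) 0 = z0" for n by (simp add: w_def z(1) \<eta>0)
  moreover have "(\<lambda>n. w (k n) 0) \<longlonglongrightarrow> y 0" using y(4)[of 0] d by simp
  ultimately have "y 0 = z0" by (simp add: LIMSEQ_const_iff)
  moreover have "y t \<in> S" if "t \<in> {0..d}" for t using y(3)[OF that] r(2) by (auto simp: K_def)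
  ultimately show thesis by (rule that[OF d _ _ y(2)])
qed

text \<open>A subsequence with end points away from \<open>L\<close> would have a further
  subsequence converging to a solution that starts at \<open>z0\<close>, and such a solution ends at
  \<open>L\<close>. Only the end point of the limit has to be unique.\<close>

lemma solutions_tendsto:
  fixes z :: "nat \<Rightarrow> real \<Rightarrow> 'a::euclidean_space"
  assumes ab: "a \<le> b" and K: "compact K" and F: "continuous_on K F"
    and z: "\<forall>\<^sub>F n in sequentially. \<forall>t\<in>{a..b}. z n t \<in> K \<and>
      (z n has_vector_derivative F (z n t)) (at t within {a..b})"
    and lim: "(\<lambda>n. z n a) \<longlonglongrightarrow> z0"
    and unique: "\<And>y. y a = z0 \<Longrightarrow> (\<And>t. t \<in> {a..b} \<Longrightarrow> y t \<in> K) \<Longrightarrow>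
      (\<And>t. t \<in> {a..b} \<Longrightarrow> (y has_vector_derivative F (y t)) (at t within {a..b})) \<Longrightarrow> y b = L"
  shows "(\<lambda>n. z n b) \<longlonglongrightarrow> L"
proof (rule ccontr)
  assume "\<not> ?thesis"
  then obtain e where e: "e > 0" "\<not> (\<forall>\<^sub>F n in sequentially. dist (z n b) L < e)"
    unfolding tendsto_iff by blast
  obtain N where N: "\<And>n t. n \<ge> N \<Longrightarrow> t \<in> {a..b} \<Longrightarrow> z n t \<in> K \<and>
      (z n has_vector_derivative F (z n t)) (at t within {a..b})"
    using z unfolding eventually_sequentially by blast
  obtain r where r: "strict_mono (r :: nat \<Rightarrow> nat)" "\<And>n. \<not> dist (z (r n) b) L < e"
    using not_eventually_sequentiallyD[OF e(2)] by blast
  define j where "j n = r (n + N)" for n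
  have j: "j n \<ge> N" for n
    using seq_suble[OF r(1), of "n + N"] by (simp add: j_def)
  have jm: "strict_mono j" using r(1) by (simp add: j_def strict_mono_def)
  obtain y k where y: "strict_mono (k :: nat \<Rightarrow> nat)"
    "\<And>t. t \<in> {a..b} \<Longrightarrow> (y has_vector_derivative F (y t)) (at t within {a..b})"
    "\<And>t. t \<in> {a..b} \<Longrightarrow> y t \<in> K"
    "\<And>t. t \<in> {a..b} \<Longrightarrow> (\<lambda>n. z (j (k n)) t) \<longlonglongrightarrow> y t"
  proof (rule approximate_solutions_subsequence[OF ab K F, of "\<lambda>n. z (j n)" "\<lambda>n t. F (z (j n) t)"])
    show "z (j n) t \<in> K" "(z (j n) has_vector_derivative F (z (j n) t)) (at t within {a..b})"
      if "t \<in> {a..b}" for n t using N[OF j that] by auto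
  qed (simp, rule that)
  have "(\<lambda>n. z (j (k n)) a) \<longlonglongrightarrow> z0"
    using LIMSEQ_subseq_LIMSEQ[OF lim, of "j \<circ> k"] strict_mono_o[OF jm y(1)] by (simp add: o_def)
  then have "y a = z0" using y(4)[of a] ab LIMSEQ_unique by auto
  then have "y b = L" using unique y(2,3) by blast
  then have "\<forall>\<^sub>F n in sequentially. dist (z (j (k n)) b) L < e"
    using y(4)[of b] ab e(1) unfolding tendsto_iff by auto
  then obtain n where "dist (z (j (k n)) b) L < e" unfolding eventually_sequentially by blast
  then show False using r(2) by (simp add: j_def)
qed

section \<open>Preliminaries from calculus and linear algebra\<close>

lemma has_real_derivative_along_line:
  assumes "(f has_derivative f') (at (a + s *\<^sub>R u))"
  shows "((\<lambda>s. f (a + s *\<^sub>R u)) has_real_derivative f' u) (at s)"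
proof -
  interpret f': bounded_linear f' by (rule has_derivative_bounded_linear[OF assms])
  have "((\<lambda>s. a + s *\<^sub>R u) has_derivative (\<lambda>h. h *\<^sub>R u)) (at s)"
    by (auto intro!: derivative_eq_intros)
  from has_derivative_compose[OF this assms] show ?thesis
    by (simp add: has_field_derivative_def f'.scaleR mult_commute_abs)
qed

text \<open>Mean value theorem twice: along \<open>u\<close> for the change of \<open>f\<close>
  under the shift by \<open>h *\<^sub>R v\<close>, then along \<open>v\<close> for the derivative of
  \<open>f\<close> in direction \<open>u\<close>. The second difference is symmetric in
  \<open>u\<close> and \<open>v\<close>, while the order of differentiation on the right is
  not.\<close>

lemma second_difference_mean_value:
  fixes f :: "'a::real_normed_vector \<Rightarrow> real"
  assumes h: "h > 0"
    and S: "\<And>s t. s \<in> {0..h} \<Longrightarrow> t \<in> {0..h} \<Longrightarrow> x + s *\<^sub>R u + t *\<^sub>R v \<in> S"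
    and f: "\<And>y. y \<in> S \<Longrightarrow> (f has_derivative f' y) (at y)"
    and fu: "\<And>y. y \<in> S \<Longrightarrow> ((\<lambda>y. f' y u) has_derivative f'' y) (at y)"
  obtains s t where "s \<in> {0..h}" "t \<in> {0..h}"
    "f (x + h *\<^sub>R u + h *\<^sub>R v) - f (x + h *\<^sub>R u) - f (x + h *\<^sub>R v) + f x =
      h\<^sup>2 * f'' (x + s *\<^sub>R u + t *\<^sub>R v) v"
proof -
  have S': "(x + t *\<^sub>R v) + s *\<^sub>R u \<in> S" if "s \<in> {0..h}" "t \<in> {0..h}" for s t
    using S[OF that] by (simp add: add_ac)
  let ?p = "\<lambda>s. f ((x + h *\<^sub>R v) + s *\<^sub>R u) - f (x + s *\<^sub>R u)"
  let ?p' = "\<lambda>s. f' ((x + h *\<^sub>R v) + s *\<^sub>R u) u - f' (x + s *\<^sub>R u) u"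
  have "\<exists>s>0. s < h \<and> ?p h - ?p 0 = (h - 0) * ?p' s"
  proof (rule MVT2[OF h])
    fix s assume "0 \<le> s" "s \<le> h"
    then show "(?p has_real_derivative ?p' s) (at s)"
      using S'[of s h] S'[of s 0] h
      by (intro DERIV_diff has_real_derivative_along_line f) auto
  qed
  then obtain s where "0 < s" "s < h" "?p h - ?p 0 = (h - 0) * ?p' s" by blast
  then have s: "s \<in> {0..h}" "?p h - ?p 0 = h * ?p' s" by auto
  let ?q = "\<lambda>t. f' ((x + s *\<^sub>R u) + t *\<^sub>R v) u"
  have "\<exists>t>0. t < h \<and> ?q h - ?q 0 = (h - 0) * f'' ((x + s *\<^sub>R u) + t *\<^sub>R v) v"
  proof (rule MVT2[OF h])
    fix t assume "0 \<le> t" "t \<le> h"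
    then show "(?q has_real_derivative f'' ((x + s *\<^sub>R u) + t *\<^sub>R v) v) (at t)"
      using S[of s t] s h by (intro has_real_derivative_along_line fu) auto
  qed
  then obtain t where "0 < t" "t < h" "?q h - ?q 0 = (h - 0) * f'' ((x + s *\<^sub>R u) + t *\<^sub>R v) v"
    by blast
  then have t: "t \<in> {0..h}" "?q h - ?q 0 = h * f'' (x + s *\<^sub>R u + t *\<^sub>R v) v" by auto
  have "?p' s = ?q h - ?q 0" by (simp add: add_ac)
  then have "?p h - ?p 0 = h * (h * f'' (x + s *\<^sub>R u + t *\<^sub>R v) v)"
    using s(2) t(2) by presburger
  then show thesis
    using that[OF s(1) t(1)] by (simp add: power2_eq_square add_ac)
qed

text \<open>Both mixed derivatives, taken at suitable points near \<open>x\<close>, equal the same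
  second difference divided by the square of \<open>h\<close>; continuity moves the points to
  \<open>x\<close>. Differentiability is asked of \<open>f' y u\<close> for fixed vectors, the form
  in which \<open>Ck_on\<close> delivers it.\<close>

lemma second_derivative_symmetric:
  fixes f :: "'a::real_normed_vector \<Rightarrow> real"
  assumes S: "open S" "x \<in> S"
    and f: "\<And>y. y \<in> S \<Longrightarrow> (f has_derivative f' y) (at y)"
    and fu: "\<And>y. y \<in> S \<Longrightarrow> ((\<lambda>y. f' y u) has_derivative fu y) (at y)"
    and fv: "\<And>y. y \<in> S \<Longrightarrow> ((\<lambda>y. f' y v) has_derivative fv y) (at y)"
    and cu: "continuous_on S (\<lambda>y. fu y v)" and cv: "continuous_on S (\<lambda>y. fv y u)"
  shows "fu x v = fv x u"
proof (rule ccontr)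
  assume "fu x v \<noteq> fv x u"
  \<comment> \<open>Half the gap, since the two mixed derivatives are evaluated at different points
    and each may deviate by less than \<open>e\<close>.\<close>
  define e where "e = \<bar>fu x v - fv x u\<bar> / 2"
  have e: "e > 0" using \<open>fu x v \<noteq> fv x u\<close> by (simp add: e_def)
  have "isCont (\<lambda>y. fu y v) x" "isCont (\<lambda>y. fv y u) x"
    using S cu cv by (simp_all add: continuous_on_eq_continuous_at)
  then have "\<forall>\<^sub>F y in nhds x. y \<in> S \<and> dist (fu y v) (fu x v) < e \<and> dist (fv y u) (fv x u) < e"
    using e S by (intro eventually_conj)
      (auto simp: continuous_at tendsto_iff eventually_at_filter eventually_nhds_in_open
        elim!: eventually_mono)
  then obtain d where d: "d > 0" "\<And>y. dist y x < d \<Longrightarrow>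
      y \<in> S \<and> dist (fu y v) (fu x v) < e \<and> dist (fv y u) (fv x u) < e"
    unfolding eventually_nhds_metric by blast
  define N where "N = norm u + norm v + 1"
  have N: "N > 0" by (simp add: N_def add_nonneg_pos)
  \<comment> \<open>Chosen such that the whole parallelogram spanned by \<open>h *\<^sub>R u\<close>
    and \<open>h *\<^sub>R v\<close> lies within \<open>d / 2\<close> of \<open>x\<close>; the
    summand 1 in \<open>N\<close> covers \<open>u = v = 0\<close>.\<close>
  define h where "h = d / (2 * N)"
  have h: "h > 0" unfolding h_def using d(1) N by simp
  have near: "dist (x + s *\<^sub>R u + t *\<^sub>R v) x < d" if "s \<in> {0..h}" "t \<in> {0..h}" for s t
  proof -
    have "norm (s *\<^sub>R u + t *\<^sub>R v) \<le> s * norm u + t * norm v"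
      using norm_triangle_ineq[of "s *\<^sub>R u" "t *\<^sub>R v"] that by simp
    also have "\<dots> \<le> h * norm u + h * norm v"
      using that by (intro add_mono mult_right_mono) auto
    also have "\<dots> \<le> h * N" using h by (simp add: N_def algebra_simps)
    also have "\<dots> = d / 2" using N by (simp add: h_def)
    finally show ?thesis using d(1) by (simp add: dist_norm add.assoc)
  qed
  obtain s t where st: "s \<in> {0..h}" "t \<in> {0..h}"
    "f (x + h *\<^sub>R u + h *\<^sub>R v) - f (x + h *\<^sub>R u) - f (x + h *\<^sub>R v) + f x =
      h\<^sup>2 * fu (x + s *\<^sub>R u + t *\<^sub>R v) v"
    by (rule second_difference_mean_value[where x = x and u = u and v = v and S = S, OF h _ f fu]) (use near d in blast)+
  have near': "dist (x + s *\<^sub>R v + t *\<^sub>R u) x < d" if "s \<in> {0..h}" "t \<in> {0..h}" for s t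
    using near[OF that(2,1)] by (simp add: add_ac)
  obtain s' t' where st': "s' \<in> {0..h}" "t' \<in> {0..h}"
    "f (x + h *\<^sub>R v + h *\<^sub>R u) - f (x + h *\<^sub>R v) - f (x + h *\<^sub>R u) + f x =
      h\<^sup>2 * fv (x + s' *\<^sub>R v + t' *\<^sub>R u) u"
    by (rule second_difference_mean_value[where x = x and u = v and v = u and S = S, OF h _ f fv]) (use near' d in blast)+
  have "h\<^sup>2 * fu (x + s *\<^sub>R u + t *\<^sub>R v) v = h\<^sup>2 * fv (x + s' *\<^sub>R v + t' *\<^sub>R u) u"
    using st(3) st'(3) unfolding add.assoc add.commute[of "h *\<^sub>R u"] by linarith
  then have "fu (x + s *\<^sub>R u + t *\<^sub>R v) v = fv (x + s' *\<^sub>R v + t' *\<^sub>R u) u" using h by simp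
  moreover have "dist (fu (x + s *\<^sub>R u + t *\<^sub>R v) v) (fu x v) < e"
    using d(2) near st by blast
  moreover have "dist (fv (x + s' *\<^sub>R v + t' *\<^sub>R u) u) (fv x u) < e"
    using d(2) near' st' by blast
  ultimately show False unfolding e_def dist_real_def by (smt (verit) field_sum_of_halves)
qed

section \<open>Inverse matrices and their continuity\<close>

lemma matrix_inv_invertible:
  fixes M :: "real^'n^'n"
  assumes "invertible M"
  shows "M ** matrix_inv M = mat 1" "matrix_inv M ** M = mat 1"
  using someI_ex[OF assms[unfolded invertible_def]] by (simp_all add: matrix_inv_def)

text \<open>As quotients of determinants, the entries of the inverse are visibly continuous in the
  entries of the matrix. This gives continuity of the Christoffel symbols.\<close>

lemma matrix_inv_cramer:
  fixes M :: "real^'n^'n"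
  assumes "det M \<noteq> 0"
  shows "matrix_inv M $ k $ l =
    det (\<chi> i j. if j = k then if i = l then 1 else 0 else M $ i $ j) / det M"
proof -
  have inv: "invertible M" using assms by (simp add: invertible_det_nz)
  have "M *v (matrix_inv M *v axis l 1) = axis l 1"
    by (simp add: matrix_vector_mul_assoc matrix_inv_invertible[OF inv])
  then have "matrix_inv M *v axis l 1 =
      (\<chi> k. det (\<chi> i j. if j = k then axis l 1 $ i else M $ i $ j) / det M)"
    using cramer[OF assms] by blast
  then have "(matrix_inv M *v axis l 1) $ k =
      det (\<chi> i j. if j = k then axis l 1 $ i else M $ i $ j) / det M" by simp
  moreover have "(matrix_inv M *v axis l 1) $ k = matrix_inv M $ k $ l"
    by (simp add: matrix_vector_mult_def axis_def if_distrib cong: if_cong)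
  moreover have "axis l 1 $ i = (if i = l then 1 else 0 :: real)" for i
    by (simp add: axis_def)
  ultimately show ?thesis by (simp cong: if_cong)
qed

lemma continuous_on_det [continuous_intros]:
  fixes M :: "'a::topological_space \<Rightarrow> real^'n^'n"
  assumes "\<And>i j. continuous_on S (\<lambda>x. M x $ i $ j)"
  shows "continuous_on S (\<lambda>x. det (M x))"
  unfolding det_def by (intro continuous_intros assms)

lemma continuous_on_matrix_inv_nth:
  fixes M :: "'a::topological_space \<Rightarrow> real^'n^'n"
  assumes "\<And>i j. continuous_on S (\<lambda>x. M x $ i $ j)" and "\<And>x. x \<in> S \<Longrightarrow> det (M x) \<noteq> 0"
  shows "continuous_on S (\<lambda>x. matrix_inv (M x) $ k $ l)"
proof -
  have "continuous_on S (\<lambda>x.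
      det (\<chi> i j. if j = k then if i = l then 1 else 0 else M x $ i $ j) / det (M x))"
  proof (intro continuous_on_divide continuous_on_det ballI)
    show "continuous_on S (\<lambda>x. (\<chi> i j. if j = k then if i = l then 1 else 0 else M x $ i $ j) $ i $ j)"
      for i j using assms(1)[of i j] by (cases "j = k") auto
  qed (use assms in auto)
  then show ?thesis
    by (rule continuous_on_eq) (simp add: matrix_inv_cramer assms(2))
qed

section \<open>Components, and derivatives within intervals\<close>

lemma has_derivative_vec_componentwise:
  fixes f :: "'a::real_normed_vector \<Rightarrow> real^'n"
  shows "(f has_derivative f') F \<Longrightarrow> ((\<lambda>x. f x $ i) has_derivative (\<lambda>h. f' h $ i)) F"
  by (rule bounded_linear.has_derivative[OF bounded_linear_vec_nth])

lemma vec_eq_sum_axis: "(\<Sum>i\<in>UNIV. x $ i *\<^sub>R axis i 1) = (x :: real^'n)"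
  using basis_expansion[of x] by (simp add: scalar_mult_eq_scaleR)

text \<open>This is what the condition \<open>interior I \<noteq> {}\<close> in
  \<open>C2_curve\<close> provides: derivatives within \<open>I\<close> are unique, also at end
  points.\<close>

lemma at_within_interval_neq_bot:
  fixes I :: "real set"
  assumes "is_interval I" "interior I \<noteq> {}" "t \<in> I"
  shows "at t within I \<noteq> bot"
proof -
  have "I \<noteq> {x}" for x using assms(2) by (metis interior_singleton)
  then have "t islimpt I"
    using connected_imp_perfect assms by (metis is_interval_connected_1)
  then show ?thesis using trivial_limit_within by blast
qed

lemma has_vector_derivative_Pair:
  assumes "(f has_vector_derivative f') (at t within I)" "(h has_vector_derivative h') (at t within I)"
  shows "((\<lambda>t. (f t, h t)) has_vector_derivative (f', h')) (at t within I)"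
  using has_derivative_Pair[OF assms[unfolded has_vector_derivative_def]]
  unfolding has_vector_derivative_def by simp

lemma has_vector_derivative_shift:
  assumes "(f has_vector_derivative f') (at (s + t) within {s + a..s + b})"
  shows "((\<lambda>t. f (s + t)) has_vector_derivative f') (at (t::real) within {a..b})"
proof -
  have "((\<lambda>t. s + t) has_vector_derivative 1) (at t within {a..b})"
    by (auto intro!: derivative_eq_intros)
  from vector_diff_chain_within[OF this, of f f'] assms show ?thesis
    by (simp add: o_def add.commute[of _ s])
qed

lemma has_vector_derivative_reflect:
  assumes "(f has_vector_derivative f') (at (- t) within {a..b})"
  shows "((\<lambda>t. f (- t)) has_vector_derivative - f') (at (t::real) within {-b..-a})"
proof -
  have "((\<lambda>t. - t) has_vector_derivative -1) (at t within {-b..-a})"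
    by (auto intro!: derivative_eq_intros)
  from vector_diff_chain_within[OF this, of f f'] assms show ?thesis by (simp add: o_def)
qed

text \<open>If \<open>f t = f a\<close>, the remainder of the linear approximation is all of
  \<open>(t - a) *\<^sub>R f'\<close>, but near \<open>a\<close> it is at most half as long. Applied
  to a coordinate curve, this prevents a geodesic with nonzero velocity from returning to its
  starting point at once.\<close>

lemma has_vector_derivative_avoids_value:
  assumes "(f has_vector_derivative f') (at a within {a..b})" "f' \<noteq> 0" "a < b"
  obtains d where "d > 0" "\<And>t. t \<in> {a<..<a + d} \<Longrightarrow> t \<le> b \<Longrightarrow> f t \<noteq> f a"
proof -
  have "norm f' / 2 > 0" using assms(2) by simp
  with assms(1) obtain d where d: "d > 0" "\<And>t. t \<in> {a..b} \<Longrightarrow> norm (t - a) < d \<Longrightarrow>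
      norm (f t - f a - (t - a) *\<^sub>R f') \<le> norm f' / 2 * norm (t - a)"
    unfolding has_vector_derivative_def has_derivative_within_alt by blast
  show thesis
  proof (rule that[OF d(1)], rule notI)
    fix t assume t: "t \<in> {a<..<a + d}" "t \<le> b" "f t = f a"
    then have "(t - a) * norm f' \<le> norm f' / 2 * (t - a)" using d(2)[of t] by simp
    moreover have "(t - a) * norm f' > 0" using t assms(2) by simp
    ultimately show False by (simp add: mult.commute)
  qed
qed

lemma eventually_within_Icc_imp:
  fixes a b :: real
  assumes "eventually P (at a within {a..b})" "P a" "a < b"
  obtains d where "d > 0" "d \<le> b - a" "\<And>t. t \<in> {a..a + d} \<Longrightarrow> P t"
proof -
  obtain d where d: "d > 0" "\<And>t. t \<in> {a..b} \<Longrightarrow> t \<noteq> a \<Longrightarrow> dist t a < d \<Longrightarrow> P t"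
    using assms(1) unfolding eventually_at by blast
  show thesis
  proof (rule that[of "min (d / 2) (b - a)"])
    fix t assume t: "t \<in> {a..a + min (d / 2) (b - a)}"
    then have "t \<in> {a..b}" "dist t a < d" using d(1) by (auto simp: dist_real_def)
    then show "P t" using d(2) assms(2) by (cases "t = a") auto
  qed (use d(1) assms(3) in auto)
qed

lemma Icc_interval_interior: "(a::real) < b \<Longrightarrow> is_interval {a..b} \<and> interior {a..b} \<noteq> {}"
  by (simp add: is_interval_cc)

section \<open>Changes of charts\<close>

context smooth_manifold
begin

abbreviation transition where "transition c d \<equiv> cmap d \<circ> cinv c"

abbreviation transition_deriv where
  "transition_deriv c d x \<equiv> frechet_derivative (transition c d) (at x)"

text \<open>\<open>Ck_on\<close> differentiates the first derivative for one fixed vector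
  \<open>v\<close> at a time. Linearity in the direction \<open>z\<close> is therefore immediate,
  while linearity in \<open>v\<close> is recovered in \<open>transition_deriv2_sum\<close>.\<close>

abbreviation transition_deriv2 where
  "transition_deriv2 c d x z v \<equiv> frechet_derivative (\<lambda>y. transition_deriv c d y v) (at x) z"

abbreviation overlap where "overlap c d \<equiv> cmap c ` (cdom c \<inter> cdom d)"

lemma cmap_cinv: "c \<in> A \<Longrightarrow> x \<in> cmap c ` cdom c \<Longrightarrow> cmap c (cinv c x) = x"
  using chart_homeomorphism unfolding homeomorphism_def by blast

lemma cinv_in_cdom: "x \<in> cmap c ` cdom c \<Longrightarrow> cinv c x \<in> cdom c"
  by (rule inv_into_into)

lemma overlap_eq:
  assumes "c \<in> A"
  shows "overlap c d = cmap c ` cdom c \<inter> cinv c -` cdom d"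
proof
  show "overlap c d \<subseteq> cmap c ` cdom c \<inter> cinv c -` cdom d"
    using cinv_cmap[of c] assms by (auto simp: charts_at_def)
  show "cmap c ` cdom c \<inter> cinv c -` cdom d \<subseteq> overlap c d"
  proof
    fix x assume "x \<in> cmap c ` cdom c \<inter> cinv c -` cdom d"
    then have x: "x \<in> cmap c ` cdom c" "cinv c x \<in> cdom d" by auto
    show "x \<in> overlap c d"
      by (rule image_eqI[where x = "cinv c x"]) (simp_all add: x cinv_in_cdom cmap_cinv assms)
  qed
qed

lemma open_overlap:
  assumes "c \<in> A" "d \<in> A"
  shows "open (overlap c d)"
proof -
  have "continuous_on (cmap c ` cdom c) (cinv c)"
    using chart_homeomorphism[OF assms(1)] by (simp add: homeomorphism_def)
  from continuous_open_preimage[OF this open_cimage[OF assms(1)] open_cdom[OF assms(2)]]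
  show ?thesis unfolding overlap_eq[OF assms(1)] .
qed

lemma transition_has_derivative:
  assumes "c \<in> A" "d \<in> A" "x \<in> overlap c d"
  shows "(transition c d has_derivative transition_deriv c d x) (at x)"
proof -
  have "Ck_on (Suc 0) (overlap c d) (transition c d)"
    using charts_compatible[OF assms(1,2)] unfolding smooth_on_def by blast
  then have "transition c d differentiable (at x)" using assms(3) unfolding Ck_on.simps by blast
  then show ?thesis by (simp add: frechet_derivative_works)
qed

lemma transition_deriv_has_derivative:
  assumes "c \<in> A" "d \<in> A" "x \<in> overlap c d"
  shows "((\<lambda>y. transition_deriv c d y v) has_derivative (\<lambda>z. transition_deriv2 c d x z v)) (at x)"
proof -
  have "Ck_on (Suc (Suc 0)) (overlap c d) (transition c d)"
    using charts_compatible[OF assms(1,2)] unfolding smooth_on_def by blast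
  then have "(\<lambda>y. transition_deriv c d y v) differentiable (at x)"
    using assms(3) unfolding Ck_on.simps by blast
  then show ?thesis by (simp add: frechet_derivative_works)
qed

lemma continuous_on_transition_deriv2:
  assumes "c \<in> A" "d \<in> A"
  shows "continuous_on (overlap c d) (\<lambda>x. transition_deriv2 c d x z v)"
proof -
  have "Ck_on (Suc (Suc 0)) (overlap c d) (transition c d)"
    using charts_compatible[OF assms(1,2)] unfolding smooth_on_def by blast
  then show ?thesis by simp
qed

lemma linear_transition_deriv:
  assumes "c \<in> A" "d \<in> A" "x \<in> overlap c d"
  shows "linear (transition_deriv c d x)"
  using transition_has_derivative[OF assms] has_derivative_linear by blast

lemma transition_deriv2_symmetric:
  assumes "c \<in> A" "d \<in> A" "x \<in> overlap c d"
  shows "transition_deriv2 c d x u v = transition_deriv2 c d x v u"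
proof (rule vec_eq_iff[THEN iffD2], rule allI)
  fix i
  note cd = assms(1,2)
  show "transition_deriv2 c d x u v $ i = transition_deriv2 c d x v u $ i"
    by (rule second_derivative_symmetric[OF open_overlap[OF cd] assms(3),
          where f = "\<lambda>x. transition c d x $ i" and f' = "\<lambda>x v. transition_deriv c d x v $ i"])
       (intro has_derivative_vec_componentwise transition_has_derivative[OF cd]
          transition_deriv_has_derivative[OF cd] continuous_intros
          continuous_on_transition_deriv2[OF cd] | assumption)+
qed

lemma transition_deriv2_sum:
  assumes cd: "c \<in> A" "d \<in> A" "x \<in> overlap c d"
  shows "transition_deriv2 c d x z v = (\<Sum>i\<in>UNIV. v $ i *\<^sub>R transition_deriv2 c d x z (axis i 1))"
proof -
  have "((\<lambda>y. \<Sum>i\<in>UNIV. v $ i *\<^sub>R transition_deriv c d y (axis i 1)) has_derivative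
      (\<lambda>z. \<Sum>i\<in>UNIV. v $ i *\<^sub>R transition_deriv2 c d x z (axis i 1))) (at x)"
    by (intro has_derivative_sum has_derivative_scaleR_right transition_deriv_has_derivative[OF cd])
  then have "((\<lambda>y. transition_deriv c d y v) has_derivative
      (\<lambda>z. \<Sum>i\<in>UNIV. v $ i *\<^sub>R transition_deriv2 c d x z (axis i 1))) (at x)"
  proof (rule has_derivative_transform_within_open[OF _ open_overlap[OF cd(1,2)] cd(3)])
    fix y assume "y \<in> overlap c d"
    then show "(\<Sum>i\<in>UNIV. v $ i *\<^sub>R transition_deriv c d y (axis i 1)) = transition_deriv c d y v"
      using linear_sum[OF linear_transition_deriv[OF cd(1,2)], of y "\<lambda>i. v $ i *\<^sub>R axis i 1" UNIV]
      by (simp add: vec_eq_sum_axis linear_cmul[OF linear_transition_deriv[OF cd(1,2)]])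
  qed
  then show ?thesis by (rule fun_cong[OF frechet_derivative_at, symmetric])
qed

lemma transition_deriv_sum:
  assumes cd: "c \<in> A" "d \<in> A" "x \<in> overlap c d"
  shows "transition_deriv c d x v = (\<Sum>i\<in>UNIV. v $ i *\<^sub>R transition_deriv c d x (axis i 1))"
  using linear_sum[OF linear_transition_deriv[OF cd], of "\<lambda>i. v $ i *\<^sub>R axis i 1" UNIV]
  by (simp add: vec_eq_sum_axis linear_cmul[OF linear_transition_deriv[OF cd]])

text \<open>Product rule with moving base point and moving vector. As the first derivative is known
  to be differentiable for fixed vectors only, \<open>u\<close> is expanded in the standard basis,
  and the product rule is applied to each coordinate.\<close>

lemma transition_deriv_along_curve:
  assumes cd: "c \<in> A" "d \<in> A" "x t \<in> overlap c d"
    and x: "(x has_vector_derivative x') (at t within I)"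
    and u: "(u has_vector_derivative u') (at t within I)"
    and J: "t \<in> I" "e > 0" "\<And>s. s \<in> I \<Longrightarrow> dist s t < e \<Longrightarrow> x s \<in> overlap c d"
  shows "((\<lambda>s. transition_deriv c d (x s) (u s)) has_vector_derivative
    transition_deriv c d (x t) u' + transition_deriv2 c d (x t) x' (u t)) (at t within I)"
proof -
  let ?D = "\<lambda>i s. transition_deriv c d (x s) (axis i 1)"
  have D: "(?D i has_vector_derivative transition_deriv2 c d (x t) x' (axis i 1)) (at t within I)" for i
  proof -
    have "(?D i has_derivative (\<lambda>h. transition_deriv2 c d (x t) (h *\<^sub>R x') (axis i 1))) (at t within I)"
      using has_derivative_compose[OF x[unfolded has_vector_derivative_def]
          transition_deriv_has_derivative[OF cd]] .
    then show ?thesis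
      using linear_cmul[OF has_derivative_linear[OF transition_deriv_has_derivative[OF cd]]]
      by (simp add: has_vector_derivative_def)
  qed
  have "((\<lambda>s. u s $ i *\<^sub>R ?D i s) has_vector_derivative
      u t $ i *\<^sub>R transition_deriv2 c d (x t) x' (axis i 1) + u' $ i *\<^sub>R ?D i t) (at t within I)" for i
    using bounded_linear.has_vector_derivative[OF bounded_linear_vec_nth u]
    by (intro has_vector_derivative_scaleR D)
      (simp add: has_real_derivative_iff_has_vector_derivative)
  then have "((\<lambda>s. \<Sum>i\<in>UNIV. u s $ i *\<^sub>R ?D i s) has_vector_derivative
      (\<Sum>i\<in>UNIV. u t $ i *\<^sub>R transition_deriv2 c d (x t) x' (axis i 1) + u' $ i *\<^sub>R ?D i t))
      (at t within I)"
    by (intro has_vector_derivative_sum) auto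
  then have *: "((\<lambda>s. \<Sum>i\<in>UNIV. u s $ i *\<^sub>R ?D i s) has_vector_derivative
      transition_deriv c d (x t) u' + transition_deriv2 c d (x t) x' (u t)) (at t within I)"
    using transition_deriv_sum[OF cd, of u'] transition_deriv2_sum[OF cd, of "u t" x']
    by (simp add: sum.distrib add.commute)
  show ?thesis
    by (rule has_vector_derivative_transform_within[OF * J(2,1)])
       (rule transition_deriv_sum[OF cd(1,2) J(3), symmetric])
qed

lemma transition_along_curve:
  assumes cd: "c \<in> A" "d \<in> A" "x t \<in> overlap c d"
    and x: "(x has_vector_derivative x') (at t within I)"
  shows "((\<lambda>s. transition c d (x s)) has_vector_derivative transition_deriv c d (x t) x') (at t within I)"
  using has_derivative_compose[OF x[unfolded has_vector_derivative_def] transition_has_derivative[OF cd]]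
    linear_cmul[OF linear_transition_deriv[OF cd]]
  by (simp add: has_vector_derivative_def)

text \<open>Joint continuity in point and vector, again reduced to fixed vectors by expansion in the
  basis.\<close>

lemma transition_deriv_tendsto:
  assumes cd: "c \<in> A" "d \<in> A" "x \<in> overlap c d"
    and f: "(f \<longlongrightarrow> x) F" and g: "(g \<longlongrightarrow> v) F"
  shows "((\<lambda>n. transition_deriv c d (f n) (g n)) \<longlongrightarrow> transition_deriv c d x v) F"
proof -
  have "((\<lambda>n. \<Sum>i\<in>UNIV. g n $ i *\<^sub>R transition_deriv c d (f n) (axis i 1)) \<longlongrightarrow>
      (\<Sum>i\<in>UNIV. v $ i *\<^sub>R transition_deriv c d x (axis i 1))) F"
    by (intro tendsto_sum tendsto_scaleR tendsto_vec_nth g isCont_tendsto_compose[OF _ f]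
        has_derivative_continuous[OF transition_deriv_has_derivative[OF cd]])
  moreover have "\<forall>\<^sub>F n in F. f n \<in> overlap c d"
    using topological_tendstoD[OF f open_overlap[OF cd(1,2)] cd(3)] .
  then have "\<forall>\<^sub>F n in F. (\<Sum>i\<in>UNIV. g n $ i *\<^sub>R transition_deriv c d (f n) (axis i 1)) =
      transition_deriv c d (f n) (g n)"
    by eventually_elim (rule transition_deriv_sum[OF cd(1,2), symmetric])
  ultimately show ?thesis
    using transition_deriv_sum[OF cd, of v] by (auto intro: Lim_transform_eventually)
qed

lemma overlap_charts_at:
  "c \<in> A \<Longrightarrow> d \<in> A \<Longrightarrow> x \<in> overlap c d \<Longrightarrow> c \<in> charts_at A (cinv c x) \<and> d \<in> charts_at A (cinv c x)"
  by (auto simp: charts_at_def overlap_eq cinv_in_cdom)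

lemma tvec_of_coords_transition:
  assumes "c \<in> A" "d \<in> A" "x \<in> overlap c d"
  shows "tvec_of_coords A d (cinv c x) (transition_deriv c d x v) = tvec_of_coords A c (cinv c x) v"
proof -
  note cda = overlap_charts_at[OF assms]
  have x: "cmap c (cinv c x) = x" using assms cmap_cinv by blast
  then show ?thesis
    using transition_cocycle[of c "cinv c x" d] cda
    by (auto simp: tvec_of_coords_def fun_eq_iff)
qed

text \<open>The cocycle rule for the charts \<open>d\<close>, \<open>c\<close>, \<open>d\<close>
  exhibits the reverse transition as a right inverse. Thus every test vector in \<open>d\<close>
  comes from one in \<open>c\<close>.\<close>

lemma transition_deriv_surj:
  assumes "c \<in> A" "d \<in> A" "x \<in> overlap c d"
  shows "\<exists>v. transition_deriv c d x v = w"
proof -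
  note cda = overlap_charts_at[OF assms]
  have x: "cmap c (cinv c x) = x" using assms cmap_cinv by blast
  have "transition_deriv c d x (transition_deriv d c (cmap d (cinv c x)) w) =
      transition_deriv d d (cmap d (cinv c x)) w"
    using transition_cocycle[of d "cinv c x" c d w] cda x by simp
  also have "\<dots> = w"
    using tvec_of_coords_self[of d "cinv c x" w] cda by (simp add: tvec_of_coords_def)
  finally show ?thesis by blast
qed

lemma linear_tvec_of_coords:
  assumes "c \<in> charts_at A p"
  shows "tvec_of_coords A c p (a *\<^sub>R u + b *\<^sub>R v) =
    (\<lambda>d. a *\<^sub>R tvec_of_coords A c p u d + b *\<^sub>R tvec_of_coords A c p v d)"
proof
  fix d
  show "tvec_of_coords A c p (a *\<^sub>R u + b *\<^sub>R v) d =
      a *\<^sub>R tvec_of_coords A c p u d + b *\<^sub>R tvec_of_coords A c p v d"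
    using linear_frechet_derivative[OF transition_differentiable[OF assms, of d]]
    by (simp add: tvec_of_coords_def linear_add linear_cmul)
qed

lemma tvec_of_coords_inverse:
  "c \<in> charts_at A p \<Longrightarrow> v \<in> tangent_space A p \<Longrightarrow> tvec_of_coords A c p (v c) = v"
  using tangent_space_homeomorphism by (simp add: homeomorphism_def)

end

section \<open>The geodesic equation\<close>

context C1_spacetime
begin

section \<open>The metric and its first derivatives in coordinates\<close>

definition gform where
  "gform c x u w = (\<Sum>i\<in>UNIV. \<Sum>j\<in>UNIV. metric_comp A g c i j x * (u $ i * w $ j))"

text \<open>The derivative in direction \<open>z\<close> of the coefficients alone, with the
  coordinates of \<open>u\<close> and \<open>w\<close> frozen. It is not tensorial, whence the
  correction terms in \<open>dgform_transition\<close>.\<close>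

definition dgform where
  "dgform c x z u w =
    (\<Sum>i\<in>UNIV. \<Sum>j\<in>UNIV. frechet_derivative (metric_comp A g c i j) (at x) z * (u $ i * w $ j))"

text \<open>The Euler-Lagrange form of the geodesic equation, tested with w. Contrary to the Christoffel
  symbols, it is easily transformed to other charts.\<close>

definition EL where
  "EL c x u a w = gform c x a w + dgform c x u u w - dgform c x w u u / 2"

definition geod_acc :: "('m, 'n) chart \<Rightarrow> real^'n \<Rightarrow> real^'n \<Rightarrow> real^'n" where
  "geod_acc c x u =
    (\<chi> k. - (\<Sum>i\<in>UNIV. \<Sum>j\<in>UNIV. christoffel A g c k i j x * u $ i * u $ j))"

lemma coords_charts_at: "c \<in> A \<Longrightarrow> x \<in> cmap c ` cdom c \<Longrightarrow> c \<in> charts_at A (cinv c x)"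
  by (simp add: charts_at_def cinv_in_cdom)

lemma gform_eq:
  assumes "c \<in> A" "x \<in> cmap c ` cdom c"
  shows "gform c x u w =
    g (cinv c x) (tvec_of_coords A c (cinv c x) u) (tvec_of_coords A c (cinv c x) w)"
proof -
  let ?p = "cinv c x"
  let ?L = "tvec_of_coords A c ?p"
  note c = coords_charts_at[OF assms]
  have L: "?L v \<in> tangent_space A ?p" for v by (rule tvec_of_coords_in_tangent_space[OF c])
  have comb: "g ?p (?L (a *\<^sub>R u + b *\<^sub>R v)) (?L w) = a * g ?p (?L u) (?L w) + b * g ?p (?L v) (?L w)"
    for a b u v w
    unfolding linear_tvec_of_coords[OF c] by (rule metric_linear[OF L L L])
  have lin: "linear (\<lambda>u. g ?p (?L u) (?L w))" for w
    using comb[of 1 _ 1] comb[of _ _ 0 0] by (intro linearI) simp_all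
  have left: "g ?p (?L u) (?L w) = (\<Sum>i\<in>UNIV. u $ i * g ?p (?L (axis i 1)) (?L w))" for u w
  proof -
    have "g ?p (?L (\<Sum>i\<in>UNIV. u $ i *\<^sub>R axis i 1)) (?L w) =
        (\<Sum>i\<in>UNIV. g ?p (?L (u $ i *\<^sub>R axis i 1)) (?L w))"
      by (rule linear_sum[OF lin])
    then show ?thesis by (simp add: vec_eq_sum_axis linear_cmul[OF lin])
  qed
  have right: "g ?p (?L (axis i 1)) (?L w) = (\<Sum>j\<in>UNIV. w $ j * metric_comp A g c i j x)" for i
    unfolding metric_comp_def metric_sym[OF L L, of "axis i 1"] by (rule left)
  show ?thesis
    unfolding left[of u w] right gform_def by (simp add: sum_distrib_left mult_ac)
qed

lemma gform_sym:
  assumes "c \<in> A" "x \<in> cmap c ` cdom c"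
  shows "gform c x u w = gform c x w u"
  unfolding gform_eq[OF assms]
  by (intro metric_sym tvec_of_coords_in_tangent_space coords_charts_at assms)

lemma gform_add_left: "gform c x (u + v) w = gform c x u w + gform c x v w"
  by (simp add: gform_def sum.distrib algebra_simps)

lemma gform_transition:
  assumes "c \<in> A" "d \<in> A" "x \<in> overlap c d"
  shows "gform c x u w =
    gform d (transition c d x) (transition_deriv c d x u) (transition_deriv c d x w)"
proof -
  have x: "x \<in> cmap c ` cdom c" "cinv c x \<in> cdom d" 
    using assms(3) unfolding overlap_eq[OF assms(1)] by auto
  have "transition c d x \<in> cmap d ` cdom d" using x by auto
  moreover have "cinv d (transition c d x) = cinv c x"
    using cinv_cmap[of d "cinv c x"] assms x by (simp add: charts_at_def)
  ultimately show ?thesis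
    unfolding gform_eq[OF assms(1) x(1)] gform_eq[OF assms(2)]
    by (simp add: gform_eq[OF assms(2)] tvec_of_coords_transition[OF assms])
qed

lemma metric_comp_has_derivative:
  assumes "c \<in> A" "x \<in> cmap c ` cdom c"
  shows "(metric_comp A g c i j has_derivative frechet_derivative (metric_comp A g c i j) (at x)) (at x)"
proof -
  have "metric_comp A g c i j differentiable (at x)"
    using metric_C1[OF assms(1), of i j] assms(2) unfolding One_nat_def Ck_on.simps by blast
  then show ?thesis by (simp add: frechet_derivative_works)
qed

lemma continuous_on_metric_comp:
  "c \<in> A \<Longrightarrow> continuous_on (cmap c ` cdom c) (metric_comp A g c i j)"
  by (intro continuous_at_imp_continuous_on ballI)
    (rule has_derivative_continuous[OF metric_comp_has_derivative])

lemma continuous_on_metric_partial: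
  "c \<in> A \<Longrightarrow> continuous_on (cmap c ` cdom c) (metric_partial A g c i j l)"
  using metric_C1[of c j l] unfolding One_nat_def Ck_on.simps metric_partial_def[abs_def] by blast

text \<open>All three arguments depend on a common variable. This variable is the base point when
  charts are changed, and time when \<open>g(u,u)\<close> is differentiated along a
  solution.\<close>

lemma gform_has_derivative:
  assumes "c \<in> A" "Y t \<in> cmap c ` cdom c"
    and Y: "(Y has_derivative Y') (at t within I)"
    and P: "(P has_derivative P') (at t within I)"
    and Q: "(Q has_derivative Q') (at t within I)"
  shows "((\<lambda>s. gform c (Y s) (P s) (Q s)) has_derivative
    (\<lambda>h. dgform c (Y t) (Y' h) (P t) (Q t) + gform c (Y t) (P' h) (Q t) + gform c (Y t) (P t) (Q' h)))
    (at t within I)"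
proof -
  have "((\<lambda>s. \<Sum>i\<in>UNIV. \<Sum>j\<in>UNIV. metric_comp A g c i j (Y s) * (P s $ i * Q s $ j)) has_derivative
    (\<lambda>h. \<Sum>i\<in>UNIV. \<Sum>j\<in>UNIV. metric_comp A g c i j (Y t) * (P t $ i * Q' h $ j + P' h $ i * Q t $ j) +
      frechet_derivative (metric_comp A g c i j) (at (Y t)) (Y' h) * (P t $ i * Q t $ j)))
    (at t within I)"
    by (intro has_derivative_sum has_derivative_mult has_derivative_vec_componentwise P Q
        has_derivative_compose[OF Y metric_comp_has_derivative[OF assms(1,2)]])
  then show ?thesis
    unfolding gform_def dgform_def
    by (rule has_derivative_eq_rhs) (simp add: fun_eq_iff sum.distrib algebra_simps)
qed

text \<open>Both sides of \<open>gform_transition\<close> are differentiated in \<open>x\<close>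
  with \<open>p\<close> and \<open>q\<close> fixed; on the right the vectors depend on
  \<open>x\<close> through the derivative of the transition map. Uniqueness of the derivative gives
  the identity.\<close>

lemma dgform_transition:
  assumes cd: "c \<in> A" "d \<in> A" "x \<in> overlap c d"
  defines "D \<equiv> transition_deriv c d x" and "D2 \<equiv> transition_deriv2 c d x" and "y \<equiv> transition c d x"
  shows "dgform c x z p q =
    dgform d y (D z) (D p) (D q) + gform d y (D2 z p) (D q) + gform d y (D p) (D2 z q)"
proof -
  have x: "x \<in> cmap c ` cdom c" "y \<in> cmap d ` cdom d"
    using cd overlap_eq[of c d] by (auto simp: y_def)
  have "((\<lambda>x. gform c x p q) has_derivative
      (\<lambda>z. dgform c x z p q + gform c x 0 q + gform c x p 0)) (at x)"
    using gform_has_derivative[OF cd(1) x(1) has_derivative_ident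
        has_derivative_const[of p] has_derivative_const[of q]] .
  then have 1: "((\<lambda>x. gform c x p q) has_derivative (\<lambda>z. dgform c x z p q)) (at x)"
    by (simp add: gform_def)
  have "((\<lambda>x. gform d (transition c d x) (transition_deriv c d x p) (transition_deriv c d x q))
      has_derivative (\<lambda>z. dgform d y (D z) (D p) (D q) + gform d y (D2 z p) (D q) +
        gform d y (D p) (D2 z q))) (at x)"
    unfolding D_def D2_def y_def
    by (rule gform_has_derivative[OF cd(2)])
      (use x(2) in \<open>simp add: y_def\<close>, intro transition_has_derivative[OF cd]
        transition_deriv_has_derivative[OF cd])+
  then have "((\<lambda>x. gform c x p q) has_derivative (\<lambda>z. dgform d y (D z) (D p) (D q) +
      gform d y (D2 z p) (D q) + gform d y (D p) (D2 z q))) (at x)"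
    by (rule has_derivative_transform_within_open[OF _ open_overlap[OF cd(1,2)] cd(3)])
      (rule gform_transition[OF cd(1,2), symmetric])
  from has_derivative_unique[OF 1 this] show ?thesis by (rule fun_cong)
qed

text \<open>The terms with second derivatives of the transition map cancel because of their symmetry.\<close>

lemma EL_transition:
  assumes cd: "c \<in> A" "d \<in> A" "x \<in> overlap c d"
  shows "EL c x u a w = EL d (transition c d x) (transition_deriv c d x u)
    (transition_deriv c d x a + transition_deriv2 c d x u u) (transition_deriv c d x w)"
proof -
  have "transition c d x \<in> cmap d ` cdom d"
    using cd overlap_eq[of c d] by auto
  then show ?thesis
    unfolding EL_def gform_transition[OF cd] dgform_transition[OF cd] gform_add_left
    using gform_sym[OF cd(2), of "transition c d x" "transition_deriv2 c d x w u"]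
    by (simp add: transition_deriv2_symmetric[OF cd, of w] add_divide_distrib)
qed

text \<open>With the coordinates of an orthonormal frame as the columns of \<open>P\<close>, the
  Gram matrix is diagonal with entries 1 and -1. The product formula for determinants then excludes
  a singular metric matrix.\<close>

lemma det_metric_matrix:
  assumes "c \<in> A" "x \<in> cmap c ` cdom c"
  shows "det (metric_matrix A g c x) \<noteq> 0"
proof -
  let ?p = "cinv c x" and ?M = "metric_matrix A g c x"
  note c = coords_charts_at[OF assms]
  obtain e i0 where e: "\<And>i::'n. e i \<in> tangent_space A ?p"
    "\<And>i j. g ?p (e i) (e j) = (if i \<noteq> j then 0 else if i = i0 then - 1 else 1)"
    using metric_signature by metis
  define P :: "real^'n^'n" where "P = (\<chi> k i. e i c $ k)"
  have "(transpose P ** ?M ** P) $ i $ j = g ?p (e i) (e j)" for i j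
  proof -
    have "(transpose P ** ?M ** P) $ i $ j = gform c x (e i c) (e j c)"
      unfolding gform_def metric_matrix_def P_def matrix_matrix_mult_def transpose_def
      by (simp add: sum_distrib_right sum_distrib_left mult_ac)
         (rule sum.swap)
    then show ?thesis
      by (simp add: gform_eq[OF assms] tvec_of_coords_inverse[OF c e(1)])
  qed
  then have "det (transpose P ** ?M ** P) = (\<Prod>i\<in>UNIV. if i = i0 then - 1 else 1)"
    by (subst det_diagonal) (auto simp: e(2) intro!: prod.cong)
  then have "det (transpose P ** ?M ** P) \<noteq> 0" by (simp add: prod_zero_iff)
  then show ?thesis by (auto simp: det_mul)
qed

text \<open>\<open>EL\<close> is the inner product of the test vector with
  \<open>M *v a + (1/2) *\<^sub>R R\<close>. It vanishes for all test vectors iff this linear system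
  for \<open>a\<close> holds, and multiplying by the inverse metric matrix yields the Christoffel
  symbols.\<close>

lemma EL_zero_iff:
  assumes cx: "c \<in> A" "x \<in> cmap c ` cdom c"
  shows "(\<forall>w. EL c x u a w = 0) \<longleftrightarrow> a = geod_acc c x u"
proof -
  define M where "M = metric_matrix A g c x"
  define P where "P = (\<lambda>i j l. metric_partial A g c i j l x)"
  \<comment> \<open>Twice the Christoffel symbols of the first kind, contracted with
    \<open>u\<close> in both lower slots; \<open>P i j l\<close> is the partial derivative in
    direction \<open>i\<close> of the component with indices \<open>j\<close> and
    \<open>l\<close>.\<close>
  define R :: "real^'n" where
    "R = (\<chi> l. \<Sum>i\<in>UNIV. \<Sum>j\<in>UNIV. (P i j l + P j i l - P l i j) * (u $ i * u $ j))"
  have inv: "invertible M"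
    using det_metric_matrix[OF cx] by (simp add: invertible_det_nz M_def)
  have dg: "dgform c x z v w = (\<Sum>l\<in>UNIV. \<Sum>i\<in>UNIV. \<Sum>j\<in>UNIV. z $ l * (P l i j * (v $ i * w $ j)))"
    for z v w
  proof -
    have "frechet_derivative (metric_comp A g c i j) (at x) z = (\<Sum>l\<in>UNIV. z $ l * P l i j)" for i j
    proof -
      have lin: "linear (frechet_derivative (metric_comp A g c i j) (at x))"
        using has_derivative_linear[OF metric_comp_has_derivative[OF cx]] .
      have "frechet_derivative (metric_comp A g c i j) (at x) (\<Sum>l\<in>UNIV. z $ l *\<^sub>R axis l 1) =
          (\<Sum>l\<in>UNIV. frechet_derivative (metric_comp A g c i j) (at x) (z $ l *\<^sub>R axis l 1))"
        by (rule linear_sum[OF lin])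
      then show ?thesis
        by (simp add: vec_eq_sum_axis linear_cmul[OF lin] P_def metric_partial_def)
    qed
    then have "dgform c x z v w = (\<Sum>i\<in>UNIV. \<Sum>j\<in>UNIV. \<Sum>l\<in>UNIV. z $ l * (P l i j * (v $ i * w $ j)))"
      unfolding dgform_def by (simp add: sum_distrib_right sum_distrib_left mult_ac)
    also have "\<dots> = (\<Sum>i\<in>UNIV. \<Sum>l\<in>UNIV. \<Sum>j\<in>UNIV. z $ l * (P l i j * (v $ i * w $ j)))"
      by (intro sum.cong refl sum.swap)
    also have "\<dots> = (\<Sum>l\<in>UNIV. \<Sum>i\<in>UNIV. \<Sum>j\<in>UNIV. z $ l * (P l i j * (v $ i * w $ j)))"
      by (rule sum.swap)
    finally show ?thesis .
  qed
  have gf: "gform c x a w = w \<bullet> (M *v a)" for a w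
  proof -
    have "gform c x w a = w \<bullet> (M *v a)"
      by (simp add: gform_def M_def metric_matrix_def inner_vec_def matrix_vector_mult_def
          sum_distrib_left mult_ac)
    then show ?thesis using gform_sym[OF cx] by metis
  qed
  \<comment> \<open>The first two terms of \<open>R\<close> have the same contraction with
    \<open>u\<close> and \<open>u\<close>, by renaming \<open>i\<close> and \<open>j\<close>; hence
    the factor 2.\<close>
  have R: "w \<bullet> R = 2 * dgform c x u u w - dgform c x w u u" for w
  proof -
    have "w \<bullet> R = (\<Sum>l\<in>UNIV. \<Sum>i\<in>UNIV. \<Sum>j\<in>UNIV. w $ l * (P i j l * (u $ i * u $ j)))
      + (\<Sum>l\<in>UNIV. \<Sum>i\<in>UNIV. \<Sum>j\<in>UNIV. w $ l * (P j i l * (u $ i * u $ j))) - dgform c x w u u"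
      unfolding dg by (simp add: inner_vec_def R_def sum_distrib_left sum.distrib[symmetric]
          sum_subtractf[symmetric] algebra_simps)
    moreover have "(\<Sum>l\<in>UNIV. \<Sum>i\<in>UNIV. \<Sum>j\<in>UNIV. w $ l * (P j i l * (u $ i * u $ j))) =
        (\<Sum>l\<in>UNIV. \<Sum>i\<in>UNIV. \<Sum>j\<in>UNIV. w $ l * (P i j l * (u $ i * u $ j)))"
      by (subst sum.swap[of _ UNIV UNIV]) (simp add: mult_ac)
    moreover have "(\<Sum>l\<in>UNIV. \<Sum>i\<in>UNIV. \<Sum>j\<in>UNIV. w $ l * (P i j l * (u $ i * u $ j))) =
        (\<Sum>i\<in>UNIV. \<Sum>l\<in>UNIV. \<Sum>j\<in>UNIV. w $ l * (P i j l * (u $ i * u $ j)))"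
      by (rule sum.swap)
    moreover have "\<dots> = (\<Sum>i\<in>UNIV. \<Sum>j\<in>UNIV. \<Sum>l\<in>UNIV. w $ l * (P i j l * (u $ i * u $ j)))"
      by (intro sum.cong refl sum.swap)
    moreover have "\<dots> = dgform c x u u w" unfolding dg by (simp add: mult_ac)
    ultimately show ?thesis by simp
  qed
  have EL: "EL c x u a w = w \<bullet> (M *v a + (1/2) *\<^sub>R R)" for w
    by (simp add: EL_def gf inner_add_right R)
  have acc: "geod_acc c x u = - ((1/2) *\<^sub>R (matrix_inv M *v R))"
  proof -
    have "(\<Sum>i\<in>UNIV. \<Sum>j\<in>UNIV. christoffel A g c k i j x * u $ i * u $ j) =
        1/2 * (matrix_inv M *v R) $ k" for k
    proof -
      have "(\<Sum>i\<in>UNIV. \<Sum>j\<in>UNIV. christoffel A g c k i j x * u $ i * u $ j) =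
        (\<Sum>i\<in>UNIV. \<Sum>j\<in>UNIV. \<Sum>l\<in>UNIV. 1/2 * (matrix_inv M $ k $ l * ((P i j l + P j i l - P l i j) * (u $ i * u $ j))))"
        by (simp add: christoffel_def M_def P_def sum_distrib_left sum_distrib_right mult_ac)
      also have "\<dots> = (\<Sum>i\<in>UNIV. \<Sum>l\<in>UNIV. \<Sum>j\<in>UNIV. 1/2 * (matrix_inv M $ k $ l * ((P i j l + P j i l - P l i j) * (u $ i * u $ j))))"
        by (intro sum.cong refl sum.swap)
      also have "\<dots> = (\<Sum>l\<in>UNIV. \<Sum>i\<in>UNIV. \<Sum>j\<in>UNIV. 1/2 * (matrix_inv M $ k $ l * ((P i j l + P j i l - P l i j) * (u $ i * u $ j))))"
        by (rule sum.swap)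
      also have "\<dots> = 1/2 * (matrix_inv M *v R) $ k"
        by (simp add: matrix_vector_mult_def R_def sum_distrib_left)
      finally show ?thesis .
    qed
    then show ?thesis by (simp add: geod_acc_def vec_eq_iff)
  qed
  have mv: "matrix_inv M *v (- ((1/2) *\<^sub>R R)) = - ((1/2) *\<^sub>R (matrix_inv M *v R))"
    using matrix_vector_mult_scaleR[of "matrix_inv M" "- (1/2)" R] by simp
  have "(\<forall>w. EL c x u a w = 0) \<longleftrightarrow> M *v a + (1/2) *\<^sub>R R = 0"
    unfolding EL by (metis inner_eq_zero_iff inner_zero_right)
  also have "\<dots> \<longleftrightarrow> a = geod_acc c x u"
  proof
    assume "M *v a + (1/2) *\<^sub>R R = 0"
    then have "M *v a = - ((1/2) *\<^sub>R R)" by (rule eq_neg_iff_add_eq_0[THEN iffD2])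
    then have "matrix_inv M *v (M *v a) = matrix_inv M *v (- ((1/2) *\<^sub>R R))" by (rule arg_cong)
    then have "a = matrix_inv M *v (- ((1/2) *\<^sub>R R))"
      by (simp only: matrix_vector_mul_assoc matrix_inv_invertible[OF inv] matrix_vector_mul_lid)
    then show "a = geod_acc c x u"
      unfolding acc mv .
  next
    assume "a = geod_acc c x u"
    then have "a = matrix_inv M *v (- ((1/2) *\<^sub>R R))" unfolding acc mv .
    then have "M *v a = - ((1/2) *\<^sub>R R)"
      by (simp only: matrix_vector_mul_assoc matrix_inv_invertible[OF inv] matrix_vector_mul_lid)
    then show "M *v a + (1/2) *\<^sub>R R = 0" by simp
  qed
  finally show ?thesis .
qed

text \<open>The transformation law of the Christoffel symbols, contracted with \<open>u\<close>. The
  acceleration makes \<open>EL\<close> vanish in \<open>c\<close>, hence its transform does so in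
  \<open>d\<close> for every test vector, which characterizes the acceleration in
  \<open>d\<close>.\<close>

lemma geod_acc_transition:
  assumes cd: "c \<in> A" "d \<in> A" "x \<in> overlap c d"
  shows "transition_deriv c d x (geod_acc c x u) + transition_deriv2 c d x u u =
    geod_acc d (transition c d x) (transition_deriv c d x u)"
proof -
  have x: "x \<in> cmap c ` cdom c" "transition c d x \<in> cmap d ` cdom d"
    using cd overlap_eq[of c d] by auto
  have "EL c x u (geod_acc c x u) w = 0" for w
    using EL_zero_iff[OF cd(1) x(1)] by blast
  then have "EL d (transition c d x) (transition_deriv c d x u)
      (transition_deriv c d x (geod_acc c x u) + transition_deriv2 c d x u u) w = 0" for w
    using EL_transition[OF cd] transition_deriv_surj[OF cd, of w] by metis
  then show ?thesis using EL_zero_iff[OF cd(2) x(2)] by blast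
qed

lemma continuous_on_geod_acc:
  assumes "c \<in> A"
  shows "continuous_on (cmap c ` cdom c \<times> UNIV) (\<lambda>z. geod_acc c (fst z) (snd z))"
proof -
  have inv: "continuous_on (cmap c ` cdom c) (\<lambda>x. matrix_inv (metric_matrix A g c x) $ k $ l)" for k l
    by (rule continuous_on_matrix_inv_nth)
       (simp add: metric_matrix_def continuous_on_metric_comp assms, rule det_metric_matrix[OF assms])
  have "continuous_on (cmap c ` cdom c) (\<lambda>x. christoffel A g c k i j x)" for k i j
    unfolding christoffel_def
    by (intro continuous_intros inv continuous_on_metric_partial assms)
  then have "continuous_on (cmap c ` cdom c \<times> UNIV) (\<lambda>z::(real^'n)\<times>(real^'n). christoffel A g c k i j (fst z))"
    for k i j
    by (rule continuous_on_compose2) (auto intro: continuous_intros)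
  then show ?thesis
    unfolding geod_acc_def by (intro continuous_intros)
qed

text \<open>The case \<open>r = -1\<close> gives time reversal; \<open>r = norm u\<close> reduces
  estimates to unit vectors.\<close>

lemma geod_acc_scaleR: "geod_acc c x (r *\<^sub>R u) = r\<^sup>2 *\<^sub>R geod_acc c x u"
  by (simp add: geod_acc_def vec_eq_iff sum_distrib_left power2_eq_square mult_ac)

section \<open>Geodesics as solutions of a first-order equation in a chart\<close>

definition geod_field :: "('m, 'n) chart \<Rightarrow> (real^'n) \<times> (real^'n) \<Rightarrow> (real^'n) \<times> (real^'n)" where
  "geod_field c z = (snd z, geod_acc c (fst z) (snd z))"

text \<open>Keeping the velocity as a component of the unknown allows existence, gluing and limits
  to be treated in the coordinate space, with values in which convergence of positions and
  velocities is a single statement.\<close>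

definition chart_solution :: "('m, 'n) chart \<Rightarrow> real set \<Rightarrow> (real \<Rightarrow> (real^'n) \<times> (real^'n)) \<Rightarrow> bool" where
  "chart_solution c J z \<longleftrightarrow> (\<forall>t\<in>J. fst (z t) \<in> cmap c ` cdom c \<and>
    (z has_vector_derivative geod_field c (z t)) (at t within J))"

lemma continuous_on_geod_field:
  "c \<in> A \<Longrightarrow> continuous_on (cmap c ` cdom c \<times> UNIV) (geod_field c)"
  unfolding geod_field_def[abs_def] by (intro continuous_intros continuous_on_geod_acc)

lemma chart_solutionD:
  assumes "chart_solution c J z" "t \<in> J"
  shows "fst (z t) \<in> cmap c ` cdom c"
    and "(z has_vector_derivative geod_field c (z t)) (at t within J)"
    and "((\<lambda>t. fst (z t)) has_vector_derivative snd (z t)) (at t within J)"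
    and "((\<lambda>t. snd (z t)) has_vector_derivative geod_acc c (fst (z t)) (snd (z t))) (at t within J)"
proof -
  show z: "(z has_vector_derivative geod_field c (z t)) (at t within J)"
    and "fst (z t) \<in> cmap c ` cdom c"
    using assms by (auto simp: chart_solution_def)
  show "((\<lambda>t. fst (z t)) has_vector_derivative snd (z t)) (at t within J)"
    using bounded_linear.has_vector_derivative[OF bounded_linear_fst z] by (simp add: geod_field_def)
  show "((\<lambda>t. snd (z t)) has_vector_derivative geod_acc c (fst (z t)) (snd (z t))) (at t within J)"
    using bounded_linear.has_vector_derivative[OF bounded_linear_snd z] by (simp add: geod_field_def)
qed

lemma chart_solution_continuous: "chart_solution c J z \<Longrightarrow> continuous_on J z"
  unfolding continuous_on_eq_continuous_within
  using chart_solutionD(2) has_vector_derivative_continuous by blast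

lemma chart_solution_subset: "chart_solution c J z \<Longrightarrow> I \<subseteq> J \<Longrightarrow> chart_solution c I z"
  unfolding chart_solution_def by (meson has_vector_derivative_within_subset subsetD)

lemma chart_solution_shift:
  "chart_solution c {s + a..s + b} z \<Longrightarrow> chart_solution c {a..b} (\<lambda>t. z (s + t))"
  unfolding chart_solution_def by (intro ballI conjI has_vector_derivative_shift) auto

text \<open>Since the equation is of first order, equality at \<open>m\<close> already equates the
  one-sided derivatives: both are \<open>geod_field c\<close> of the common value.\<close>

lemma chart_solution_glue:
  assumes z: "chart_solution c {a..m} z" and w: "chart_solution c {m..b} w"
    and eq: "z m = w m" and m: "a < m" "m < b"
  shows "chart_solution c {a..b} (\<lambda>t. if t \<le> m then z t else w t)"
proof -
  have cl: "closure {a..m} \<inter> closure {m<..b} = {m}" using m by auto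
  have eqs: "{a..m} \<union> {m} = {a..m}" "{m<..b} \<union> {m} = {m..b}" using m by auto
  have "((\<lambda>t. if t \<in> {a..m} then z t else w t) has_vector_derivative
      (if t \<in> {a..m} then geod_field c (z t) else geod_field c (w t))) (at t within {a..b})"
    if t: "t \<in> {a..b}" for t
  proof (rule has_vector_derivative_If_within_closures)
    show "{a..b} = {a..m} \<union> {m<..b}" using m by auto
    show "(z has_vector_derivative geod_field c (z t))
        (at t within {a..m} \<union> closure {a..m} \<inter> closure {m<..b})"
      if "t \<in> {a..m} \<union> closure {a..m} \<inter> closure {m<..b}"
      using chart_solutionD(2)[OF z] that unfolding cl eqs by blast
    show "(w has_vector_derivative geod_field c (w t))
        (at t within {m<..b} \<union> closure {a..m} \<inter> closure {m<..b})"
      if "t \<in> {m<..b} \<union> closure {a..m} \<inter> closure {m<..b}"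
      using chart_solutionD(2)[OF w] that unfolding cl eqs by blast
  qed (use t m eq in auto)
  then have "((\<lambda>t. if t \<le> m then z t else w t) has_vector_derivative
      geod_field c (if t \<le> m then z t else w t)) (at t within {a..b})" if "t \<in> {a..b}" for t
    using that by (force intro: has_vector_derivative_transform[rotated 2])
  then show ?thesis
    using chart_solutionD(1)[OF z] chart_solutionD(1)[OF w] m by (auto simp: chart_solution_def)
qed

lemma chart_solution_exists:
  assumes "c \<in> A" "x \<in> cmap c ` cdom c"
  obtains d z where "d > 0" "z 0 = (x, u)" "chart_solution c {0..d} z"
proof -
  have S: "open (cmap c ` cdom c \<times> (UNIV :: (real^'n) set))"
    by (intro open_Times open_cimage assms open_UNIV)
  have xu: "(x, u) \<in> cmap c ` cdom c \<times> UNIV" using assms by auto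
  obtain d z where "d > 0" "z 0 = (x, u)" "\<And>t. t \<in> {0..d} \<Longrightarrow> z t \<in> cmap c ` cdom c \<times> UNIV"
    "\<And>t. t \<in> {0..d} \<Longrightarrow> (z has_vector_derivative geod_field c (z t)) (at t within {0..d})"
    using Peano_existence[OF S continuous_on_geod_field[OF assms(1)] xu] by metis
  with that show thesis unfolding chart_solution_def by (metis mem_Times_iff)
qed

text \<open>Time reversal of a forward solution with velocity \<open>- u\<close>. The reversed curve
  solves the same equation because the acceleration is even in the velocity.\<close>

lemma chart_solution_exists_backwards:
  assumes "c \<in> A" "x \<in> cmap c ` cdom c"
  obtains d z where "d > 0" "z 0 = (x, u)" "chart_solution c {-d..0} z"
proof -
  obtain d y where y: "d > 0" "y 0 = (x, - u)" "chart_solution c {0..d} y"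
    using chart_solution_exists[OF assms, of "- u"] by metis
  define z where "z t = (fst (y (- t)), - snd (y (- t)))" for t
  have "(z has_vector_derivative geod_field c (z t)) (at t within {-d..0})" if t: "t \<in> {-d..0}" for t
  proof -
    have t': "- t \<in> {0..d}" using t by auto
    have "(z has_vector_derivative
        (- snd (y (- t)), - (- geod_acc c (fst (y (- t))) (snd (y (- t)))))) (at t within {-d..0})"
      unfolding z_def
      using has_vector_derivative_reflect[OF chart_solutionD(3)[OF y(3) t']]
        has_vector_derivative_reflect[OF chart_solutionD(4)[OF y(3) t']]
      by (intro has_vector_derivative_Pair has_vector_derivative_minus) simp_all
    then show ?thesis
      using geod_acc_scaleR[of c "fst (y (- t))" "-1" "snd (y (- t))"]
      by (simp add: geod_field_def z_def)
  qed
  moreover have "fst (z t) \<in> cmap c ` cdom c" if "t \<in> {-d..0}" for t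
    using chart_solutionD(1)[OF y(3), of "- t"] that by (simp add: z_def)
  ultimately have "chart_solution c {-d..0} z" by (simp add: chart_solution_def)
  then show thesis using that[of d z] y by (simp add: z_def)
qed

section \<open>From geodesics to chart solutions and back\<close>

lemma geodesic_has_vector_derivative:
  assumes \<gamma>: "geodesic A g I \<gamma>" and "c \<in> A" "t \<in> I" "\<gamma> t \<in> cdom c"
  shows "((\<lambda>t. cmap c (\<gamma> t)) has_vector_derivative cvel c I \<gamma> t) (at t within I)"
    and "(cvel c I \<gamma> has_vector_derivative geod_acc c (cmap c (\<gamma> t)) (cvel c I \<gamma> t)) (at t within I)"
proof -
  have d: "(cmap c \<circ> \<gamma>) differentiable (at t within I)" "cvel c I \<gamma> differentiable (at t within I)"
    using assms unfolding geodesic_def C2_curve_def by blast+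
  show "((\<lambda>t. cmap c (\<gamma> t)) has_vector_derivative cvel c I \<gamma> t) (at t within I)"
    using d(1)[unfolded vector_derivative_works] by (simp add: cvel_def o_def)
  have "cacc c I \<gamma> t = geod_acc c (cmap c (\<gamma> t)) (cvel c I \<gamma> t)"
    using \<gamma> assms(2-4) unfolding geodesic_def
    by (simp add: geod_acc_def vec_eq_iff eq_neg_iff_add_eq_0)
  then show "(cvel c I \<gamma> has_vector_derivative geod_acc c (cmap c (\<gamma> t)) (cvel c I \<gamma> t)) (at t within I)"
    using d(2)[unfolded vector_derivative_works] by (simp add: cacc_def)
qed

lemma geodesic_interval:
  "geodesic A g I \<gamma> \<Longrightarrow> is_interval I" "geodesic A g I \<gamma> \<Longrightarrow> interior I \<noteq> {}"
  "geodesic A g I \<gamma> \<Longrightarrow> continuous_on I \<gamma>"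
  by (auto simp: geodesic_def C2_curve_def)

text \<open>Continuity of the second derivative is automatic: by the equation it is a continuous
  function of position and velocity.\<close>

lemma geodesicI:
  assumes I: "is_interval I" "interior I \<noteq> {}" and \<gamma>: "continuous_on I \<gamma>"
    and pos: "\<And>c t. c \<in> A \<Longrightarrow> t \<in> I \<Longrightarrow> \<gamma> t \<in> cdom c \<Longrightarrow>
      ((\<lambda>t. cmap c (\<gamma> t)) has_vector_derivative cvel c I \<gamma> t) (at t within I)"
    and vel: "\<And>c t. c \<in> A \<Longrightarrow> t \<in> I \<Longrightarrow> \<gamma> t \<in> cdom c \<Longrightarrow>
      (cvel c I \<gamma> has_vector_derivative geod_acc c (cmap c (\<gamma> t)) (cvel c I \<gamma> t)) (at t within I)"
  shows "geodesic A g I \<gamma>"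
proof -
  have acc: "cacc c I \<gamma> t = geod_acc c (cmap c (\<gamma> t)) (cvel c I \<gamma> t)"
    if "c \<in> A" "t \<in> I" "\<gamma> t \<in> cdom c" for c t
    unfolding cacc_def
    by (rule vector_derivative_within[OF at_within_interval_neq_bot[OF I that(2)] vel[OF that]])
  have "continuous_on {t \<in> I. \<gamma> t \<in> cdom c} (cacc c I \<gamma>)" if c: "c \<in> A" for c
  proof -
    let ?J = "{t \<in> I. \<gamma> t \<in> cdom c}"
    have "continuous_on ?J (cvel c I \<gamma>)" "continuous_on ?J (\<lambda>t. cmap c (\<gamma> t))"
      unfolding continuous_on_eq_continuous_within
      using has_vector_derivative_continuous[OF vel[OF c]]
        has_vector_derivative_continuous[OF pos[OF c]]
      by (auto intro: continuous_within_subset)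
    then have "continuous_on ?J (\<lambda>t. (cmap c (\<gamma> t), cvel c I \<gamma> t))" by (intro continuous_intros)
    from continuous_on_compose2[OF continuous_on_geod_acc[OF c] this]
    have "continuous_on ?J (\<lambda>t. geod_acc c (cmap c (\<gamma> t)) (cvel c I \<gamma> t))" by auto
    then show ?thesis by (rule continuous_on_eq) (use acc c in auto)
  qed
  moreover have "(cmap c \<circ> \<gamma>) differentiable (at t within I) \<and> cvel c I \<gamma> differentiable (at t within I)"
    if "c \<in> A" "t \<in> I" "\<gamma> t \<in> cdom c" for c t
    using pos[OF that] vel[OF that] differentiableI_vector by (auto simp: o_def)
  ultimately have "C2_curve A I \<gamma>" using I \<gamma> by (simp add: C2_curve_def)
  then show ?thesis
    using acc by (simp add: geodesic_def geod_acc_def)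
qed

text \<open>\<open>cvel\<close> refers to the interval, so restriction is not a mere matter of
  definition: derivatives within \<open>J\<close> and within \<open>I\<close> agree because those
  within the nondegenerate interval \<open>J\<close> are unique.\<close>

lemma geodesic_subset:
  assumes \<gamma>: "geodesic A g I \<gamma>" and J: "J \<subseteq> I" "is_interval J" "interior J \<noteq> {}"
  shows "geodesic A g J \<gamma>"
    and "\<And>c t. c \<in> A \<Longrightarrow> t \<in> J \<Longrightarrow> \<gamma> t \<in> cdom c \<Longrightarrow> cvel c J \<gamma> t = cvel c I \<gamma> t"
proof -
  show vel: "cvel c J \<gamma> t = cvel c I \<gamma> t" if "c \<in> A" "t \<in> J" "\<gamma> t \<in> cdom c" for c t
    unfolding cvel_def[of c J]
    using geodesic_has_vector_derivative(1)[OF \<gamma> that(1) _ that(3)] J(1) that(2)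
    by (intro vector_derivative_within at_within_interval_neq_bot J)
      (auto simp: o_def intro: has_vector_derivative_within_subset)
  have cont: "continuous_on J \<gamma>" using geodesic_interval(3)[OF \<gamma>] J(1) continuous_on_subset by blast
  show "geodesic A g J \<gamma>"
  proof (rule geodesicI[OF J(2,3) cont])
    fix c t assume t: "c \<in> A" "t \<in> J" "\<gamma> t \<in> cdom c"
    then have tI: "t \<in> I" using J(1) by blast
    show "((\<lambda>t. cmap c (\<gamma> t)) has_vector_derivative cvel c J \<gamma> t) (at t within J)"
      using has_vector_derivative_within_subset[OF geodesic_has_vector_derivative(1)[OF \<gamma> t(1) tI t(3)] J(1)]
      by (simp add: vel t)
    have V: "(cvel c I \<gamma> has_vector_derivative geod_acc c (cmap c (\<gamma> t)) (cvel c I \<gamma> t)) (at t within J)"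
      using has_vector_derivative_within_subset[OF geodesic_has_vector_derivative(2)[OF \<gamma> t(1) tI t(3)] J(1)] .
    have "continuous (at t within J) \<gamma>" using cont t(2) continuous_on_eq_continuous_within by blast
    then have "\<forall>\<^sub>F s in at t within J. \<gamma> s \<in> cdom c"
      unfolding continuous_within using open_cdom[OF t(1)] t(3) topological_tendstoD by blast
    then obtain d where d: "d > 0" "\<And>s. s \<in> J \<Longrightarrow> s \<noteq> t \<Longrightarrow> dist s t < d \<Longrightarrow> \<gamma> s \<in> cdom c"
      unfolding eventually_at by blast
    have "(cvel c J \<gamma> has_vector_derivative geod_acc c (cmap c (\<gamma> t)) (cvel c I \<gamma> t)) (at t within J)"
      by (rule has_vector_derivative_transform_within[OF V d(1) t(2)]) (metis d(2) vel t)
    then show "(cvel c J \<gamma> has_vector_derivative geod_acc c (cmap c (\<gamma> t)) (cvel c J \<gamma> t)) (at t within J)"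
      by (simp add: vel t)
  qed
qed

lemma geodesic_cvel_transition:
  assumes \<gamma>: "geodesic A g I \<gamma>" and t: "t \<in> I"
    and c: "c \<in> charts_at A (\<gamma> t)" and d: "d \<in> charts_at A (\<gamma> t)"
  shows "cvel d I \<gamma> t = transition_deriv c d (cmap c (\<gamma> t)) (cvel c I \<gamma> t)"
proof -
  have cd: "c \<in> A" "d \<in> A" "\<gamma> t \<in> cdom c" "\<gamma> t \<in> cdom d" "cmap c (\<gamma> t) \<in> overlap c d"
    using c d by (auto simp: charts_at_def)
  have "continuous (at t within I) \<gamma>"
    using geodesic_interval(3)[OF \<gamma>] t continuous_on_eq_continuous_within by blast
  then have "\<forall>\<^sub>F s in at t within I. \<gamma> s \<in> cdom c"
    unfolding continuous_within using open_cdom[OF cd(1)] cd(3) topological_tendstoD by blast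
  then obtain e where e: "e > 0" "\<And>s. s \<in> I \<Longrightarrow> s \<noteq> t \<Longrightarrow> dist s t < e \<Longrightarrow> \<gamma> s \<in> cdom c"
    unfolding eventually_at by blast
  have "((\<lambda>s. transition c d (cmap c (\<gamma> s))) has_vector_derivative
      transition_deriv c d (cmap c (\<gamma> t)) (cvel c I \<gamma> t)) (at t within I)"
    by (rule transition_along_curve[OF cd(1,2,5) geodesic_has_vector_derivative(1)[OF \<gamma> cd(1) t cd(3)]])
  then have "(cmap d \<circ> \<gamma> has_vector_derivative
      transition_deriv c d (cmap c (\<gamma> t)) (cvel c I \<gamma> t)) (at t within I)"
  proof (rule has_vector_derivative_transform_within[OF _ e(1) t])
    fix s assume "s \<in> I" "dist s t < e"
    then have "\<gamma> s \<in> cdom c" using e(2) cd(3) by (cases "s = t") auto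
    then show "transition c d (cmap c (\<gamma> s)) = (cmap d \<circ> \<gamma>) s"
      using cinv_cmap[of c "\<gamma> s"] cd(1) by (simp add: charts_at_def)
  qed
  then show ?thesis unfolding cvel_def
    by (intro vector_derivative_within at_within_interval_neq_bot[OF geodesic_interval(1,2)[OF \<gamma> ]] t)
qed

lemma geodesic_chart_solution:
  assumes \<gamma>: "geodesic A g I \<gamma>" and "c \<in> A" "J \<subseteq> I" "\<gamma> ` J \<subseteq> cdom c"
  shows "chart_solution c J (\<lambda>t. (cmap c (\<gamma> t), cvel c I \<gamma> t))"
  unfolding chart_solution_def
proof (intro ballI conjI)
  fix t assume "t \<in> J"
  then have t: "t \<in> I" "\<gamma> t \<in> cdom c" using assms by auto
  then show "fst (cmap c (\<gamma> t), cvel c I \<gamma> t) \<in> cmap c ` cdom c" by simp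
  show "((\<lambda>t. (cmap c (\<gamma> t), cvel c I \<gamma> t)) has_vector_derivative
      geod_field c (cmap c (\<gamma> t), cvel c I \<gamma> t)) (at t within J)"
    unfolding geod_field_def fst_conv snd_conv
    by (intro has_vector_derivative_Pair has_vector_derivative_within_subset[OF _ assms(3)]
        geodesic_has_vector_derivative \<gamma> assms(2) t)
qed

lemma continuous_on_cinv: "c \<in> A \<Longrightarrow> continuous_on (cmap c ` cdom c) (cinv c)"
  using chart_homeomorphism by (simp add: homeomorphism_def)

text \<open>The equation has to be verified in every chart \<open>d\<close> met by the curve. There
  the velocity is the image of \<open>snd (z t)\<close> under the derivative of the transition map,
  and its derivative is computed by \<open>transition_deriv_along_curve\<close> and identified by
  \<open>geod_acc_transition\<close>.\<close>

lemma chart_solution_geodesic: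
  assumes c: "c \<in> A" and J: "is_interval J" "interior J \<noteq> {}" and z: "chart_solution c J z"
  defines "\<gamma> \<equiv> \<lambda>t. cinv c (fst (z t))"
  shows "geodesic A g J \<gamma>"
    and "\<And>t. t \<in> J \<Longrightarrow> velocity A J \<gamma> t = tvec_of_coords A c (\<gamma> t) (snd (z t))"
proof -
  have x: "fst (z t) \<in> cmap c ` cdom c" if "t \<in> J" for t using chart_solutionD(1)[OF z that] .
  have xc: "continuous_on J (\<lambda>t. fst (z t))"
    using chart_solution_continuous[OF z] by (intro continuous_intros)
  have \<gamma>: "continuous_on J \<gamma>" unfolding \<gamma>_def
    by (rule continuous_on_compose2[OF continuous_on_cinv[OF c] xc]) (use x in auto)
  have ov: "fst (z t) \<in> overlap c d" if "t \<in> J" "\<gamma> t \<in> cdom d" for d t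
    unfolding overlap_eq[OF c] using x[OF that(1)] that(2) by (simp add: \<gamma>_def)
  have pos: "((\<lambda>t. cmap d (\<gamma> t)) has_vector_derivative transition_deriv c d (fst (z t)) (snd (z t)))
      (at t within J)" if "d \<in> A" "t \<in> J" "\<gamma> t \<in> cdom d" for d t
    using transition_along_curve[OF c that(1) ov[OF that(2,3)] chart_solutionD(3)[OF z that(2)]]
    by (simp add: \<gamma>_def)
  have vel: "cvel d J \<gamma> t = transition_deriv c d (fst (z t)) (snd (z t))"
    if "d \<in> A" "t \<in> J" "\<gamma> t \<in> cdom d" for d t
    unfolding cvel_def
    by (rule vector_derivative_within[OF at_within_interval_neq_bot[OF J that(2)]])
       (use pos[OF that] in \<open>simp add: o_def\<close>)
  show "geodesic A g J \<gamma>"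
  proof (rule geodesicI[OF J \<gamma>])
    fix d t assume t: "d \<in> A" "t \<in> J" "\<gamma> t \<in> cdom d"
    show "((\<lambda>t. cmap d (\<gamma> t)) has_vector_derivative cvel d J \<gamma> t) (at t within J)"
      unfolding vel[OF t] by (rule pos[OF t])
    have "continuous (at t within J) (\<lambda>t. fst (z t))"
      using xc t(2) continuous_on_eq_continuous_within by blast
    then have "\<forall>\<^sub>F s in at t within J. fst (z s) \<in> overlap c d"
      unfolding continuous_within
      using open_overlap[OF c t(1)] ov[OF t(2,3)] topological_tendstoD by blast
    then obtain e where "e > 0" "\<And>s. s \<in> J \<Longrightarrow> s \<noteq> t \<Longrightarrow> dist s t < e \<Longrightarrow> fst (z s) \<in> overlap c d"
      unfolding eventually_at by blast
    with ov[OF t(2,3)] have e: "e > 0" "\<And>s. s \<in> J \<Longrightarrow> dist s t < e \<Longrightarrow> fst (z s) \<in> overlap c d"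
      by metis+
    have "((\<lambda>s. transition_deriv c d (fst (z s)) (snd (z s))) has_vector_derivative
        geod_acc d (cmap d (\<gamma> t)) (cvel d J \<gamma> t)) (at t within J)"
      using transition_deriv_along_curve[OF c t(1) ov[OF t(2,3)] chart_solutionD(3,4)[OF z t(2)] t(2) e]
      unfolding geod_acc_transition[OF c t(1) ov[OF t(2,3)]] vel[OF t] by (simp add: \<gamma>_def)
    then show "(cvel d J \<gamma> has_vector_derivative geod_acc d (cmap d (\<gamma> t)) (cvel d J \<gamma> t)) (at t within J)"
    proof (rule has_vector_derivative_transform_within[OF _ e(1) t(2)])
      fix s assume s: "s \<in> J" "dist s t < e"
      then have "\<gamma> s \<in> cdom d" using e(2) overlap_eq[OF c] by (auto simp: \<gamma>_def)
      then show "transition_deriv c d (fst (z s)) (snd (z s)) = cvel d J \<gamma> s"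
        using vel[OF t(1) s(1)] by simp
    qed
  qed
  fix t assume t: "t \<in> J"
  show "velocity A J \<gamma> t = tvec_of_coords A c (\<gamma> t) (snd (z t))"
    using vel[OF _ t] cmap_cinv[OF c x[OF t]]
    by (auto simp: velocity_def tvec_of_coords_def charts_at_def \<gamma>_def fun_eq_iff)
qed

text \<open>Conservation of \<open>g(u,u)\<close>: its time derivative is twice \<open>EL\<close>
  tested with the velocity itself. In particular the causal character at one time determines it at
  all times.\<close>

lemma chart_solution_gform_constant:
  assumes c: "c \<in> A" and J: "is_interval J" and z: "chart_solution c J z" and st: "s \<in> J" "t \<in> J"
  shows "gform c (fst (z s)) (snd (z s)) (snd (z s)) = gform c (fst (z t)) (snd (z t)) (snd (z t))"
proof -
  let ?G = "\<lambda>t. gform c (fst (z t)) (snd (z t)) (snd (z t))"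
  have "(?G has_derivative (\<lambda>h. 0)) (at t within J)" if t: "t \<in> J" for t
  proof -
    let ?x = "fst (z t)" and ?u = "snd (z t)" and ?a = "geod_acc c (fst (z t)) (snd (z t))"
    note x = chart_solutionD(1)[OF z t]
    have "(?G has_derivative (\<lambda>h. dgform c ?x (h *\<^sub>R ?u) ?u ?u + gform c ?x (h *\<^sub>R ?a) ?u +
        gform c ?x ?u (h *\<^sub>R ?a))) (at t within J)"
      using gform_has_derivative[where Y = "\<lambda>t. fst (z t)" and P = "\<lambda>t. snd (z t)"
          and Q = "\<lambda>t. snd (z t)", OF c x] chart_solutionD(3,4)[OF z t]
      unfolding has_vector_derivative_def by blast
    moreover have "dgform c ?x (h *\<^sub>R ?u) ?u ?u = h * dgform c ?x ?u ?u ?u" for h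
      unfolding dgform_def
      using linear_cmul[OF has_derivative_linear[OF metric_comp_has_derivative[OF c x]]]
      by (simp add: sum_distrib_left mult_ac)
    moreover have "gform c ?x (h *\<^sub>R ?a) ?u = h * gform c ?x ?a ?u" for h
      by (simp add: gform_def sum_distrib_left mult_ac)
    moreover have "EL c ?x ?u ?a ?u = 0" using EL_zero_iff[OF c x] by blast
    then have "dgform c ?x ?u ?u ?u = - 2 * gform c ?x ?a ?u" by (simp add: EL_def)
    ultimately show ?thesis using gform_sym[OF c x] by (simp add: algebra_simps)
  qed
  moreover have "convex J" using J by (simp add: is_interval_convex)
  ultimately obtain k where "\<And>t. t \<in> J \<Longrightarrow> ?G t = k"
    using has_derivative_zero_constant[of J ?G] by blast
  with st show ?thesis by metis
qed

text \<open>The sign of \<open>g(u,u)\<close> need be known at one time only, being conserved. The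
  velocity is assumed nonzero throughout because \<open>causal_vector\<close> excludes 0.\<close>

lemma chart_solution_causal_geodesic:
  assumes c: "c \<in> A" and J: "is_interval J" "interior J \<noteq> {}" and z: "chart_solution c J z"
    and nz: "\<And>t. t \<in> J \<Longrightarrow> snd (z t) \<noteq> 0"
    and s: "s \<in> J" "gform c (fst (z s)) (snd (z s)) (snd (z s)) \<le> 0"
  shows "causal_geodesic A g J (\<lambda>t. cinv c (fst (z t)))"
  unfolding causal_geodesic_def causal_vector_def
proof (intro conjI ballI)
  show "geodesic A g J (\<lambda>t. cinv c (fst (z t)))"
    by (rule chart_solution_geodesic(1)[OF c J z])
  fix t assume t: "t \<in> J"
  note x = chart_solutionD(1)[OF z t]
  note vel = chart_solution_geodesic(2)[OF c J z t]
  show "velocity A J (\<lambda>t. cinv c (fst (z t))) t \<noteq> (\<lambda>c. 0)"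
    unfolding vel using tvec_of_coords_self[OF coords_charts_at[OF c x], of "snd (z t)"] nz[OF t]
    by auto
  show "g (cinv c (fst (z t))) (velocity A J (\<lambda>t. cinv c (fst (z t))) t)
      (velocity A J (\<lambda>t. cinv c (fst (z t))) t) \<le> 0"
    unfolding vel using gform_eq[OF c x] chart_solution_gform_constant[OF c J(1) z s(1) t] s(2) by simp
qed

section \<open>Uniqueness of causal geodesics\<close>

lemma chart_solution_eqI:
  assumes z: "chart_solution c {a..b} z" and w: "chart_solution c {a..b} w" and ab: "a < b"
    and eq: "\<And>t. t \<in> {a..b} \<Longrightarrow> fst (z t) = fst (w t)" and t: "t \<in> {a..b}"
  shows "z t = w t"
proof -
  have "((\<lambda>t. fst (z t)) has_vector_derivative snd (w t)) (at t within {a..b})"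
    using has_vector_derivative_transform[OF t _ chart_solutionD(3)[OF w t], of "\<lambda>t. fst (z t)"] eq
    by blast
  moreover have "at t within {a..b} \<noteq> bot"
    using at_within_interval_neq_bot Icc_interval_interior[OF ab] t by blast
  ultimately have "snd (z t) = snd (w t)"
    using vector_derivative_within chart_solutionD(3)[OF z t] by metis
  with eq[OF t] show ?thesis by (simp add: prod_eq_iff)
qed

text \<open>The acceleration is quadratic in the velocity, so a vanishing initial velocity propagates.\<close>

lemma chart_solution_zero_velocity:
  assumes c: "c \<in> A" and z: "chart_solution c {0..b} z" and b: "b > 0" and z0: "snd (z 0) = 0"
  obtains d where "d > 0" "d \<le> b" "\<And>t. t \<in> {0..d} \<Longrightarrow> z t = z 0"
proof -
  have zc: "continuous_on {0..b} z" by (rule chart_solution_continuous[OF z])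
  define K where "K = (\<lambda>t. fst (z t)) ` {0..b}"
  have K: "compact K" unfolding K_def
    by (intro compact_continuous_image continuous_intros zc compact_Icc)
  have KS: "K \<times> cball 0 1 \<subseteq> cmap c ` cdom c \<times> UNIV"
    unfolding K_def using chart_solutionD(1)[OF z] by auto
  obtain C where C: "C > 0" "\<And>x u. x \<in> K \<Longrightarrow> norm u \<le> 1 \<Longrightarrow> norm (geod_acc c x u) \<le> C"
  proof -
    have "bounded ((\<lambda>z. geod_acc c (fst z) (snd z)) ` (K \<times> cball 0 1))"
      by (intro compact_imp_bounded compact_continuous_image compact_Times K compact_cball
          continuous_on_subset[OF continuous_on_geod_acc[OF c] KS])
    then obtain C where "C > 0" "\<And>z. z \<in> K \<times> cball 0 1 \<Longrightarrow> norm (geod_acc c (fst z) (snd z)) \<le> C"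
      unfolding bounded_pos by blast
    then show thesis using that[of C] by force
  qed
  \<comment> \<open>Homogeneity of degree two turns the bound for unit vectors into a quadratic
    bound.\<close>
  have quad: "norm (geod_acc c x u) \<le> C * (norm u)\<^sup>2" if "x \<in> K" for x u
  proof (cases "u = 0")
    case True
    then show ?thesis using geod_acc_scaleR[of c x 0 0] by simp
  next
    case False
    have "geod_acc c x u = geod_acc c x (norm u *\<^sub>R sgn u)"
      using False by (simp add: sgn_div_norm)
    then have "norm (geod_acc c x u) = (norm u)\<^sup>2 * norm (geod_acc c x (sgn u))"
      by (simp add: geod_acc_scaleR)
    also have "\<dots> \<le> (norm u)\<^sup>2 * C"
      by (intro mult_left_mono C(2) that) (simp_all add: norm_sgn)
    finally show ?thesis by (simp add: mult.commute)
  qed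
  have uc: "continuous_on {0..b} (\<lambda>t. snd (z t))" by (intro continuous_intros zc)
  then have "((\<lambda>t. snd (z t)) \<longlongrightarrow> snd (z 0)) (at 0 within {0..b})"
    using b unfolding continuous_on_def by auto
  then have "\<forall>\<^sub>F t in at 0 within {0..b}. norm (snd (z t)) < 1"
    unfolding tendsto_iff dist_norm z0 by simp
  moreover have "norm (snd (z 0)) < 1" using z0 by simp
  ultimately obtain d0 where d0: "d0 > 0" "d0 \<le> b - 0" "\<And>t. t \<in> {0..0 + d0} \<Longrightarrow> norm (snd (z t)) < 1"
    using b by (rule eventually_within_Icc_imp) blast
  \<comment> \<open>On \<open>{0..d}\<close> the maximal speed \<open>m\<close> is at most 1, so
    \<open>m * m \<le> m\<close>. Integrating the quadratic bound from velocity 0 gives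
    \<open>m \<le> d * C * m \<le> m / 2\<close>, which forces \<open>m = 0\<close>.\<close>
  define d where "d = min d0 (1 / (2 * C))"
  have "d * C \<le> 1 / (2 * C) * C"
    using C(1) by (intro mult_right_mono) (auto simp: d_def)
  then have d: "d > 0" "d \<le> d0" "d \<le> b" "d * C \<le> 1 / 2"
    using d0 C(1) by (auto simp: d_def)
  have zd: "chart_solution c {0..d} z" using chart_solution_subset[OF z] d by simp
  have "compact ((\<lambda>t. norm (snd (z t))) ` {0..d})"
    using d by (intro compact_continuous_image continuous_intros continuous_on_subset[OF zc]) auto
  then obtain s where s: "s \<in> {0..d}" "\<And>t. t \<in> {0..d} \<Longrightarrow> norm (snd (z t)) \<le> norm (snd (z s))"
    using compact_attains_sup[of "(\<lambda>t. norm (snd (z t))) ` {0..d}"] d by auto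
  define m where "m = norm (snd (z s))"
  have m1: "m \<le> 1" using d0(3)[of s] s(1) d by (simp add: m_def)
  have acc: "norm (geod_acc c (fst (z t)) (snd (z t))) \<le> C * m" if t: "t \<in> {0..d}" for t
  proof -
    have "norm (snd (z t)) \<le> m" using s(2)[OF t] by (simp add: m_def)
    then have "(norm (snd (z t)))\<^sup>2 \<le> m * m"
      unfolding power2_eq_square by (intro mult_mono) (auto simp: m_def)
    also have "\<dots> \<le> 1 * m" by (intro mult_right_mono m1) (simp add: m_def)
    finally have "C * (norm (snd (z t)))\<^sup>2 \<le> C * m" using C(1) by simp
    moreover have "fst (z t) \<in> K" using t d by (auto simp: K_def)
    ultimately show ?thesis using quad order_trans by blast
  qed
  have "norm (snd (z s) - snd (z 0)) \<le> C * m * \<bar>s - 0\<bar>"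
    by (rule vector_derivative_bound_imp_lipschitz[OF chart_solutionD(4)[OF zd] acc s(1)])
      (use d(1) in auto)
  also have "\<dots> = s * C * m" using s(1) by simp
  also have "s * C \<le> d * C" using s(1) C(1) by (intro mult_right_mono) auto
  then have "s * C * m \<le> 1 / 2 * m"
    using d(4) by (intro mult_right_mono) (auto simp: m_def)
  finally have "m = 0" using z0 by (simp add: m_def)
  then have u: "snd (z t) = 0" if "t \<in> {0..d}" for t using s(2)[OF that] by (simp add: m_def)
  have x: "fst (z t) = fst (z 0)" if t: "t \<in> {0..d}" for t
  proof -
    have "norm (fst (z t) - fst (z 0)) \<le> 0 * \<bar>t - 0\<bar>"
      using vector_derivative_bound_imp_lipschitz[OF chart_solutionD(3)[OF zd], of 0 t 0] u t d(1)
      by auto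
    then show ?thesis by simp
  qed
  show thesis
    by (rule that[OF d(1,3)], rule prod_eqI) (simp_all only: x u z0)
qed

text \<open>Branching requires disjoint images, so it is not enough that the curves differ at equal
  times: a point reached by both at different times must be excluded too. The second alternative of
  non-intertwining, being about images, is used for exactly this.\<close>

lemma causal_chart_solution_locally_unique:
  assumes nb: "causally_non_branching A g" and ni: "non_intertwining A g"
    and c: "c \<in> A" and b: "b > 0"
    and z: "chart_solution c {0..b} z" and w: "chart_solution c {0..b} w" and zw: "z 0 = w 0"
    and nz: "snd (z 0) \<noteq> 0" and causal: "gform c (fst (z 0)) (snd (z 0)) (snd (z 0)) \<le> 0"
  obtains d where "d > 0" "d \<le> b" "\<And>t. t \<in> {0..d} \<Longrightarrow> z t = w t"
proof -
  define \<gamma> where "\<gamma> t = cinv c (fst (z t))" for t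
  define \<sigma> where "\<sigma> t = cinv c (fst (w t))" for t
  define p where "p = \<gamma> 0"
  have p: "\<sigma> 0 = p" using zw by (simp add: p_def \<gamma>_def \<sigma>_def)
  note Ib = Icc_interval_interior[OF b]
  have zc: "continuous_on {0..b} z" and wc: "continuous_on {0..b} w"
    using chart_solution_continuous z w by auto
  have \<gamma>c: "continuous_on {0..b} \<gamma>" and \<sigma>c: "continuous_on {0..b} \<sigma>"
    using geodesic_interval(3) chart_solution_geodesic(1)[OF c _ _ z] chart_solution_geodesic(1)[OF c _ _ w] Ib
    unfolding \<gamma>_def \<sigma>_def by blast+
  obtain U where pU: "p \<in> interior U" and U: "\<And>\<epsilon> \<gamma>\<^sub>1 \<gamma>\<^sub>2. \<epsilon> > 0 \<Longrightarrow>
        causal_geodesic A g {0..\<epsilon>} \<gamma>\<^sub>1 \<Longrightarrow> causal_geodesic A g {0..\<epsilon>} \<gamma>\<^sub>2 \<Longrightarrow>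
        \<gamma>\<^sub>1 ` {0..\<epsilon>} \<subseteq> U \<Longrightarrow> \<gamma>\<^sub>2 ` {0..\<epsilon>} \<subseteq> U \<Longrightarrow> \<gamma>\<^sub>1 0 = p \<Longrightarrow> \<gamma>\<^sub>2 0 = p \<Longrightarrow>
        velocity A {0..\<epsilon>} \<gamma>\<^sub>1 0 = velocity A {0..\<epsilon>} \<gamma>\<^sub>2 0 \<Longrightarrow>
        (\<forall>t\<in>{0..\<epsilon>}. \<gamma>\<^sub>1 t = \<gamma>\<^sub>2 t) \<or> \<not> (\<exists>q. q islimpt (\<gamma>\<^sub>1 ` {0<..\<epsilon>} \<inter> \<gamma>\<^sub>2 ` {0<..\<epsilon>}))"
    using ni unfolding non_intertwining_def by metis
  have lim: "(f \<longlongrightarrow> f 0) (at 0 within {0..b})" if "continuous_on {0..b} f"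
    for f :: "real \<Rightarrow> 'x::topological_space"
    using that b unfolding continuous_on_def by simp
  \<comment> \<open>For a short time the velocities stay nonzero, which makes both curves causal
    geodesics, and the images stay in \<open>U\<close>.\<close>
  have "\<forall>\<^sub>F t in at 0 within {0..b}. snd (z t) \<noteq> 0"
    using tendsto_imp_eventually_ne[OF lim[OF continuous_on_snd[OF zc]] nz] .
  moreover have "\<forall>\<^sub>F t in at 0 within {0..b}. snd (w t) \<noteq> 0"
    using tendsto_imp_eventually_ne[OF lim[OF continuous_on_snd[OF wc]] nz[unfolded zw]] .
  moreover have "\<forall>\<^sub>F t in at 0 within {0..b}. \<gamma> t \<in> interior U"
    using topological_tendstoD[OF lim[OF \<gamma>c] open_interior] pU by (simp add: p_def)
  moreover have "\<forall>\<^sub>F t in at 0 within {0..b}. \<sigma> t \<in> interior U"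
    using topological_tendstoD[OF lim[OF \<sigma>c] open_interior] pU by (simp add: p)
  ultimately have "\<forall>\<^sub>F t in at 0 within {0..b}. snd (z t) \<noteq> 0 \<and> snd (w t) \<noteq> 0 \<and>
      \<gamma> t \<in> interior U \<and> \<sigma> t \<in> interior U"
    by eventually_elim blast
  moreover have "snd (z 0) \<noteq> 0 \<and> snd (w 0) \<noteq> 0 \<and> \<gamma> 0 \<in> interior U \<and> \<sigma> 0 \<in> interior U"
    using nz zw pU p by (simp add: p_def)
  ultimately obtain e where e: "e > 0" "e \<le> b - 0" and eU: "\<And>t. t \<in> {0..0 + e} \<Longrightarrow>
      snd (z t) \<noteq> 0 \<and> snd (w t) \<noteq> 0 \<and> \<gamma> t \<in> interior U \<and> \<sigma> t \<in> interior U"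
    using b by (rule eventually_within_Icc_imp) blast
  have sub: "{0..e} \<subseteq> {0..b}" using e by simp
  have ze: "chart_solution c {0..e} z" and we: "chart_solution c {0..e} w"
    using chart_solution_subset[OF z sub] chart_solution_subset[OF w sub] by auto
  have x: "fst (z t) = cmap c (\<gamma> t)" "fst (w t) = cmap c (\<sigma> t)" if "t \<in> {0..e}" for t
    using cmap_cinv[OF c] chart_solutionD(1)[OF ze that] chart_solutionD(1)[OF we that]
    by (simp_all add: \<gamma>_def \<sigma>_def)
  note Ie = Icc_interval_interior[OF e(1)]
  have 0: "0 \<in> {0..e}" using e by simp
  have geo: "causal_geodesic A g {0..e} \<gamma>" "causal_geodesic A g {0..e} \<sigma>"
    unfolding \<gamma>_def[abs_def] \<sigma>_def[abs_def]
    using chart_solution_causal_geodesic[OF c _ _ ze _ 0 causal]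
      chart_solution_causal_geodesic[OF c _ _ we _ 0 causal[unfolded zw]] eU Ie by auto
  have vel: "velocity A {0..e} \<gamma> 0 = velocity A {0..e} \<sigma> 0"
    unfolding \<gamma>_def[abs_def] \<sigma>_def[abs_def]
    using chart_solution_geodesic(2)[OF c _ _ ze 0] chart_solution_geodesic(2)[OF c _ _ we 0] Ie zw
    by simp
  have im: "\<gamma> ` {0..e} \<subseteq> U" "\<sigma> ` {0..e} \<subseteq> U" using eU interior_subset[of U] by fastforce+
  consider "\<And>t. t \<in> {0..e} \<Longrightarrow> \<gamma> t = \<sigma> t"
    | "\<not> (\<exists>q. q islimpt (\<gamma> ` {0<..e} \<inter> \<sigma> ` {0<..e}))"
    using U[OF e(1) geo im p_def[symmetric] p vel] by blast
  then show thesis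
  proof cases
    case 1
    then have "fst (z t) = fst (w t)" if "t \<in> {0..e}" for t using x that by simp
    then have "z t = w t" if "t \<in> {0..e}" for t using chart_solution_eqI[OF ze we e(1)] that by blast
    then show thesis using that[of e] e by simp
  next
    case 2
    define S where "S = \<gamma> ` {0<..e} \<inter> \<sigma> ` {0<..e}"
    \<comment> \<open>An infinite subset of a compact set would have an accumulation point.\<close>
    have "compact (\<gamma> ` {0..e})"
      by (intro compact_continuous_image continuous_on_subset[OF \<gamma>c] sub compact_Icc)
    moreover have "S \<subseteq> \<gamma> ` {0..e}" by (auto simp: S_def)
    ultimately have S: "finite S"
      using 2 unfolding S_def by (meson Heine_Borel_imp_Bolzano_Weierstrass)
    \<comment> \<open>The point \<open>p\<close> itself may belong to \<open>S\<close> if both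
      curves come back to it later. A return of \<gamma> within time \<open>d1\<close> is excluded
      by the nonzero velocity; the other points of \<open>S\<close> are avoided by continuity, see
      \<open>d2\<close>.\<close>
    obtain d1 where d1: "d1 > 0" "\<And>t. t \<in> {0<..<0 + d1} \<Longrightarrow> t \<le> e \<Longrightarrow> fst (z t) \<noteq> fst (z 0)"
      using has_vector_derivative_avoids_value[OF chart_solutionD(3)[OF ze 0] nz e(1)] by blast
    have "open (- (S - {p}))" using S by (intro open_Compl finite_imp_closed) simp
    moreover have p': "\<gamma> 0 \<in> - (S - {p})" by (simp add: p_def)
    ultimately have "\<forall>\<^sub>F t in at 0 within {0..b}. \<gamma> t \<in> - (S - {p})"
      by (rule topological_tendstoD[OF lim[OF \<gamma>c]])
    then obtain d2 where d2: "d2 > 0" "d2 \<le> b - 0" "\<And>t. t \<in> {0..0 + d2} \<Longrightarrow> \<gamma> t \<in> - (S - {p})"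
      using p' b by (rule eventually_within_Icc_imp) blast
    \<comment> \<open>\<open>branches_at\<close> needs an interior time, while the two solutions
      start at 0. One common past for both makes 0 interior.\<close>
    obtain d3 l where l: "d3 > 0" "l 0 = (fst (z 0), snd (z 0))" "chart_solution c {-d3..0} l"
      using chart_solution_exists_backwards[OF c chart_solutionD(1)[OF ze 0]] by metis
    have "continuous_on {-d3..0} (\<lambda>t. snd (l t))"
      by (intro continuous_intros chart_solution_continuous[OF l(3)])
    then have "((\<lambda>t. snd (l t)) \<longlongrightarrow> snd (l 0)) (at 0 within {-d3..0})"
      using l(1) unfolding continuous_on_def by simp
    then have "\<forall>\<^sub>F t in at 0 within {-d3..0}. snd (l t) \<noteq> 0"
      using nz l(2) by (intro tendsto_imp_eventually_ne) auto
    then obtain d4 where d4: "d4 > 0" "\<And>t. t \<in> {-d3..0} \<Longrightarrow> t \<noteq> 0 \<Longrightarrow> dist t 0 < d4 \<Longrightarrow> snd (l t) \<noteq> 0"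
      unfolding eventually_at by blast
    define d where "d = min e (min (d1 / 2) (min d2 (min d3 (d4 / 2))))"
    have d: "d > 0" "d \<le> e" "d < d1" "d \<le> d2" "d \<le> d3" "d < d4"
      using e(1) d1(1) d2(1) l(1) d4(1) by (auto simp: d_def)
    have ld: "chart_solution c {-d..0} l" by (rule chart_solution_subset[OF l(3)]) (use d in auto)
    have zd: "chart_solution c {0..d} z" and wd: "chart_solution c {0..d} w"
      by (rule chart_solution_subset[OF ze], use d in auto, rule chart_solution_subset[OF we], use d in auto)
    have l0: "l 0 = z 0" "l 0 = w 0" using l(2) zw by simp_all
    define Z where "Z t = (if t \<le> 0 then l t else z t)" for t
    define W where "W t = (if t \<le> 0 then l t else w t)" for t
    have Z: "chart_solution c {-d..d} Z" and W: "chart_solution c {-d..d} W"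
      using chart_solution_glue[OF ld zd l0(1)] chart_solution_glue[OF ld wd l0(2)] d(1)
      by (simp_all add: Z_def[abs_def] W_def[abs_def])
    have Znz: "snd (Z t) \<noteq> 0" if "t \<in> {-d..d}" for t
    proof (cases "t < 0")
      case True
      then show ?thesis using d4(2)[of t] that d by (auto simp: Z_def dist_real_def)
    next
      case False
      then show ?thesis using eU[of t] that d l0 by (cases "t = 0") (auto simp: Z_def nz)
    qed
    have Z0: "gform c (fst (Z 0)) (snd (Z 0)) (snd (Z 0)) \<le> 0" using causal l0 by (simp add: Z_def)
    have dd: "- d < d" using d by simp
    note Id = Icc_interval_interior[OF dd]
    define \<Gamma> where "\<Gamma> t = cinv c (fst (Z t))" for t
    define \<Sigma> where "\<Sigma> t = cinv c (fst (W t))" for t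
    have \<Gamma>: "causal_geodesic A g {-d..d} \<Gamma>"
      unfolding \<Gamma>_def[abs_def]
      using chart_solution_causal_geodesic[OF c _ _ Z Znz _ Z0] Id d(1) by simp
    \<comment> \<open>\<open>Z\<close> takes the part of the causal geodesic on a closed interval.
      Its competitor \<open>W\<close> need only be a geodesic, and is considered on the open
      interval as in \<open>branches_at\<close>.\<close>
    have W': "chart_solution c {-d<..<d} W"
      by (rule chart_solution_subset[OF W greaterThanLessThan_subseteq_atLeastAtMost_iff[THEN iffD2]]) simp
    have \<Sigma>: "geodesic A g {-d<..<d} \<Sigma>"
      unfolding \<Sigma>_def[abs_def]
      by (rule chart_solution_geodesic(1)[OF c _ _ W']) (use dd in \<open>simp_all add: is_interval_oo\<close>)
    have "\<Gamma> ` {0<..<d} \<inter> \<Sigma> ` {0<..<d} = {}"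
    proof (rule ccontr)
      assume "\<not> ?thesis"
      then obtain s t where st: "s \<in> {0<..<d}" "t \<in> {0<..<d}" "\<Gamma> s = \<Sigma> t" by blast
      then have "\<gamma> s = \<sigma> t" by (simp add: \<Gamma>_def \<Sigma>_def Z_def W_def \<gamma>_def \<sigma>_def)
      moreover have "s \<in> {0<..e}" "t \<in> {0<..e}" using st d by auto
      ultimately have "\<gamma> s \<in> S" unfolding S_def by (metis IntI imageI)
      moreover have "\<gamma> s \<noteq> p"
        using d1(2)[of s] x(1)[of s] x(1)[OF 0] st d by (auto simp: p_def)
      moreover have "\<gamma> s \<in> - (S - {p})" using d2(3)[of s] st d by auto
      ultimately show False by blast
    qed
    moreover have "\<Gamma> t = \<Sigma> t" if "t \<le> 0" for t using that by (simp add: \<Gamma>_def \<Sigma>_def Z_def W_def)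
    ultimately have "branches_at A g (-d) d \<Gamma> 0"
      unfolding branches_at_def using d(1) \<Sigma> by (intro exI[of _ d] conjI exI[of _ \<Sigma>]) auto
    moreover have "0 \<in> {-d<..<d}" using d(1) by simp
    ultimately have False
      using nb \<Gamma> dd unfolding causally_non_branching_def by blast
    then show thesis ..
  qed
qed

text \<open>Equality passes to limits by continuity and extends beyond \<open>t\<close> by the local
  result, applicable there since \<open>g(u,u)\<close> is conserved. If the velocity at
  \<open>t\<close> is 0, the hypotheses say nothing, but then both solutions are constant for a
  short time.\<close>

lemma causal_chart_solution_unique:
  assumes nb: "causally_non_branching A g" and ni: "non_intertwining A g" and c: "c \<in> A"
    and z: "chart_solution c {a..b} z" and w: "chart_solution c {a..b} w" and zw: "z a = w a"
    and causal: "gform c (fst (z a)) (snd (z a)) (snd (z a)) \<le> 0"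
    and t: "t \<in> {a..b}"
  shows "z t = w t"
proof (rule real_induction[OF _ _ t])
  fix t assume t: "t \<in> {a..b}" and IH: "\<And>s. s \<in> {a..<t} \<Longrightarrow> z s = w s"
  show "z t = w t"
  proof (cases "t = a")
    case False
    then have at: "a < t" using t by simp
    have "closed {s \<in> {a..t}. z s - w s = 0}"
      by (intro continuous_closed_preimage_constant continuous_on_diff closed_atLeastAtMost
          continuous_on_subset[OF chart_solution_continuous[OF z]]
          continuous_on_subset[OF chart_solution_continuous[OF w]]) (use t in auto)
    moreover have "{a..<t} \<subseteq> {s \<in> {a..t}. z s - w s = 0}" using IH by auto
    ultimately have "closure {a..<t} \<subseteq> {s \<in> {a..t}. z s - w s = 0}" by (rule closure_minimal[rotated])
    then show ?thesis using at by (auto simp: subset_iff)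
  qed (simp add: zw)
next
  fix t assume t: "t \<in> {a..<b}" and IH: "\<And>s. s \<in> {a..t} \<Longrightarrow> z s = w s"
  have sub: "{t + 0..t + (b - t)} \<subseteq> {a..b}" using t by auto
  let ?z = "\<lambda>s. z (t + s)" and ?w = "\<lambda>s. w (t + s)"
  have zs: "chart_solution c {0..b - t} ?z" and ws: "chart_solution c {0..b - t} ?w"
    by (rule chart_solution_shift[OF chart_solution_subset[OF z sub]],
        rule chart_solution_shift[OF chart_solution_subset[OF w sub]])
  have bt: "b - t > 0" using t by simp
  have eq: "?z 0 = ?w 0" using IH[of t] t by simp
  have cz: "gform c (fst (?z 0)) (snd (?z 0)) (snd (?z 0)) \<le> 0"
    using chart_solution_gform_constant[OF c _ z, of t a] causal t by (auto simp: is_interval_cc)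
  obtain d where d: "d > 0" "\<And>s. s \<in> {0..d} \<Longrightarrow> ?z s = ?w s"
  proof (cases "snd (?z 0) = 0")
    case True
    obtain d1 where d1: "d1 > 0" "\<And>s. s \<in> {0..d1} \<Longrightarrow> ?z s = ?z 0"
      using chart_solution_zero_velocity[OF c zs bt True] by blast
    have True': "snd (?w 0) = 0" using True eq by simp
    obtain d2 where d2: "d2 > 0" "\<And>s. s \<in> {0..d2} \<Longrightarrow> ?w s = ?w 0"
      using chart_solution_zero_velocity[OF c ws bt True'] by blast
    show thesis
    proof (rule that[of "min d1 d2"])
      show "?z s = ?w s" if "s \<in> {0..min d1 d2}" for s
        using d1(2)[of s] d2(2)[of s] eq that by simp
    qed (use d1(1) d2(1) in simp)
  next
    case False
    show thesis
      using causal_chart_solution_locally_unique[OF nb ni c bt zs ws eq False cz] that by blast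
  qed
  show "\<exists>e>0. \<forall>s. t < s \<and> s < t + e \<and> s \<le> b \<longrightarrow> z s = w s"
  proof (intro exI[of _ d] conjI d(1) allI impI)
    fix s assume "t < s \<and> s < t + d \<and> s \<le> b"
    then show "z s = w s" using d(2)[of "s - t"] by simp
  qed
qed

section \<open>Convergence of geodesics\<close>

definition pos_vel :: "('m, 'n) chart \<Rightarrow> (real \<Rightarrow> 'm) \<Rightarrow> real \<Rightarrow> (real^'n) \<times> (real^'n)" where
  "pos_vel c \<gamma> t = (cmap c (\<gamma> t), cvel c {0..1} \<gamma> t)"

text \<open>The property propagated along \<open>{0..1}\<close>. Causality is required of the limit
  only. Membership of \<open>\<Gamma> n t\<close> in the domain is demanded separately, as
  \<open>cmap c\<close> is arbitrary outside it and convergence of its values alone would say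
  nothing about the points.\<close>

definition causal_convergence :: "(nat \<Rightarrow> real \<Rightarrow> 'm) \<Rightarrow> (real \<Rightarrow> 'm) \<Rightarrow> ('m, 'n) chart \<Rightarrow> real \<Rightarrow> bool" where
  "causal_convergence \<Gamma> \<gamma> c t \<longleftrightarrow> c \<in> charts_at A (\<gamma> t) \<and>
    gform c (fst (pos_vel c \<gamma> t)) (snd (pos_vel c \<gamma> t)) (snd (pos_vel c \<gamma> t)) \<le> 0 \<and>
    (\<forall>\<^sub>F n in sequentially. \<Gamma> n t \<in> cdom c) \<and> (\<lambda>n. pos_vel c (\<Gamma> n) t) \<longlonglongrightarrow> pos_vel c \<gamma> t"

lemma causal_convergence_position:
  assumes "causal_convergence \<Gamma> \<gamma> c t"
  shows "(\<lambda>n. \<Gamma> n t) \<longlonglongrightarrow> \<gamma> t"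
proof -
  have c: "c \<in> A" "\<gamma> t \<in> cdom c" "c \<in> charts_at A (\<gamma> t)"
    using assms by (auto simp: causal_convergence_def charts_at_def)
  have ev: "\<forall>\<^sub>F n in sequentially. \<Gamma> n t \<in> cdom c"
    and lim: "(\<lambda>n. pos_vel c (\<Gamma> n) t) \<longlonglongrightarrow> pos_vel c \<gamma> t"
    using assms by (auto simp: causal_convergence_def)
  have "(\<lambda>n. cinv c (cmap c (\<Gamma> n t))) \<longlonglongrightarrow> cinv c (cmap c (\<gamma> t))"
    by (rule continuous_on_tendsto_compose[OF continuous_on_cinv[OF c(1)]])
      (use tendsto_fst[OF lim] c ev in \<open>auto simp: pos_vel_def elim!: eventually_mono\<close>)
  moreover have "\<forall>\<^sub>F n in sequentially. cinv c (cmap c (\<Gamma> n t)) = \<Gamma> n t"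
    using ev by eventually_elim (simp add: cinv_cmap charts_at_def c)
  ultimately show ?thesis using cinv_cmap[OF c(3)] by (auto intro: Lim_transform_eventually)
qed

text \<open>Allows the chart to be changed between two steps of the propagation. That
  \<open>\<Gamma> n t\<close> eventually lies in the new domain follows from convergence of the
  points in the manifold.\<close>

lemma causal_convergence_chart:
  assumes \<Gamma>: "\<And>n. geodesic A g {0..1} (\<Gamma> n)" and \<gamma>: "geodesic A g {0..1} \<gamma>" and t: "t \<in> {0..1}"
    and conv: "causal_convergence \<Gamma> \<gamma> c t" and d: "d \<in> charts_at A (\<gamma> t)"
  shows "causal_convergence \<Gamma> \<gamma> d t"
proof -
  have c: "c \<in> charts_at A (\<gamma> t)" and ev: "\<forall>\<^sub>F n in sequentially. \<Gamma> n t \<in> cdom c"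
    and lim: "(\<lambda>n. pos_vel c (\<Gamma> n) t) \<longlonglongrightarrow> pos_vel c \<gamma> t"
    and caus: "gform c (fst (pos_vel c \<gamma> t)) (snd (pos_vel c \<gamma> t)) (snd (pos_vel c \<gamma> t)) \<le> 0"
    using conv by (auto simp: causal_convergence_def)
  have cd: "c \<in> A" "d \<in> A" "cmap c (\<gamma> t) \<in> overlap c d"
    using c d by (auto simp: charts_at_def)
  have trans: "pos_vel d \<beta> t = (transition c d (fst (pos_vel c \<beta> t)),
      transition_deriv c d (fst (pos_vel c \<beta> t)) (snd (pos_vel c \<beta> t)))"
    if "geodesic A g {0..1} \<beta>" "\<beta> t \<in> cdom c" "\<beta> t \<in> cdom d" for \<beta>
    using geodesic_cvel_transition[OF that(1) t, of c d] cinv_cmap[of c "\<beta> t"] cd that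
    by (simp add: pos_vel_def charts_at_def)
  have ev': "\<forall>\<^sub>F n in sequentially. \<Gamma> n t \<in> cdom d"
    using topological_tendstoD[OF causal_convergence_position[OF conv] open_cdom[OF cd(2)]] d
    by (simp add: charts_at_def)
  note tr\<gamma> = trans[OF \<gamma>]
  have \<gamma>cd: "\<gamma> t \<in> cdom c" "\<gamma> t \<in> cdom d" using c d by (auto simp: charts_at_def)
  have x: "fst (pos_vel c \<gamma> t) \<in> overlap c d" using cd(3) by (simp add: pos_vel_def)
  have "(\<lambda>n. (transition c d (fst (pos_vel c (\<Gamma> n) t)),
      transition_deriv c d (fst (pos_vel c (\<Gamma> n) t)) (snd (pos_vel c (\<Gamma> n) t)))) \<longlonglongrightarrow> pos_vel d \<gamma> t"
    unfolding tr\<gamma>[OF \<gamma>cd]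
    by (intro tendsto_Pair transition_deriv_tendsto[OF cd(1,2) x] tendsto_fst tendsto_snd lim
        isCont_tendsto_compose[OF has_derivative_continuous[OF transition_has_derivative[OF cd(1,2) x]]])
  moreover have "\<forall>\<^sub>F n in sequentially. (transition c d (fst (pos_vel c (\<Gamma> n) t)),
      transition_deriv c d (fst (pos_vel c (\<Gamma> n) t)) (snd (pos_vel c (\<Gamma> n) t))) = pos_vel d (\<Gamma> n) t"
    using ev ev' by eventually_elim (rule trans[OF \<Gamma>, symmetric])
  ultimately have "(\<lambda>n. pos_vel d (\<Gamma> n) t) \<longlonglongrightarrow> pos_vel d \<gamma> t" by (rule Lim_transform_eventually)
  moreover have "gform d (fst (pos_vel d \<gamma> t)) (snd (pos_vel d \<gamma> t)) (snd (pos_vel d \<gamma> t)) \<le> 0"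
    using caus unfolding tr\<gamma>[OF \<gamma>cd] gform_transition[OF cd(1,2) x] by simp
  ultimately show ?thesis using d ev' by (simp add: causal_convergence_def)
qed

lemma charts_at_nonempty: obtains c where "c \<in> charts_at A p"
proof -
  have "p \<in> (\<Union>c\<in>A. cdom c)" using charts_cover by simp
  then show thesis using that by (auto simp: charts_at_def)
qed

section \<open>Propagation of convergence along the unit interval\<close>

lemma pos_vel_has_vector_derivative:
  assumes "geodesic A g {0..1} \<gamma>" "c \<in> A" "t \<in> {0..1}" "\<gamma> t \<in> cdom c"
  shows "(pos_vel c \<gamma> has_vector_derivative geod_field c (pos_vel c \<gamma> t)) (at t within {0..1})"
  unfolding pos_vel_def[abs_def] geod_field_def fst_conv snd_conv
  by (intro has_vector_derivative_Pair geodesic_has_vector_derivative assms)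

lemma pos_vel_chart_solution:
  assumes "geodesic A g {0..1} \<gamma>" "c \<in> A" "J \<subseteq> {0..1}" "\<gamma> ` J \<subseteq> cdom c"
  shows "chart_solution c J (pos_vel c \<gamma>)"
  unfolding pos_vel_def[abs_def] by (rule geodesic_chart_solution[OF assms])

lemma pos_vel_near:
  assumes \<gamma>: "geodesic A g {0..1} \<gamma>" and c: "c \<in> A" and t: "t \<in> {0..1}" "\<gamma> t \<in> cdom c"
    and N: "open N" "pos_vel c \<gamma> t \<in> N"
  obtains d where "d > 0" "\<And>s. s \<in> {0..1} \<Longrightarrow> dist s t < d \<Longrightarrow> \<gamma> s \<in> cdom c \<and> pos_vel c \<gamma> s \<in> N"
proof -
  have "(\<gamma> \<longlongrightarrow> \<gamma> t) (at t within {0..1})"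
    using geodesic_interval(3)[OF \<gamma>] t by (simp add: continuous_on_def)
  then have 1: "\<forall>\<^sub>F s in at t within {0..1}. \<gamma> s \<in> cdom c"
    using topological_tendstoD open_cdom[OF c] t(2) by blast
  have "(pos_vel c \<gamma> \<longlongrightarrow> pos_vel c \<gamma> t) (at t within {0..1})"
    using has_vector_derivative_continuous[OF pos_vel_has_vector_derivative[OF \<gamma> c t]]
    by (simp add: continuous_within)
  then have 2: "\<forall>\<^sub>F s in at t within {0..1}. pos_vel c \<gamma> s \<in> N"
    using topological_tendstoD N by blast
  obtain d where d: "d > 0" "\<And>s. s \<in> {0..1} \<Longrightarrow> s \<noteq> t \<Longrightarrow> dist s t < d \<Longrightarrow> \<gamma> s \<in> cdom c \<and> pos_vel c \<gamma> s \<in> N"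
    using eventually_conj[OF 1 2] unfolding eventually_at by blast
  show thesis by (rule that[OF d(1)]) (use d(2) t(2) N(2) in metis)
qed

text \<open>While the geodesic stays in the box, position and velocity move with speed at most
  \<open>M\<close>, too slowly to reach its boundary before \<open>r'\<close>. Real induction is
  needed because the coordinates are meaningful only as long as the curve is known to be in the
  chart.\<close>

lemma geodesic_trapped:
  assumes \<gamma>: "geodesic A g {0..1} \<gamma>" and c: "c \<in> A"
    and \<rho>: "cball x \<rho> \<subseteq> cmap c ` cdom c"
    and M0: "0 \<le> M" and M: "\<And>z. z \<in> cball x \<rho> \<times> cball 0 B \<Longrightarrow> norm (geod_field c z) \<le> M"
    and r: "0 \<le> r" "r \<le> r'" "r' \<le> 1" "\<gamma> r \<in> cdom c"
    and init: "dist x (fst (pos_vel c \<gamma> r)) + M * (r' - r) < \<rho>" "norm (snd (pos_vel c \<gamma> r)) + M * (r' - r) < B"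
    and t: "t \<in> {r..r'}"
  shows "\<gamma> t \<in> cdom c \<and> pos_vel c \<gamma> t \<in> cball x \<rho> \<times> cball 0 B"
proof (rule real_induction[OF _ _ t])
  have sub: "{r..r'} \<subseteq> {0..1}" using r by auto
  \<comment> \<open>The strict inequalities of \<open>init\<close> leave some slack, so the curve
    lies in the open box and remains there a little longer.\<close>
  have estimate: "pos_vel c \<gamma> t \<in> ball x \<rho> \<times> ball 0 B"
    if t: "t \<in> {r..r'}" and P: "\<And>s. s \<in> {r..t} \<Longrightarrow> \<gamma> s \<in> cdom c \<and> pos_vel c \<gamma> s \<in> cball x \<rho> \<times> cball 0 B"
    for t
  proof -
    have sol: "chart_solution c {r..t} (pos_vel c \<gamma>)"
      by (rule pos_vel_chart_solution[OF \<gamma> c]) (use P t r in auto)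
    have "norm (pos_vel c \<gamma> t - pos_vel c \<gamma> r) \<le> M * \<bar>t - r\<bar>"
      by (rule vector_derivative_bound_imp_lipschitz[OF chart_solutionD(2)[OF sol]])
        (use P M t in auto)
    also have "\<dots> \<le> M * (r' - r)" using t M0 by (intro mult_left_mono) auto
    finally have *: "dist (pos_vel c \<gamma> r) (pos_vel c \<gamma> t) \<le> M * (r' - r)"
      by (simp add: dist_norm norm_minus_commute)
    have "dist x (fst (pos_vel c \<gamma> t)) \<le> dist x (fst (pos_vel c \<gamma> r)) + M * (r' - r)"
      using dist_triangle[of x "fst (pos_vel c \<gamma> t)" "fst (pos_vel c \<gamma> r)"]
        dist_fst_le[of "pos_vel c \<gamma> r" "pos_vel c \<gamma> t"] * by simp
    moreover have "norm (snd (pos_vel c \<gamma> t)) \<le> norm (snd (pos_vel c \<gamma> r)) + M * (r' - r)"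
      using norm_triangle_sub[of "snd (pos_vel c \<gamma> t)" "snd (pos_vel c \<gamma> r)"]
        dist_snd_le[of "pos_vel c \<gamma> r" "pos_vel c \<gamma> t"] * by (simp add: dist_norm norm_minus_commute)
    ultimately show ?thesis using init by (simp add: mem_Times_iff)
  qed
  {
    fix t assume t: "t \<in> {r..r'}"
      and IH: "\<And>s. s \<in> {r..<t} \<Longrightarrow> \<gamma> s \<in> cdom c \<and> pos_vel c \<gamma> s \<in> cball x \<rho> \<times> cball 0 B"
    show "\<gamma> t \<in> cdom c \<and> pos_vel c \<gamma> t \<in> cball x \<rho> \<times> cball 0 B"
    proof (cases "t = r")
      case True
      have "0 \<le> M * (r' - r)" using M0 r by simp
      then show ?thesis using True init r(4) by (simp add: mem_Times_iff)
    next
      case False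
      then have rt: "r < t" using t by simp
      have bot: "at t within {r..<t} \<noteq> bot"
        using rt by (simp add: trivial_limit_within islimpt_Ico)
      have sub': "{r..<t} \<subseteq> {0..1}" "t \<in> {0..1}" using t sub by auto
      \<comment> \<open>At time \<open>t\<close> it is not yet known that the curve is in the chart.
        The inverse image of the closed ball is compact, hence closed in the Hausdorff space, so it
        contains the limit; only then is \<open>pos_vel\<close> continuous at
        \<open>t\<close>.\<close>
      have "compact (cinv c ` cball x \<rho>)"
        by (intro compact_continuous_image continuous_on_subset[OF continuous_on_cinv[OF c] \<rho>] compact_cball)
      then have closed: "closed (cinv c ` cball x \<rho>)" by (rule compact_imp_closed)
      have "\<gamma> s \<in> cinv c ` cball x \<rho>" if "s \<in> {r..<t}" for s
      proof -
        have "cinv c (cmap c (\<gamma> s)) = \<gamma> s" using IH[OF that] cinv_cmap[of c "\<gamma> s"] c by (simp add: charts_at_def)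
        moreover have "cmap c (\<gamma> s) \<in> cball x \<rho>"
          using IH[OF that] by (simp add: pos_vel_def)
        ultimately show ?thesis by (metis imageI)
      qed
      then have "\<forall>\<^sub>F s in at t within {r..<t}. \<gamma> s \<in> cinv c ` cball x \<rho>"
        by (simp add: eventually_at_filter)
      moreover have "(\<gamma> \<longlongrightarrow> \<gamma> t) (at t within {r..<t})"
        using geodesic_interval(3)[OF \<gamma>] sub' tendsto_within_subset unfolding continuous_on_def by blast
      ultimately have "\<gamma> t \<in> cinv c ` cball x \<rho>" using Lim_in_closed_set[OF closed _ bot] by blast
      then obtain y where "y \<in> cball x \<rho>" "\<gamma> t = cinv c y" by blast
      then have \<gamma>t: "\<gamma> t \<in> cdom c" using cinv_in_cdom[OF subsetD[OF \<rho>]] by simp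
      have "(pos_vel c \<gamma> \<longlongrightarrow> pos_vel c \<gamma> t) (at t within {0..1})"
        using has_vector_derivative_continuous[OF pos_vel_has_vector_derivative[OF \<gamma> c sub'(2) \<gamma>t]]
        by (simp add: continuous_within)
      then have "(pos_vel c \<gamma> \<longlongrightarrow> pos_vel c \<gamma> t) (at t within {r..<t})"
        using sub'(1) tendsto_within_subset by blast
      moreover have "\<forall>\<^sub>F s in at t within {r..<t}. pos_vel c \<gamma> s \<in> cball x \<rho> \<times> cball 0 B"
        using IH by (simp add: eventually_at_filter)
      moreover have "closed (cball x \<rho> \<times> cball (0 :: real^'n) B)" by (intro closed_Times closed_cball)
      ultimately show ?thesis using Lim_in_closed_set[OF _ _ bot] \<gamma>t by blast
    qed
  next
    fix t assume t: "t \<in> {r..<r'}"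
      and P: "\<And>s. s \<in> {r..t} \<Longrightarrow> \<gamma> s \<in> cdom c \<and> pos_vel c \<gamma> s \<in> cball x \<rho> \<times> cball 0 B"
    have t01: "t \<in> {0..1}" and \<gamma>t: "\<gamma> t \<in> cdom c" using t r P by auto
    have "pos_vel c \<gamma> t \<in> ball x \<rho> \<times> ball 0 B" by (rule estimate[OF _ P]) (use t in auto)
    then obtain d where d: "d > 0" "\<And>s. s \<in> {0..1} \<Longrightarrow> dist s t < d \<Longrightarrow>
        \<gamma> s \<in> cdom c \<and> pos_vel c \<gamma> s \<in> ball x \<rho> \<times> ball 0 B"
      using pos_vel_near[OF \<gamma> c t01 \<gamma>t, of "ball x \<rho> \<times> ball 0 B"] by (auto simp: open_Times)
    show "\<exists>e>0. \<forall>s. t < s \<and> s < t + e \<and> s \<le> r' \<longrightarrow>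
        \<gamma> s \<in> cdom c \<and> pos_vel c \<gamma> s \<in> cball x \<rho> \<times> cball 0 B"
    proof (intro exI[of _ d] conjI d(1) allI impI)
      fix s assume s: "t < s \<and> s < t + d \<and> s \<le> r'"
      then have "s \<in> {0..1}" "dist s t < d" using t r by (auto simp: dist_real_def)
      from d(2)[OF this] show "\<gamma> s \<in> cdom c" "pos_vel c \<gamma> s \<in> cball x \<rho> \<times> cball 0 B"
        by (auto simp: mem_Times_iff)
    qed
  }
qed

text \<open>Near time \<open>s\<close> all but finitely many geodesics remain in one compact box of
  the chart at \<open>\<gamma> s\<close>, which makes the compactness argument applicable. The
  window from \<open>r\<close> to \<open>r'\<close> around \<open>s\<close> is the shape required by
  \<open>Bolzano\<close>.\<close>

lemma causal_convergence_local:
  assumes nb: "causally_non_branching A g" and ni: "non_intertwining A g"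
    and \<Gamma>: "\<And>n. geodesic A g {0..1} (\<Gamma> n)" and \<gamma>: "geodesic A g {0..1} \<gamma>"
    and s: "s \<in> {0..1}" and c: "c \<in> charts_at A (\<gamma> s)"
  obtains d where "d > 0"
    "\<And>r r'. 0 \<le> r \<Longrightarrow> r \<le> s \<Longrightarrow> s \<le> r' \<Longrightarrow> r' \<le> 1 \<Longrightarrow> r' - r < d \<Longrightarrow>
      causal_convergence \<Gamma> \<gamma> c r \<Longrightarrow> causal_convergence \<Gamma> \<gamma> c r'"
proof -
  have cA: "c \<in> A" and \<gamma>s: "\<gamma> s \<in> cdom c" using c by (auto simp: charts_at_def)
  define x where "x = fst (pos_vel c \<gamma> s)"
  define u where "u = snd (pos_vel c \<gamma> s)"
  have "x \<in> cmap c ` cdom c" using \<gamma>s by (simp add: x_def pos_vel_def)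
  then obtain \<rho> where \<rho>: "\<rho> > 0" "cball x \<rho> \<subseteq> cmap c ` cdom c"
    using open_cimage[OF cA] open_contains_cball by blast
  define B where "B = norm u + 2"
  define K where "K = cball x \<rho> \<times> cball (0 :: real^'n) B"
  have K: "compact K" unfolding K_def by (intro compact_Times compact_cball)
  have F: "continuous_on K (geod_field c)"
    by (rule continuous_on_subset[OF continuous_on_geod_field[OF cA]]) (use \<rho>(2) in \<open>auto simp: K_def\<close>)
  obtain M where M: "M > 0" "\<And>z. z \<in> K \<Longrightarrow> norm (geod_field c z) \<le> M"
    using compact_imp_bounded[OF compact_continuous_image[OF F K]] unfolding bounded_pos by auto
  \<comment> \<open>Geodesics starting in \<open>N\<close> are within \<open>\<rho> / 3\<close> of
    \<open>x\<close> and have velocity within 1/2 of \<open>u\<close>. The choice of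
    \<open>d\<close> below limits the further displacement to the same amounts, so they stay
    strictly inside \<open>K\<close>.\<close>
  define N where "N = ball x (\<rho> / 3) \<times> ball u (1 / 2)"
  have N: "open N" "pos_vel c \<gamma> s \<in> N"
    using \<rho>(1) by (simp_all add: N_def open_Times x_def u_def mem_Times_iff)
  obtain d0 where d0: "d0 > 0" "\<And>t. t \<in> {0..1} \<Longrightarrow> dist t s < d0 \<Longrightarrow> \<gamma> t \<in> cdom c \<and> pos_vel c \<gamma> t \<in> N"
    using pos_vel_near[OF \<gamma> cA s \<gamma>s N] by blast
  define d where "d = min d0 (min (\<rho> / 3) (1 / 2) / M)"
  have d: "d > 0" using d0(1) \<rho>(1) M(1) by (simp add: d_def)
  show thesis
  proof (rule that[OF d])
    fix r r' assume r: "0 \<le> r" "r \<le> s" "s \<le> r'" "r' \<le> 1" "r' - r < d"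
      and conv: "causal_convergence \<Gamma> \<gamma> c r"
    have rr: "r \<le> r'" and sub: "{r..r'} \<subseteq> {0..1}" using r by auto
    have "M * (r' - r) \<le> M * (min (\<rho> / 3) (1 / 2) / M)"
      using r(5) M(1) by (intro mult_left_mono) (auto simp: d_def)
    then have Mr: "M * (r' - r) \<le> \<rho> / 3" "M * (r' - r) \<le> 1 / 2" using M(1) by auto
    have \<gamma>N: "\<gamma> t \<in> cdom c" "pos_vel c \<gamma> t \<in> N" if "t \<in> {r..r'}" for t
      using d0(2)[of t] that r by (auto simp: d_def dist_real_def)
    have sol: "chart_solution c {r..r'} (pos_vel c \<gamma>)"
      by (rule pos_vel_chart_solution[OF \<gamma> cA sub]) (use \<gamma>N in auto)
    have rin: "r \<in> {r..r'}" "r' \<in> {r..r'}" using rr by auto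
    have caus: "gform c (fst (pos_vel c \<gamma> r)) (snd (pos_vel c \<gamma> r)) (snd (pos_vel c \<gamma> r)) \<le> 0"
      and dom: "\<forall>\<^sub>F n in sequentially. \<Gamma> n r \<in> cdom c"
      and lim: "(\<lambda>n. pos_vel c (\<Gamma> n) r) \<longlonglongrightarrow> pos_vel c \<gamma> r"
      using conv by (auto simp: causal_convergence_def)
    have "\<forall>\<^sub>F n in sequentially. pos_vel c (\<Gamma> n) r \<in> N"
      using topological_tendstoD[OF lim N(1) \<gamma>N(2)[OF rin(1)]] .
    with dom have ev: "\<forall>\<^sub>F n in sequentially. \<forall>t\<in>{r..r'}. \<Gamma> n t \<in> cdom c \<and> pos_vel c (\<Gamma> n) t \<in> K"
    proof eventually_elim
      case (elim n)
      have 1: "dist x (fst (pos_vel c (\<Gamma> n) r)) + M * (r' - r) < \<rho>"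
        using elim(2) Mr(1) \<rho>(1) by (simp add: N_def mem_Times_iff)
      have "norm (snd (pos_vel c (\<Gamma> n) r)) < norm u + 1 / 2"
        using elim(2) norm_triangle_sub[of "snd (pos_vel c (\<Gamma> n) r)" u]
        by (simp add: N_def mem_Times_iff dist_norm norm_minus_commute)
      then have 2: "norm (snd (pos_vel c (\<Gamma> n) r)) + M * (r' - r) < B"
        using Mr(2) by (simp add: B_def)
      show ?case
        using geodesic_trapped[OF \<Gamma> cA \<rho>(2) less_imp_le[OF M(1)] M(2)[unfolded K_def] r(1) rr r(4) elim(1) 1 2]
        unfolding K_def by blast
    qed
    have "(\<lambda>n. pos_vel c (\<Gamma> n) r') \<longlonglongrightarrow> pos_vel c \<gamma> r'"
    proof (rule solutions_tendsto[where z = "\<lambda>n. pos_vel c (\<Gamma> n)", OF rr K F _ lim])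
      show "\<forall>\<^sub>F n in sequentially. \<forall>t\<in>{r..r'}. pos_vel c (\<Gamma> n) t \<in> K \<and>
          (pos_vel c (\<Gamma> n) has_vector_derivative geod_field c (pos_vel c (\<Gamma> n) t)) (at t within {r..r'})"
        using ev
      proof eventually_elim
        case (elim n)
        have "chart_solution c {r..r'} (pos_vel c (\<Gamma> n))"
          by (rule pos_vel_chart_solution[OF \<Gamma> cA sub]) (use elim in auto)
        then show ?case using elim chart_solutionD(2) by blast
      qed
      \<comment> \<open>Uniqueness is invoked here for the limit \<open>y\<close>, whose initial
        data are the causal ones of \<gamma>.\<close>
      fix y assume y: "y r = pos_vel c \<gamma> r" "\<And>t. t \<in> {r..r'} \<Longrightarrow> y t \<in> K"
        "\<And>t. t \<in> {r..r'} \<Longrightarrow> (y has_vector_derivative geod_field c (y t)) (at t within {r..r'})"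
      have "fst (y t) \<in> cmap c ` cdom c" if "t \<in> {r..r'}" for t
        using y(2)[OF that] \<rho>(2) by (auto simp: K_def mem_Times_iff)
      then have "chart_solution c {r..r'} y" using y(3) by (simp add: chart_solution_def)
      from causal_chart_solution_unique[OF nb ni cA sol this y(1)[symmetric] caus rin(2)]
      show "y r' = pos_vel c \<gamma> r'" by simp
    qed
    moreover have "gform c (fst (pos_vel c \<gamma> r')) (snd (pos_vel c \<gamma> r')) (snd (pos_vel c \<gamma> r')) \<le> 0"
      using chart_solution_gform_constant[OF cA is_interval_cc sol rin] caus by simp
    moreover have "\<forall>\<^sub>F n in sequentially. \<Gamma> n r' \<in> cdom c"
      using ev by eventually_elim (use rin in blast)
    ultimately show "causal_convergence \<Gamma> \<gamma> c r'"
      using \<gamma>N(1)[OF rin(2)] cA by (simp add: causal_convergence_def charts_at_def)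
  qed
qed

text \<open>Bisection replaces an explicit choice of finitely many charts along the limit geodesic:
  the implication \<open>P\<close> is transitive and holds on all short windows.\<close>

lemma causal_convergence_global:
  assumes nb: "causally_non_branching A g" and ni: "non_intertwining A g"
    and \<Gamma>: "\<And>n. geodesic A g {0..1} (\<Gamma> n)" and \<gamma>: "geodesic A g {0..1} \<gamma>"
    and conv: "causal_convergence \<Gamma> \<gamma> c 0"
  shows "(\<lambda>n. \<Gamma> n 1) \<longlonglongrightarrow> \<gamma> 1"
proof -
  \<comment> \<open>The range conditions are premises because \<open>Bolzano\<close> also considers
    windows that stick out of \<open>{0..1}\<close>. The chart is existentially quantified since the
    two times may need different ones.\<close>
  define P where "P r r' \<longleftrightarrow> (0 \<le> r \<longrightarrow> r' \<le> 1 \<longrightarrow> (\<exists>c. causal_convergence \<Gamma> \<gamma> c r) \<longrightarrow>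
    (\<exists>c. causal_convergence \<Gamma> \<gamma> c r'))" for r r'
  have "P 0 1"
  proof (rule Bolzano[of 0 1 P])
    fix s :: real assume "0 \<le> s" "s \<le> 1"
    then have s: "s \<in> {0..1}" by simp
    obtain c where c: "c \<in> charts_at A (\<gamma> s)" by (rule charts_at_nonempty)
    obtain d1 where d1: "d1 > 0" "\<And>r r'. 0 \<le> r \<Longrightarrow> r \<le> s \<Longrightarrow> s \<le> r' \<Longrightarrow> r' \<le> 1 \<Longrightarrow> r' - r < d1 \<Longrightarrow>
        causal_convergence \<Gamma> \<gamma> c r \<Longrightarrow> causal_convergence \<Gamma> \<gamma> c r'"
      by (rule causal_convergence_local[where \<Gamma> = \<Gamma>, OF nb ni \<Gamma> \<gamma> s c]) (rule that)
    have cs: "c \<in> A" "\<gamma> s \<in> cdom c" using c by (auto simp: charts_at_def)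
    \<comment> \<open>Within \<open>d2\<close> of \<open>s\<close> the limit stays in the chart
      \<open>c\<close>, so convergence known at \<open>r\<close> in any chart can first be moved to
      \<open>c\<close>.\<close>
    obtain d2 where d2: "d2 > 0"
      and near: "\<And>t. t \<in> {0..1} \<Longrightarrow> dist t s < d2 \<Longrightarrow> \<gamma> t \<in> cdom c \<and> pos_vel c \<gamma> t \<in> UNIV"
      by (rule pos_vel_near[OF \<gamma> cs(1) s cs(2) open_UNIV UNIV_I]) (rule that)
    have chart: "c \<in> charts_at A (\<gamma> t)" if "t \<in> {0..1}" "dist t s < d2" for t
      using near[OF that] cs(1) by (simp add: charts_at_def)
    show "\<exists>d>0. \<forall>r r'. r \<le> s \<and> s \<le> r' \<and> r' - r < d \<longrightarrow> P r r'"
    proof (intro exI[of _ "min d1 d2"] conjI allI impI)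
      fix r r' assume r: "r \<le> s \<and> s \<le> r' \<and> r' - r < min d1 d2"
      show "P r r'" unfolding P_def
      proof (intro impI)
        assume r0: "0 \<le> r" "r' \<le> 1" and ex: "\<exists>c. causal_convergence \<Gamma> \<gamma> c r"
        have r01: "r \<in> {0..1}" "dist r s < d2" using r r0 by (auto simp: dist_real_def)
        have "causal_convergence \<Gamma> \<gamma> c r"
          
          using ex causal_convergence_chart[where \<Gamma> = \<Gamma>, OF \<Gamma> \<gamma> r01(1) _ chart[OF r01]] by blast
        then have "causal_convergence \<Gamma> \<gamma> c r'" using d1(2)[of r r'] r r0 by simp
        then show "\<exists>c. causal_convergence \<Gamma> \<gamma> c r'" by (rule exI)
      qed
    qed (use d1(1) d2 in simp)
  qed (auto simp: P_def)
  then obtain c' where "causal_convergence \<Gamma> \<gamma> c' 1"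
    unfolding P_def using conv order_refl by blast
  then show ?thesis by (rule causal_convergence_position)
qed

section \<open>The causal exponential map\<close>

lemma causal_exp_domain_geodesic:
  assumes "maximal_geodesic_from A g p v I \<gamma>" "{0..1} \<subseteq> I"
  shows "geodesic A g {0..1} \<gamma>" "\<gamma> 0 = p"
    "\<And>c. c \<in> charts_at A p \<Longrightarrow> pos_vel c \<gamma> 0 = (cmap c p, v c)"
proof -
  have \<gamma>: "geodesic A g I \<gamma>" "\<gamma> 0 = p" "velocity A I \<gamma> 0 = v"
    using assms(1) by (auto simp: maximal_geodesic_from_def geodesic_from_def)
  have "is_interval {0..1::real}" "interior {0..1::real} \<noteq> {}" by (auto simp: is_interval_cc)
  note sub = geodesic_subset[OF \<gamma>(1) assms(2) this]
  show "geodesic A g {0..1} \<gamma>" "\<gamma> 0 = p" by (fact sub(1), fact \<gamma>(2))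
  fix c assume c: "c \<in> charts_at A p"
  then have "cvel c I \<gamma> 0 = v c" using fun_cong[OF \<gamma>(3), of c] \<gamma>(2) by (simp add: velocity_def)
  moreover have "cvel c {0..1} \<gamma> 0 = cvel c I \<gamma> 0"
    using sub(2)[of c 0] c \<gamma>(2) by (simp add: charts_at_def)
  ultimately show "pos_vel c \<gamma> 0 = (cmap c p, v c)" using \<gamma>(2) by (simp add: pos_vel_def)
qed

text \<open>All curves start at \<open>p\<close>, so convergence of the initial data is convergence
  of the coordinate velocities in one chart.\<close>

lemma maximal_geodesics_tendsto:
  assumes nb: "causally_non_branching A g" and ni: "non_intertwining A g"
    and \<Gamma>: "\<And>n. maximal_geodesic_from A g p (v n) (I n) (\<Gamma> n)" "\<And>n. {0..1} \<subseteq> I n"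
    and \<gamma>: "maximal_geodesic_from A g p w J \<gamma>" "{0..1} \<subseteq> J"
    and w: "w \<in> tangent_space A p" "g p w w \<le> 0"
    and c: "c \<in> charts_at A p" and lim: "(\<lambda>n. v n c) \<longlonglongrightarrow> w c"
  shows "(\<lambda>n. \<Gamma> n 1) \<longlonglongrightarrow> \<gamma> 1"
proof (rule causal_convergence_global[OF nb ni])
  note geo = causal_exp_domain_geodesic[OF \<Gamma>] causal_exp_domain_geodesic[OF \<gamma>]
  show "geodesic A g {0..1} (\<Gamma> n)" for n by (rule geo(1))
  show "geodesic A g {0..1} \<gamma>" by (rule geo(4))
  have cp: "c \<in> A" "p \<in> cdom c" using c by (auto simp: charts_at_def)
  have "gform c (cmap c p) (w c) (w c) \<le> 0"
    using gform_eq[OF cp(1), of "cmap c p"] cp(2) w(2) cinv_cmap[OF c] tvec_of_coords_inverse[OF c w(1)]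
    by simp
  moreover have "(\<lambda>n. (cmap c p, v n c)) \<longlonglongrightarrow> (cmap c p, w c)" by (intro tendsto_intros lim)
  ultimately show "causal_convergence \<Gamma> \<gamma> c 0"
    using c cp geo(3)[OF c] geo(6)[OF c] geo(2,5) by (simp add: causal_convergence_def)
qed

lemma causal_exp_eq:
  assumes nb: "causally_non_branching A g" and ni: "non_intertwining A g"
    and \<gamma>: "maximal_geodesic_from A g p v I \<gamma>" "{0..1} \<subseteq> I"
    and v: "v \<in> tangent_space A p" "g p v v \<le> 0"
  shows "causal_exp A g p v = \<gamma> 1"
  unfolding causal_exp_def
proof (rule the_equality)
  fix q assume "\<exists>I \<gamma>. maximal_geodesic_from A g p v I \<gamma> \<and> {0..1} \<subseteq> I \<and> \<gamma> 1 = q"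
  then obtain J \<sigma> where \<sigma>: "maximal_geodesic_from A g p v J \<sigma>" "{0..1} \<subseteq> J" "\<sigma> 1 = q" by blast
  obtain c where c: "c \<in> charts_at A p" by (rule charts_at_nonempty)
  from maximal_geodesics_tendsto[OF nb ni \<sigma>(1,2) \<gamma> v c tendsto_const]
  have "(\<lambda>n::nat. \<sigma> 1) \<longlonglongrightarrow> \<gamma> 1" .
  then show "q = \<gamma> 1" using \<sigma>(3) by (simp add: LIMSEQ_const_iff)
qed (use \<gamma> in blast)

theorem causal_exp_continuous:
  assumes nb: "causally_non_branching A g" and ni: "non_intertwining A g"
  shows "continuous_on (causal_exp_domain A g p) (causal_exp A g p)"
proof -
  let ?E = "causal_exp_domain A g p"
  obtain c where c: "c \<in> charts_at A p" by (rule charts_at_nonempty)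
  let ?f = "\<lambda>x. causal_exp A g p (tvec_of_coords A c p x)"
  have inv: "tvec_of_coords A c p (v c) = v" if "v \<in> ?E" for v
    using tvec_of_coords_inverse[OF c] that by (simp add: causal_exp_domain_def)
  \<comment> \<open>Tangent vectors are families over all charts, with a product topology that need
    not be first countable. In the coordinates of one chart, continuity can be tested by
    sequences.\<close>
  have "continuous_on ((\<lambda>v. v c) ` ?E) ?f"
  proof (rule continuous_on_sequentiallyI)
    fix x y assume x: "\<forall>n. x n \<in> (\<lambda>v. v c) ` ?E" and y: "y \<in> (\<lambda>v. v c) ` ?E" and lim: "x \<longlonglongrightarrow> y"
    let ?L = "tvec_of_coords A c p"
    have "?L z \<in> ?E" if z: "z \<in> (\<lambda>v. v c) ` ?E" for z
    proof -
      obtain v where "v \<in> ?E" "z = v c" using z by blast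
      then show ?thesis using inv[of v] by simp
    qed
    then have E: "?L (x n) \<in> ?E" "?L y \<in> ?E" for n using x y by simp_all
    have geo: "\<exists>I \<gamma>. maximal_geodesic_from A g p v I \<gamma> \<and> {0..1} \<subseteq> I" "v \<in> tangent_space A p" "g p v v \<le> 0"
      if "v \<in> ?E" for v using that by (auto simp: causal_exp_domain_def)
    obtain I \<Gamma> where \<Gamma>: "\<And>n. maximal_geodesic_from A g p (?L (x n)) (I n) (\<Gamma> n)" "\<And>n. {0..1} \<subseteq> I n"
      using geo(1)[OF E(1)] by metis
    obtain J \<gamma> where \<gamma>: "maximal_geodesic_from A g p (?L y) J \<gamma>" "{0..1} \<subseteq> J"
      using geo(1)[OF E(2)] by blast
    have "(\<lambda>n. \<Gamma> n 1) \<longlonglongrightarrow> \<gamma> 1"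
      using maximal_geodesics_tendsto[OF nb ni \<Gamma> \<gamma> geo(2,3)[OF E(2)] c] lim
      by (simp add: tvec_of_coords_self[OF c])
    then show "(\<lambda>n. ?f (x n)) \<longlonglongrightarrow> ?f y"
      using causal_exp_eq[OF nb ni \<Gamma> geo(2,3)[OF E(1)]] causal_exp_eq[OF nb ni \<gamma> geo(2,3)[OF E(2)]]
      by simp
  qed
  moreover have "continuous_on ?E (\<lambda>v. v c)"
    by (rule continuous_on_subset[OF continuous_on_product_coordinates subset_UNIV])
  ultimately have "continuous_on ?E (\<lambda>v. ?f (v c))" by (rule continuous_on_compose2) simp
  then show ?thesis by (rule continuous_on_eq) (simp add: inv)
qed

end

theorem proposition4p9:
  fixes A :: "('m::{t2_space, second_countable_topology}, 'n::finite) chart set"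
    and g :: "('m, 'n) metric_field"
    and T :: "'m \<Rightarrow> ('m, 'n) tvec"
  assumes "C1_spacetime A g T"
    and "causally_non_branching A g"
    and "non_intertwining A g"
  shows "\<forall>p. continuous_on (causal_exp_domain A g p) (causal_exp A g p)"
  using C1_spacetime.causal_exp_continuous[OF assms] by blast

end
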